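(* Let $\pi$ be an irreducible cuspidal $\psi$-generic representation of $\mathrm{SO}_{2l}$. Then $\gamma(\pi\times\tau,\psi)=\gamma(c\cdot\pi\times\tau,\psi)$ for all irreducible generic representations $\tau$ of $\mathrm{GL}_l$.
   Context: **Groups.** $l$ is a positive integer, $q=p^r$ with $p$ an odd prime, $\psi$ is a fixed nontrivial additive character of $\mathbb{F}_q$; representations are finite-dimensional over $\mathbb{C}$. $\mathrm{GL}_n=\mathrm{GL}_n(\mathbb{F}_q)$; $J_n$ is the $n\times n$ matrix with $1$'s on the antidiagonal and $0$ elsewhere; $\mathrm{SO}_m=\{g\in\mathrm{GL}_m:\det g=1,\ {}^tgJ_mg=J_m\}$ (over $\mathbb{F}_q$). $U_{\mathrm{GL}_l}$, $U_{\mathrm{SO}_{2l}}$ are the upper triangular unipotent subgroups. For $a\in\mathrm{GL}_l$, $a^*=J_l\,{}^ta^{-1}J_l$. **Characters, genericity.** Define $\psi(u)=\psi(\sum_{i=1}^{l-1}u_{i,i+1})$ on $U_{\mathrm{GL}_l}$ and $\psi(u)=\psi\big(\sum_{i=1}^{l-2}u_{i,i+1}+\tfrac14u_{l-1,l}-\tfrac12u_{l-1,l+1}\big)$ on $U_{\mathrm{SO}_{2l}}$. An irreducible representation $\pi$ of $\mathrm{SO}_{2l}$ (resp. $\tau$ of $\mathrm{GL}_l$) is $\psi$-generic if $\mathrm{Hom}_{U_{\mathrm{SO}_{2l}}}(\pi,\psi)\ne0$ (resp. $\mathrm{Hom}_{U_{\mathrm{GL}_l}}(\tau,\psi)\ne0$).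 Fixing a nonzero $\Gamma\in\mathrm{Hom}_{U_{\mathrm{SO}_{2l}}}(\pi,\psi)$ (unique up to scalar), $\mathcal{W}(\pi,\psi)=\{g\mapsto\Gamma(\pi(g)v): v\in\pi\}$. **Outer conjugation.** $c=\mathrm{diag}(I_{l-1},\begin{pmatrix}0&1\\1&0\end{pmatrix},I_{l-1})$ and $(c\cdot\pi)(g)=\pi(cgc)$; $c\cdot\pi$ is again irreducible, cuspidal and $\psi$-generic. **Embedding.** $\mathrm{SO}_{2l}$ embeds in $\mathrm{SO}_{2l+1}$ by $$\begin{pmatrix}A&B\\ C&D\end{pmatrix}\mapsto M^{-1}\begin{pmatrix}A&&B\\ &1&\\ C&&D\end{pmatrix}M,\quad M=\mathrm{diag}(I_{l-1},\tilde M,I_{l-1}),\ \tilde M=\begin{pmatrix}\frac14&\frac12&-\frac12\\ \frac12&0&1\\ -\frac12&1&1\end{pmatrix},$$ with $A,B,C,D$ of size $l\times l$. **Induced spaces.** $Q_l=L_lV_l$ is the standard (block upper triangular) Siegel parabolic of $\mathrm{SO}_{2l+1}$, with Levi $L_l=\{l_l(a)=\mathrm{diag}(a,1,a^* ):a\in\mathrm{GL}_l\}$ and unipotent radical $V_l$. For $\tau$ irreducible generic, $I(\tau)=\mathrm{Ind}_{Q_l}^{\mathrm{SO}_{2l+1}}\tau$ is the space of $\xi:\mathrm{SO}_{2l+1}\to\tau$ with $\xi(l_l(a)ug)=\tau(a)\xi(g)$ for $a\in \mathrm{GL}_l$, $u\in V_l$. Fix $0\ne\Lambda_\tau\in\mathrm{Hom}_{U_{\mathrm{GL}_l}}(\tau,\psi^{-1})$,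 put $f_\xi(g,a)=\Lambda_\tau(\tau(a)\xi(g))$, and let $I(\tau,\psi^{-1})$ be the span of the $f_\xi$. Let $\tau^*(a)=\tau(a^* )$. The intertwining operator $M(\tau,\psi^{-1}):I(\tau,\psi^{-1})\to I(\tau^*,\psi^{-1})$ is $$M(\tau,\psi^{-1})f(h,a)=\sum_{u\in V_l}f(w_luh,d_la^* ),\quad w_l=\begin{pmatrix}&&I_l\\ &(-1)^l&\\ I_l&&\end{pmatrix},\quad d_l=\mathrm{diag}(-1,1,-1,\dots,(-1)^l).$$ **Zeta sums.** For $W\in\mathcal{W}(\pi,\psi)$ and $f\in I(\tau,\psi^{-1})$ or $I(\tau^*,\psi^{-1})$: $\Psi(W,f)=\sum_{g\in U_{\mathrm{SO}_{2l}}\backslash\mathrm{SO}_{2l}}W(g)f(w_{l,l}g,I_l)$ with $w_{l,l}=\mathrm{diag}(\tfrac12I_l,1,2I_l)$. **Gamma factor.** $\gamma(\pi\times\tau,\psi)\in\mathbb{C}$ is the constant such that $\gamma(\pi\times\tau,\psi)\Psi(W,f)=\Psi(W,M(\tau,\psi^{-1})f)$ for all $W\in\mathcal{W}(\pi,\psi)$, $f\in I(\tau,\psi^{-1})$. *)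

theory Defs
  imports
    Jordan_Normal_Form.Determinant
    "HOL-Algebra.Coset"
    "HOL-Library.Function_Algebras"
    "HOL-Library.Cardinality"
    "HOL-Computational_Algebra.Primes"
begin

text \<open>
  Matrices are those of Jordan_Normal_Form, so their entries are indexed from 0: the entry
  $u_{i,j}$ of the usual notation is \<open>u $$ (i - 1, j - 1)\<close>.
\<close>

section \<open>Matrix groups\<close>

definition GL :: "nat \<Rightarrow> 'f::field mat monoid" where
  "GL n = \<lparr>carrier = {g \<in> carrier_mat n n. det g \<noteq> 0}, monoid.mult = (*), one = 1\<^sub>m n\<rparr>"

definition antidiag :: "nat \<Rightarrow> 'f::field mat" where
  "antidiag n = mat n n (\<lambda>(i, j). if i + j + 1 = n then 1 else 0)"

definition SO :: "nat \<Rightarrow> 'f::field mat monoid" where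
  "SO m = \<lparr>carrier = {g \<in> carrier_mat m m.
              det g = 1 \<and> transpose_mat g * antidiag m * g = antidiag m},
           monoid.mult = (*), one = 1\<^sub>m m\<rparr>"

definition U_GL :: "nat \<Rightarrow> 'f::field mat set" where
  "U_GL n = {u \<in> carrier (GL n). upper_triangular u \<and> (\<forall>i<n. u $$ (i, i) = 1)}"

definition U_SO :: "nat \<Rightarrow> 'f::field mat set" where
  "U_SO m = {u \<in> carrier (SO m). upper_triangular u \<and> (\<forall>i<m. u $$ (i, i) = 1)}"

definition star :: "nat \<Rightarrow> 'f::field mat \<Rightarrow> 'f mat" where
  "star l a = antidiag l * inv\<^bsub>GL l\<^esub> (transpose_mat a) * antidiag l"

definition c_mat :: "nat \<Rightarrow> 'f::field mat" where
  "c_mat l = diag_block_mat [1\<^sub>m (l - 1), mat_of_rows_list 2 [[0, 1], [1, 0]], 1\<^sub>m (l - 1)]"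

definition embed_conj :: "nat \<Rightarrow> 'f::field mat" where
  "embed_conj l = diag_block_mat
     [1\<^sub>m (l - 1),
      mat_of_rows_list 3 [[1/4, 1/2, -1/2], [1/2, 0, 1], [-1/2, 1, 1]],
      1\<^sub>m (l - 1)]"

text \<open>Insert a middle row and a middle column, zero except for a 1 at the centre, into a
  matrix of size \<open>2 * l\<close>.\<close>

definition insert_middle :: "nat \<Rightarrow> 'f::field mat \<Rightarrow> 'f mat" where
  "insert_middle l g = mat (2 * l + 1) (2 * l + 1) (\<lambda>(i, j).
     if i = l \<or> j = l then (if i = j then 1 else 0)
     else g $$ (if i < l then i else i - 1, if j < l then j else j - 1))"

definition embed :: "nat \<Rightarrow> 'f::field mat \<Rightarrow> 'f mat" where
  "embed l g = inv\<^bsub>GL (2 * l + 1)\<^esub> (embed_conj l) * insert_middle l g * embed_conj l"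

section \<open>Representations\<close>

text \<open>A representation acts on a whole type, with the scalar multiplication \<open>s\<close>. Its values
  outside the carrier of the group are irrelevant.\<close>

definition representation ::
  "(complex \<Rightarrow> 'v::ab_group_add \<Rightarrow> 'v) \<Rightarrow> 'g monoid \<Rightarrow> ('g \<Rightarrow> 'v \<Rightarrow> 'v) \<Rightarrow> bool" where
  "representation s G \<rho> \<longleftrightarrow>
     (\<exists>B. finite_dimensional_vector_space s B) \<and>
     (\<forall>g\<in>carrier G. Vector_Spaces.linear s s (\<rho> g)) \<and>
     \<rho> \<one>\<^bsub>G\<^esub> = id \<and>
     (\<forall>g\<in>carrier G. \<forall>h\<in>carrier G. \<rho> (g \<otimes>\<^bsub>G\<^esub> h) = \<rho> g \<circ> \<rho> h)"

definition irreducible_rep ::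
  "(complex \<Rightarrow> 'v::ab_group_add \<Rightarrow> 'v) \<Rightarrow> 'g monoid \<Rightarrow> ('g \<Rightarrow> 'v \<Rightarrow> 'v) \<Rightarrow> bool" where
  "irreducible_rep s G \<rho> \<longleftrightarrow>
     representation s G \<rho> \<and> (UNIV :: 'v set) \<noteq> {0} \<and>
     (\<forall>S. module.subspace s S \<and> (\<forall>g\<in>carrier G. \<rho> g ` S \<subseteq> S) \<longrightarrow> S = {0} \<or> S = UNIV)"

definition Hom_char ::
  "(complex \<Rightarrow> 'v::ab_group_add \<Rightarrow> 'v) \<Rightarrow> ('g \<Rightarrow> 'v \<Rightarrow> 'v) \<Rightarrow> 'g set \<Rightarrow> ('g \<Rightarrow> complex)
     \<Rightarrow> ('v \<Rightarrow> complex) set" where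
  "Hom_char s \<rho> U \<chi> =
     {\<Gamma>. Vector_Spaces.linear s (*) \<Gamma> \<and> (\<forall>u\<in>U. \<forall>v. \<Gamma> (\<rho> u v) = \<chi> u * \<Gamma> v)}"

definition outer_conj :: "nat \<Rightarrow> ('f::field mat \<Rightarrow> 'v \<Rightarrow> 'v) \<Rightarrow> 'f mat \<Rightarrow> 'v \<Rightarrow> 'v" where
  "outer_conj l \<pi> g = \<pi> (c_mat l * g * c_mat l)"

section \<open>Cuspidality\<close>

definition borel_SO :: "nat \<Rightarrow> 'f::field mat set" where
  "borel_SO m = {b \<in> carrier (SO m). upper_triangular b}"

text \<open>The parabolic subgroups are the subgroups that contain a conjugate of the Borel subgroup.\<close>

definition parabolic_SO :: "nat \<Rightarrow> 'f::field mat set \<Rightarrow> bool" where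
  "parabolic_SO m P \<longleftrightarrow> subgroup P (SO m) \<and>
     (\<exists>x\<in>carrier (SO m). \<forall>b\<in>borel_SO m. x * b * inv\<^bsub>SO m\<^esub> x \<in> P)"

text \<open>The unipotent radical is the largest normal subgroup consisting of unipotent matrices; over
  a finite field this is the largest normal \<open>p\<close>-subgroup, so the union below is such a subgroup.\<close>

definition unipotent_mat :: "nat \<Rightarrow> 'f::field mat \<Rightarrow> bool" where
  "unipotent_mat m u \<longleftrightarrow> (u - 1\<^sub>m m) ^\<^sub>m m = 0\<^sub>m m m"

definition unipotent_radical_SO :: "nat \<Rightarrow> 'f::field mat set \<Rightarrow> 'f mat set" where
  "unipotent_radical_SO m P =
     \<Union>{N. N \<lhd> (SO m)\<lparr>carrier := P\<rparr> \<and> (\<forall>u\<in>N. unipotent_mat m u)}"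

definition cuspidal_SO :: "nat \<Rightarrow> ('f::field mat \<Rightarrow> 'v::ab_group_add \<Rightarrow> 'v) \<Rightarrow> bool" where
  "cuspidal_SO m \<pi> \<longleftrightarrow>
     (\<forall>P. parabolic_SO m P \<and> P \<noteq> carrier (SO m) \<longrightarrow>
        (\<forall>v. (\<forall>u\<in>unipotent_radical_SO m P. \<pi> u v = v) \<longrightarrow> v = 0))"

section \<open>Characters and genericity\<close>

definition additive_character :: "('f::field \<Rightarrow> complex) \<Rightarrow> bool" where
  "additive_character \<psi> \<longleftrightarrow> \<psi> 0 = 1 \<and> (\<forall>x y. \<psi> (x + y) = \<psi> x * \<psi> y)"

definition psi_GL :: "('f::field \<Rightarrow> complex) \<Rightarrow> nat \<Rightarrow> 'f mat \<Rightarrow> complex" where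
  "psi_GL \<psi> l u = \<psi> (\<Sum>i<l - 1. u $$ (i, i + 1))"

text \<open>For \<open>l = 1\<close> the group \<open>U_SO (2 * l)\<close> is trivial, and so is the character.\<close>

definition psi_SO :: "('f::field \<Rightarrow> complex) \<Rightarrow> nat \<Rightarrow> 'f mat \<Rightarrow> complex" where
  "psi_SO \<psi> l u =
     (if l = 1 then 1
      else \<psi> ((\<Sum>i<l - 2. u $$ (i, i + 1)) + 1/4 * u $$ (l - 2, l - 1) - 1/2 * u $$ (l - 2, l)))"

definition generic_GL ::
  "('f::field \<Rightarrow> complex) \<Rightarrow> nat \<Rightarrow> (complex \<Rightarrow> 'w::ab_group_add \<Rightarrow> 'w)
     \<Rightarrow> ('f mat \<Rightarrow> 'w \<Rightarrow> 'w) \<Rightarrow> bool" where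
  "generic_GL \<psi> l s \<tau> \<longleftrightarrow> (\<exists>\<Lambda>\<in>Hom_char s \<tau> (U_GL l) (psi_GL \<psi> l). \<Lambda> \<noteq> (\<lambda>_. 0))"

definition generic_SO ::
  "('f::field \<Rightarrow> complex) \<Rightarrow> nat \<Rightarrow> (complex \<Rightarrow> 'v::ab_group_add \<Rightarrow> 'v)
     \<Rightarrow> ('f mat \<Rightarrow> 'v \<Rightarrow> 'v) \<Rightarrow> bool" where
  "generic_SO \<psi> l s \<pi> \<longleftrightarrow> (\<exists>\<Gamma>\<in>Hom_char s \<pi> (U_SO (2 * l)) (psi_SO \<psi> l). \<Gamma> \<noteq> (\<lambda>_. 0))"

text \<open>By multiplicity one a nonzero \<open>\<Gamma>\<close> is unique up to a scalar, so every choice of it gives the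
  same set of functions; ranging over all choices avoids singling one out. The functions are only
  meaningful on \<open>SO (2 * l)\<close>.\<close>

definition whittaker_SO ::
  "('f::field \<Rightarrow> complex) \<Rightarrow> nat \<Rightarrow> (complex \<Rightarrow> 'v::ab_group_add \<Rightarrow> 'v)
     \<Rightarrow> ('f mat \<Rightarrow> 'v \<Rightarrow> 'v) \<Rightarrow> ('f mat \<Rightarrow> complex) set" where
  "whittaker_SO \<psi> l s \<pi> =
     {\<lambda>g. \<Gamma> (\<pi> g v) | \<Gamma> v. \<Gamma> \<in> Hom_char s \<pi> (U_SO (2 * l)) (psi_SO \<psi> l) \<and> \<Gamma> \<noteq> (\<lambda>_. 0)}"

section \<open>Induction from the Siegel parabolic subgroup\<close>

definition siegel_levi :: "nat \<Rightarrow> 'f::field mat \<Rightarrow> 'f mat" where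
  "siegel_levi l a = diag_block_mat [a, 1\<^sub>m 1, star l a]"

definition siegel_block :: "nat \<Rightarrow> nat \<Rightarrow> nat" where
  "siegel_block l i = (if i < l then 0 else if i = l then 1 else 2)"

text \<open>Block upper triangular elements, for the block sizes \<open>l\<close>, 1, \<open>l\<close>, with identity diagonal
  blocks.\<close>

definition siegel_unip :: "nat \<Rightarrow> 'f::field mat set" where
  "siegel_unip l = {u \<in> carrier (SO (2 * l + 1)).
     \<forall>i<2 * l + 1. \<forall>j<2 * l + 1.
       siegel_block l j \<le> siegel_block l i \<longrightarrow> u $$ (i, j) = (if i = j then 1 else 0)}"

text \<open>The functions below are only meaningful on \<open>SO (2 * l + 1)\<close>, and their second argument on
  \<open>GL l\<close>; other values are unconstrained and never used.\<close>

definition induced_space :: "nat \<Rightarrow> ('f::field mat \<Rightarrow> 'w \<Rightarrow> 'w) \<Rightarrow> ('f mat \<Rightarrow> 'w) set" where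
  "induced_space l \<tau> = {\<xi>. \<forall>a\<in>carrier (GL l). \<forall>u\<in>siegel_unip l. \<forall>g\<in>carrier (SO (2 * l + 1)).
     \<xi> (siegel_levi l a * u * g) = \<tau> a (\<xi> g)}"

text \<open>The nonzero \<open>\<Lambda>\<close> is again unique up to a scalar.\<close>

definition induced_whittaker ::
  "('f::field \<Rightarrow> complex) \<Rightarrow> nat \<Rightarrow> (complex \<Rightarrow> 'w::ab_group_add \<Rightarrow> 'w)
     \<Rightarrow> ('f mat \<Rightarrow> 'w \<Rightarrow> 'w) \<Rightarrow> ('f mat \<Rightarrow> 'f mat \<Rightarrow> complex) set" where
  "induced_whittaker \<psi> l s \<tau> =
     module.span (\<lambda>z F g a. z * F g a)
       {\<lambda>g a. \<Lambda> (\<tau> a (\<xi> g)) | \<Lambda> \<xi>.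
          \<Lambda> \<in> Hom_char s \<tau> (U_GL l) (psi_GL \<psi> l) \<and> \<Lambda> \<noteq> (\<lambda>_. 0) \<and> \<xi> \<in> induced_space l \<tau>}"

definition w_mat :: "nat \<Rightarrow> 'f::field mat" where
  "w_mat l = mat (2 * l + 1) (2 * l + 1) (\<lambda>(i, j).
     if i = l \<and> j = l then (-1) ^ l
     else if j = i + l + 1 \<or> i = j + l + 1 then 1 else 0)"

definition d_mat :: "nat \<Rightarrow> 'f::field mat" where
  "d_mat l = mat l l (\<lambda>(i, j). if i = j then (-1) ^ (i + 1) else 0)"

definition intertwining ::
  "nat \<Rightarrow> ('f::field mat \<Rightarrow> 'f mat \<Rightarrow> complex) \<Rightarrow> 'f mat \<Rightarrow> 'f mat \<Rightarrow> complex" where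
  "intertwining l f h a = (\<Sum>u\<in>siegel_unip l. f (w_mat l * u * h) (d_mat l * star l a))"

section \<open>Zeta sums and the gamma factor\<close>

definition wll_mat :: "nat \<Rightarrow> 'f::field mat" where
  "wll_mat l = diag_block_mat [(1/2) \<cdot>\<^sub>m 1\<^sub>m l, 1\<^sub>m 1, 2 \<cdot>\<^sub>m 1\<^sub>m l]"

text \<open>The cosets \<open>U g\<close> are the right cosets of HOL-Algebra. For \<open>W\<close> in a Whittaker model and
  \<open>f\<close> in one of the induced spaces the summand does not depend on the representative.\<close>

definition zeta_sum ::
  "nat \<Rightarrow> ('f::field mat \<Rightarrow> complex) \<Rightarrow> ('f mat \<Rightarrow> 'f mat \<Rightarrow> complex) \<Rightarrow> complex" where
  "zeta_sum l W f =
     (\<Sum>C\<in>rcosets\<^bsub>SO (2 * l)\<^esub> (U_SO (2 * l)).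
        let g = (SOME g. g \<in> C) in W g * f (wll_mat l * embed l g) (1\<^sub>m l))"

definition gamma_factor ::
  "('f::field \<Rightarrow> complex) \<Rightarrow> nat
     \<Rightarrow> (complex \<Rightarrow> 'v::ab_group_add \<Rightarrow> 'v) \<Rightarrow> ('f mat \<Rightarrow> 'v \<Rightarrow> 'v)
     \<Rightarrow> (complex \<Rightarrow> 'w::ab_group_add \<Rightarrow> 'w) \<Rightarrow> ('f mat \<Rightarrow> 'w \<Rightarrow> 'w) \<Rightarrow> complex" where
  "gamma_factor \<psi> l sV \<pi> sW \<tau> =
     (THE \<gamma>. \<forall>W\<in>whittaker_SO \<psi> l sV \<pi>.
              \<forall>f\<in>induced_whittaker (\<lambda>x. inverse (\<psi> x)) l sW \<tau>.
                \<gamma> * zeta_sum l W f = zeta_sum l W (intertwining l f))"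

end

theory Submission
  imports Defs
begin

text \<open>
  Write \<open>E\<close> for the embedding of the even orthogonal group in the odd one, \<open>z\<close> for the Levi element of the
  scalar \<open>- 1\<close>, and \<open>\<rho>\<close> for the reflection \<open>whittaker_reflection l\<close> of the middle hyperbolic plane.

  Conjugation by \<open>c\<close> need not respect the generic character of the unipotent group, but \<open>\<rho>\<close>, which differs
  from \<open>c\<close> by a diagonal element of the special orthogonal group, does (\<open>U_SO_rho_conj\<close>). Therefore
  \<open>W \<mapsto> (g \<mapsto> W (\<rho> * g * c))\<close> matches the Whittaker model of \<open>\<pi>\<close> with that of \<open>c \<cdot> \<pi>\<close>
  (\<open>whittaker_SO_outer_conj\<close>). Substituting \<open>g = \<rho> * h * c\<close> in the zeta sum of such a partner of \<open>W\<close> restores \<open>W\<close>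
  and changes the argument of \<open>f\<close>. The embedding extends to all orthogonal matrices, and the matrix used to
  define it is adapted to the character in such a way that \<open>E \<rho> = - z\<close> (\<open>embed_rho\<close>). So
  \<open>E (\<rho> * h * c) = z * E h * x\<close> for a fixed element \<open>x\<close> of the odd special orthogonal group, and the zeta sum
  becomes the zeta sum of \<open>W\<close> and the twisted function \<open>(g, a) \<mapsto> f (z * g * x, a)\<close> (\<open>zeta_sum_reflected\<close>).

  Because \<open>z\<close> is central in the Levi subgroup and commutes with the Weyl element, the twist maps the induced
  space to itself (\<open>twist_induced_whittaker\<close>) and commutes with the intertwining operator
  (\<open>intertwining_twist\<close>). Hence a constant satisfies all functional equations for \<open>\<pi>\<close> if and only if it
  satisfies all those for \<open>c \<cdot> \<pi>\<close>, and the two gamma factors are defined by the same condition.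

  The substitution is carried out in a sum over the whole group. For this the summand of the zeta sum has to
  be constant on cosets, both for \<open>f\<close> and for its image under the intertwining operator. The first case
  rests on \<open>embed_U_SO_decomposition\<close>: an embedded unipotent element has a unitriangular Levi part with the
  same value of the character. The second case is \<open>siegel_equivariant_intertwining\<close>, where the
  Weyl element replaces \<open>a\<close> by \<open>a\<^sup>*\<close> and the sign matrix \<open>d\<^sub>l\<close> restores the character.
\<close>

section \<open>Transposition in the antidiagonal\<close>

lemma index_mult_sum:
  assumes "A \<in> carrier_mat n m" "B \<in> carrier_mat m k" "i < n" "j < k"
  shows "(A * B) $$ (i, j) = (\<Sum>t<m. A $$ (i, t) * B $$ (t, j))"
  using assms by (auto simp: scalar_prod_def atLeast0LessThan)

text \<open>Finiteness of the matrix groups makes the coset sums of the zeta sum into averages over the whole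
  group.\<close>

lemma finite_carrier_mat: "finite (carrier_mat n m :: 'a::finite mat set)"
proof (rule finite_subset)
  show "carrier_mat n m \<subseteq> mat n m ` (({..<n} \<times> {..<m}) \<rightarrow>\<^sub>E (UNIV :: 'a set))"
  proof
    fix A :: "'a mat" assume A: "A \<in> carrier_mat n m"
    have "A = mat n m (restrict (($$) A) ({..<n} \<times> {..<m}))"
      using A by (intro eq_matI) auto
    moreover have "restrict (($$) A) ({..<n} \<times> {..<m}) \<in> ({..<n} \<times> {..<m}) \<rightarrow>\<^sub>E UNIV"
      by auto
    ultimately show "A \<in> mat n m ` (({..<n} \<times> {..<m}) \<rightarrow>\<^sub>E (UNIV :: 'a set))"
      by (rule image_eqI)
  qed
qed (auto intro!: finite_imageI finite_PiE)

text \<open>For square matrices this is \<open>J * A\<^sup>T * J\<close>, the adjoint of \<open>A\<close> for the symmetric form with Gram matrix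
  \<open>J\<close>. Elements of the orthogonal group are the matrices inverted by it, and the entrywise formula is
  more convenient than the product.\<close>

definition flip :: "'a mat \<Rightarrow> 'a mat" where
  "flip A = mat (dim_col A) (dim_row A)
     (\<lambda>(i, j). A $$ (dim_row A - 1 - j, dim_col A - 1 - i))"

lemma flip_carrier [simp]: "A \<in> carrier_mat n m \<Longrightarrow> flip A \<in> carrier_mat m n"
  by (auto simp: flip_def)

lemma dim_flip [simp]: "dim_row (flip A) = dim_col A" "dim_col (flip A) = dim_row A"
  by (simp_all add: flip_def)

lemma flip_index:
  "A \<in> carrier_mat n m \<Longrightarrow> i < m \<Longrightarrow> j < n \<Longrightarrow> flip A $$ (i, j) = A $$ (n - 1 - j, m - 1 - i)"
  by (auto simp: flip_def)

lemma flip_flip [simp]: "A \<in> carrier_mat n m \<Longrightarrow> flip (flip A) = A"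
  by (intro eq_matI) (auto simp: flip_def)

lemma flip_one [simp]: "flip (1\<^sub>m n) = 1\<^sub>m n"
  by (intro eq_matI) (auto simp: flip_def)

lemma flip_mult:
  fixes A B :: "'a::comm_semiring_0 mat"
  assumes A: "A \<in> carrier_mat n m" and B: "B \<in> carrier_mat m k"
  shows "flip (A * B) = flip B * flip A"
proof (rule eq_matI)
  fix i j assume "i < dim_row (flip B * flip A)" "j < dim_col (flip B * flip A)"
  then have i: "i < k" and j: "j < n" using A B by (auto simp: flip_def)
  have "(flip B * flip A) $$ (i, j) = (\<Sum>t<m. flip B $$ (i, t) * flip A $$ (t, j))"
    using A B i j by (intro index_mult_sum[where n = k and m = m and k = n]) auto
  also have "\<dots> = (\<Sum>t<m. A $$ (n - 1 - j, m - Suc t) * B $$ (m - Suc t, k - 1 - i))"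
    using A B i j by (intro sum.cong) (auto simp: flip_index[OF A] flip_index[OF B] mult.commute)
  also have "\<dots> = (\<Sum>t<m. A $$ (n - 1 - j, t) * B $$ (t, k - 1 - i))"
    by (rule sum.nat_diff_reindex)
  also have "\<dots> = (A * B) $$ (n - 1 - j, k - 1 - i)"
    using A B i j by (intro index_mult_sum[symmetric, where n = n and m = m and k = k]) auto
  also have "\<dots> = flip (A * B) $$ (i, j)"
    using A B i j by (subst flip_index[where n = n and m = k]) auto
  finally show "flip (A * B) $$ (i, j) = (flip B * flip A) $$ (i, j)" by simp
qed (use A B in \<open>auto simp: flip_def\<close>)

lemma antidiag_carrier [simp]: "antidiag n \<in> carrier_mat n n"
  by (auto simp: antidiag_def)

lemma dim_antidiag [simp]: "dim_row (antidiag n) = n" "dim_col (antidiag n) = n"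
  by (simp_all add: antidiag_def)

lemma antidiag_mult_index:
  assumes "A \<in> carrier_mat n m" "i < n" "j < m"
  shows "(antidiag n * A) $$ (i, j) = A $$ (n - 1 - i, j)"
proof -
  have "(antidiag n * A) $$ (i, j) = (\<Sum>t<n. antidiag n $$ (i, t) * A $$ (t, j))"
    using assms by (intro index_mult_sum) auto
  also have "\<dots> = (\<Sum>t<n. if n - 1 - i = t then A $$ (t, j) else 0)"
    using assms by (intro sum.cong) (auto simp: antidiag_def)
  finally show ?thesis using assms by simp
qed

lemma mult_antidiag_index:
  assumes "A \<in> carrier_mat m n" "i < m" "j < n"
  shows "(A * antidiag n) $$ (i, j) = A $$ (i, n - 1 - j)"
proof -
  have "(A * antidiag n) $$ (i, j) = (\<Sum>t<n. A $$ (i, t) * antidiag n $$ (t, j))"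
    using assms by (intro index_mult_sum) auto
  also have "\<dots> = (\<Sum>t<n. if n - 1 - j = t then A $$ (i, t) else 0)"
    using assms by (intro sum.cong) (auto simp: antidiag_def)
  finally show ?thesis using assms by simp
qed

lemma antidiag_square: "antidiag n * antidiag n = 1\<^sub>m n"
proof (rule eq_matI)
  fix i j assume "i < dim_row (1\<^sub>m n :: 'a mat)" "j < dim_col (1\<^sub>m n :: 'a mat)"
  then have "i < n" "j < n" by auto
  then show "(antidiag n * antidiag n) $$ (i, j) = (1\<^sub>m n :: 'a mat) $$ (i, j)"
    by (subst antidiag_mult_index[where m = n]) (auto simp: antidiag_def)
qed auto

lemma antidiag_transpose_antidiag:
  assumes "A \<in> carrier_mat n n"
  shows "antidiag n * transpose_mat A * antidiag n = flip A"
proof (rule eq_matI)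
  fix i j assume "i < dim_row (flip A)" "j < dim_col (flip A)"
  then have i: "i < n" and j: "j < n" using assms by auto
  have "(antidiag n * transpose_mat A * antidiag n) $$ (i, j) =
      (antidiag n * transpose_mat A) $$ (i, n - 1 - j)"
    using assms i j by (intro mult_antidiag_index[where m = n] mult_carrier_mat) auto
  also have "\<dots> = transpose_mat A $$ (n - 1 - i, n - 1 - j)"
    using assms i j by (intro antidiag_mult_index[where m = n]) auto
  also have "\<dots> = flip A $$ (i, j)"
    using assms i j by (simp add: flip_index)
  finally show "(antidiag n * transpose_mat A * antidiag n) $$ (i, j) = flip A $$ (i, j)" .
qed (use assms in auto)

section \<open>The orthogonal and general linear groups\<close>

text \<open>With a single size the premises leave no dimension undetermined, so the rule can rewrite.\<close>

lemma assoc_mult_square: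
  "A \<in> carrier_mat n n \<Longrightarrow> B \<in> carrier_mat n n \<Longrightarrow> C \<in> carrier_mat n n \<Longrightarrow> A * B * C = A * (B * C)"
  for A :: "'a::semiring_0 mat"
  by (rule assoc_mult_mat)

lemma mult_square_carrier:
  "A \<in> carrier_mat n n \<Longrightarrow> B \<in> carrier_mat n n \<Longrightarrow> A * B \<in> carrier_mat n n"
  by (rule mult_carrier_mat)

text \<open>Multiply by \<open>J\<close>, which is its own inverse.\<close>

lemma form_iff_flip:
  assumes g: "g \<in> carrier_mat n n"
  shows "transpose_mat g * antidiag n * g = antidiag n \<longleftrightarrow> flip g * g = 1\<^sub>m n"
proof
  let ?J = "antidiag n :: 'a mat"
  have J: "?J \<in> carrier_mat n n" by simp
  have gt: "transpose_mat g \<in> carrier_mat n n" using g by simp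
  have eq: "flip g * g = ?J * (transpose_mat g * ?J * g)"
    unfolding antidiag_transpose_antidiag[OF g, symmetric]
    using g gt J by (simp add: assoc_mult_square[of _ n] mult_square_carrier[of _ n])
  show "flip g * g = 1\<^sub>m n" if "transpose_mat g * ?J * g = ?J"
    unfolding eq that by (rule antidiag_square)
  show "transpose_mat g * ?J * g = ?J" if "flip g * g = 1\<^sub>m n"
  proof -
    have "?J * (?J * (transpose_mat g * ?J * g)) = ?J * 1\<^sub>m n"
      using eq that by simp
    moreover have "?J * (?J * (transpose_mat g * ?J * g)) = ?J * ?J * (transpose_mat g * ?J * g)"
      using g gt J by (intro assoc_mult_square[of _ n, symmetric] mult_square_carrier)
    moreover have "transpose_mat g * ?J * g \<in> carrier_mat n n"
      using g gt J by (intro mult_square_carrier)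
    ultimately show ?thesis using J by (simp add: antidiag_square left_mult_one_mat[of _ n n])
  qed
qed

lemma mem_SO_iff:
  "g \<in> carrier (SO n) \<longleftrightarrow> g \<in> carrier_mat n n \<and> det g = 1 \<and> flip g * g = 1\<^sub>m n"
  by (auto simp: SO_def form_iff_flip)

lemma SO_simps [simp]: "mult (SO n) = (*)" "one (SO n) = 1\<^sub>m n"
  by (simp_all add: SO_def)

lemma GL_simps [simp]: "mult (GL n) = (*)" "one (GL n) = 1\<^sub>m n"
  by (simp_all add: GL_def)

lemma SO_carrier: "g \<in> carrier (SO n) \<Longrightarrow> g \<in> carrier_mat n n"
  by (simp add: mem_SO_iff)

lemma flip_right_inverse:
  fixes g :: "'a::field mat"
  assumes "g \<in> carrier_mat n n" "flip g * g = 1\<^sub>m n"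
  shows "g * flip g = 1\<^sub>m n"
  using assms by (auto intro: mat_mult_left_right_inverse[where n = n and A = "flip g"])

lemma flip_mult_orthogonal:
  fixes g h :: "'a::field mat"
  assumes g: "g \<in> carrier_mat n n" "flip g * g = 1\<^sub>m n"
    and h: "h \<in> carrier_mat n n" "flip h * h = 1\<^sub>m n"
  shows "flip (g * h) * (g * h) = 1\<^sub>m n"
proof -
  have "flip (g * h) * (g * h) = flip h * (flip g * g) * h"
    unfolding flip_mult[OF g(1) h(1)] using g(1) h(1)
    by (simp add: assoc_mult_square[of _ n] mult_square_carrier[of _ n])
  then show ?thesis using g h by simp
qed

lemma SO_mult: "g \<in> carrier (SO n) \<Longrightarrow> h \<in> carrier (SO n) \<Longrightarrow> g * h \<in> carrier (SO n)"
  by (auto simp: mem_SO_iff det_mult flip_mult_orthogonal)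

lemma SO_flip:
  assumes "g \<in> carrier (SO n)" shows "flip g \<in> carrier (SO n)"
proof -
  have g: "g \<in> carrier_mat n n" "det g = 1" "flip g * g = 1\<^sub>m n"
    using assms by (auto simp: mem_SO_iff)
  have "det (flip g) * det g = 1"
    using g by (subst det_mult[symmetric, where n = n]) auto
  then show ?thesis using g by (auto simp: mem_SO_iff flip_right_inverse)
qed

lemma SO_group: "group (SO n)"
proof (rule groupI)
  fix g :: "'a mat" assume "g \<in> carrier (SO n)"
  then show "\<exists>h\<in>carrier (SO n). h \<otimes>\<^bsub>SO n\<^esub> g = \<one>\<^bsub>SO n\<^esub>"
    by (intro bexI[of _ "flip g"] SO_flip) (auto simp: mem_SO_iff)
next
  fix x y z :: "'a mat" assume "x \<in> carrier (SO n)" "y \<in> carrier (SO n)" "z \<in> carrier (SO n)"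
  then show "x \<otimes>\<^bsub>SO n\<^esub> y \<otimes>\<^bsub>SO n\<^esub> z = x \<otimes>\<^bsub>SO n\<^esub> (y \<otimes>\<^bsub>SO n\<^esub> z)"
    by (auto simp: mem_SO_iff intro: assoc_mult_mat)
next
  fix x :: "'a mat" assume "x \<in> carrier (SO n)"
  then show "\<one>\<^bsub>SO n\<^esub> \<otimes>\<^bsub>SO n\<^esub> x = x"
    using left_mult_one_mat by (auto simp: mem_SO_iff)
qed (simp_all add: SO_mult, simp add: mem_SO_iff)

lemma SO_inv: "g \<in> carrier (SO n) \<Longrightarrow> inv\<^bsub>SO n\<^esub> g = flip g"
  by (intro group.inv_equality[OF SO_group] SO_flip) (auto simp: mem_SO_iff)

lemma mem_GL_iff: "g \<in> carrier (GL n) \<longleftrightarrow> g \<in> carrier_mat n n \<and> det g \<noteq> 0"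
  by (auto simp: GL_def)

lemma mem_GL_of_inverse:
  fixes A B :: "'a::field mat"
  assumes "A \<in> carrier_mat n n" "B \<in> carrier_mat n n" "B * A = 1\<^sub>m n"
  shows "A \<in> carrier (GL n)" "B \<in> carrier (GL n)"
proof -
  have "det B * det A = 1" using assms by (subst det_mult[symmetric, where n = n]) auto
  then show "A \<in> carrier (GL n)" "B \<in> carrier (GL n)" using assms by (auto simp: mem_GL_iff)
qed

lemma GL_inverse:
  fixes A :: "'a::field mat"
  assumes "A \<in> carrier (GL n)"
  obtains B where "B \<in> carrier (GL n)" "B * A = 1\<^sub>m n" "A * B = 1\<^sub>m n"
proof -
  have "A \<in> Units (ring_mat TYPE('a) n ())"
    using assms by (intro det_non_zero_imp_unit) (auto simp: mem_GL_iff)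
  then obtain B where "B \<in> carrier_mat n n" "B * A = 1\<^sub>m n" "A * B = 1\<^sub>m n"
    unfolding Units_def ring_mat_def by auto
  then show thesis using that mem_GL_of_inverse[of A n B] assms by (auto simp: mem_GL_iff)
qed

lemma GL_mult: "g \<in> carrier (GL n) \<Longrightarrow> h \<in> carrier (GL n) \<Longrightarrow> g * h \<in> carrier (GL n)"
  by (auto simp: mem_GL_iff det_mult)

lemma GL_group: "group (GL n)"
proof (rule groupI)
  fix g :: "'a mat" assume "g \<in> carrier (GL n)"
  then show "\<exists>h\<in>carrier (GL n). h \<otimes>\<^bsub>GL n\<^esub> g = \<one>\<^bsub>GL n\<^esub>"
    by (rule GL_inverse) auto
next
  fix x y z :: "'a mat" assume "x \<in> carrier (GL n)" "y \<in> carrier (GL n)" "z \<in> carrier (GL n)"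
  then show "x \<otimes>\<^bsub>GL n\<^esub> y \<otimes>\<^bsub>GL n\<^esub> z = x \<otimes>\<^bsub>GL n\<^esub> (y \<otimes>\<^bsub>GL n\<^esub> z)"
    by (auto simp: mem_GL_iff intro: assoc_mult_mat)
next
  fix x :: "'a mat" assume "x \<in> carrier (GL n)"
  then show "\<one>\<^bsub>GL n\<^esub> \<otimes>\<^bsub>GL n\<^esub> x = x"
    using left_mult_one_mat by (auto simp: mem_GL_iff)
qed (simp_all add: GL_mult, simp add: mem_GL_iff)

lemma GL_inv:
  assumes "A \<in> carrier_mat n n" "B \<in> carrier_mat n n" "B * A = 1\<^sub>m n"
  shows "inv\<^bsub>GL n\<^esub> A = B"
  using mem_GL_of_inverse[OF assms] assms by (intro group.inv_equality[OF GL_group]) auto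

text \<open>Replaces the inverse in the definition of \<open>a\<^sup>*\<close> by any matrix known to be inverse to \<open>a\<close>.\<close>

lemma star_eq_flip:
  fixes a b :: "'a::field mat"
  assumes a: "a \<in> carrier_mat l l" and b: "b \<in> carrier_mat l l" and ba: "b * a = 1\<^sub>m l"
  shows "star l a = flip b"
proof -
  have "transpose_mat b * transpose_mat a = transpose_mat (a * b)"
    using a b by (simp add: transpose_mult)
  also have "a * b = 1\<^sub>m l" by (rule mat_mult_left_right_inverse[OF b a ba])
  finally have "inv\<^bsub>GL l\<^esub> (transpose_mat a) = transpose_mat b"
    using a b by (intro GL_inv) auto
  then show ?thesis by (simp add: star_def antidiag_transpose_antidiag[OF b])
qed

section \<open>Matrices that are trivial outside a middle block\<close>

text \<open>The rows and columns \<open>lo, \<dots>, hi - 1\<close> carry an arbitrary block. The outer element, the reflection and the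
  conjugating matrix of the embedding all have this shape, so products with them involve at most three
  terms per entry.\<close>

definition block_id :: "nat \<Rightarrow> nat \<Rightarrow> nat \<Rightarrow> 'a::{zero,one} mat \<Rightarrow> bool" where
  "block_id lo hi n A \<longleftrightarrow> A \<in> carrier_mat n n \<and>
     (\<forall>i<n. \<forall>j<n. \<not> (lo \<le> i \<and> i < hi \<and> lo \<le> j \<and> j < hi) \<longrightarrow> A $$ (i, j) = (if i = j then 1 else 0))"

lemma block_id_carrier: "block_id lo hi n A \<Longrightarrow> A \<in> carrier_mat n n"
  by (simp add: block_id_def)

lemma block_id_index:
  "block_id lo hi n A \<Longrightarrow> i < n \<Longrightarrow> j < n \<Longrightarrow> \<not> (lo \<le> i \<and> i < hi \<and> lo \<le> j \<and> j < hi)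
    \<Longrightarrow> A $$ (i, j) = (if i = j then 1 else 0)"
  by (simp add: block_id_def)

lemma block_id_mult_index:
  fixes A B :: "'a::comm_ring_1 mat"
  assumes A: "block_id lo hi n A" and B: "B \<in> carrier_mat n m" and i: "i < n" and j: "j < m"
    and hi: "hi \<le> n"
  shows "(A * B) $$ (i, j) =
    (if lo \<le> i \<and> i < hi then \<Sum>t\<in>{lo..<hi}. A $$ (i, t) * B $$ (t, j) else B $$ (i, j))"
proof -
  note AC = block_id_carrier[OF A]
  have eq: "(A * B) $$ (i, j) = (\<Sum>t<n. A $$ (i, t) * B $$ (t, j))"
    using AC B i j by (intro index_mult_sum)
  show ?thesis
  proof (cases "lo \<le> i \<and> i < hi")
    case True
    have "(\<Sum>t<n. A $$ (i, t) * B $$ (t, j)) = (\<Sum>t\<in>{lo..<hi}. A $$ (i, t) * B $$ (t, j))"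
      using True hi i by (intro sum.mono_neutral_right) (auto simp: block_id_index[OF A])
    then show ?thesis using True eq by simp
  next
    case False
    have "(\<Sum>t<n. A $$ (i, t) * B $$ (t, j)) = (\<Sum>t<n. if i = t then B $$ (t, j) else 0)"
      using False i by (intro sum.cong) (auto simp: block_id_index[OF A])
    then show ?thesis using False eq i by auto
  qed
qed

lemma mult_block_id_index:
  fixes A B :: "'a::comm_ring_1 mat"
  assumes A: "block_id lo hi n A" and B: "B \<in> carrier_mat m n" and i: "i < m" and j: "j < n"
    and hi: "hi \<le> n"
  shows "(B * A) $$ (i, j) =
    (if lo \<le> j \<and> j < hi then \<Sum>t\<in>{lo..<hi}. B $$ (i, t) * A $$ (t, j) else B $$ (i, j))"
proof -
  note AC = block_id_carrier[OF A]
  have eq: "(B * A) $$ (i, j) = (\<Sum>t<n. B $$ (i, t) * A $$ (t, j))"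
    using AC B i j by (intro index_mult_sum)
  show ?thesis
  proof (cases "lo \<le> j \<and> j < hi")
    case True
    have "(\<Sum>t<n. B $$ (i, t) * A $$ (t, j)) = (\<Sum>t\<in>{lo..<hi}. B $$ (i, t) * A $$ (t, j))"
      using True hi j by (intro sum.mono_neutral_right) (auto simp: block_id_index[OF A])
    then show ?thesis using True eq by simp
  next
    case False
    have "(\<Sum>t<n. B $$ (i, t) * A $$ (t, j)) = (\<Sum>t<n. if j = t then B $$ (i, t) else 0)"
      using False j by (intro sum.cong) (auto simp: block_id_index[OF A])
    then show ?thesis using False eq j by auto
  qed
qed

text \<open>Upper unitriangular matrices whose middle block is the identity.\<close>

definition block_unitri :: "nat \<Rightarrow> nat \<Rightarrow> nat \<Rightarrow> 'a::{zero,one} mat \<Rightarrow> bool" where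
  "block_unitri lo hi n u \<longleftrightarrow> u \<in> carrier_mat n n \<and>
     (\<forall>i<n. \<forall>j<n. j \<le> i \<or> lo \<le> i \<and> j < hi \<longrightarrow> u $$ (i, j) = (if i = j then 1 else 0))"

lemma block_unitri_index:
  "block_unitri lo hi n u \<Longrightarrow> i < n \<Longrightarrow> j < n \<Longrightarrow> j \<le> i \<or> lo \<le> i \<and> j < hi
    \<Longrightarrow> u $$ (i, j) = (if i = j then 1 else 0)"
  by (auto simp: block_unitri_def)

text \<open>Write \<open>u = 1 + N\<close>. The nonzero entries of \<open>N\<close> lie strictly above the diagonal and outside the middle
  block; mixing rows or columns of the middle block among themselves cannot move them below the diagonal
  or into that block.\<close>

lemma block_unitri_conj:
  fixes A B u :: "'a::comm_ring_1 mat"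
  assumes A: "block_id lo hi n A" and B: "block_id lo hi n B" and AB: "A * B = 1\<^sub>m n"
    and u: "block_unitri lo hi n u" and hi: "hi \<le> n"
  shows "block_unitri lo hi n (A * u * B)"
proof -
  note AC = block_id_carrier[OF A] and BC = block_id_carrier[OF B]
  have uC: "u \<in> carrier_mat n n" using u by (simp add: block_unitri_def)
  define N where "N = u - 1\<^sub>m n"
  have NC: "N \<in> carrier_mat n n" unfolding N_def by (intro minus_carrier_mat one_carrier_mat)
  have N0: "N $$ (i, j) = 0" if "i < n" "j < n" "j \<le> i \<or> lo \<le> i \<and> j < hi" for i j
    using that block_unitri_index[OF u that] uC by (auto simp: N_def)
  have "A * u * B = A * (1\<^sub>m n + N) * B"
    using uC by (intro arg_cong[of _ _ "\<lambda>x. A * x * B"] eq_matI) (auto simp: N_def)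
  also have "A * (1\<^sub>m n + N) = A + A * N"
    using mult_add_distrib_mat[OF AC one_carrier_mat NC] AC by simp
  also have "\<dots> * B = A * B + A * N * B"
    using AC BC NC by (intro add_mult_distrib_mat) auto
  finally have eq: "A * u * B = 1\<^sub>m n + A * N * B" by (simp add: AB)
  have AN: "A * N \<in> carrier_mat n n" using AC NC by simp
  have AN0: "(A * N) $$ (i, j) = 0" if "i < n" "j < n" "j \<le> i \<or> lo \<le> i \<and> j < hi" for i j
    using that N0 hi unfolding block_id_mult_index[OF A NC that(1,2) hi]
    by (auto intro!: sum.neutral)
  have ANB0: "(A * N * B) $$ (i, j) = 0" if "i < n" "j < n" "j \<le> i \<or> lo \<le> i \<and> j < hi" for i j
    using that AN0 hi unfolding mult_block_id_index[OF B AN that(1,2) hi]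
    by (auto intro!: sum.neutral)
  show ?thesis
    unfolding eq block_unitri_def using ANB0 AN BC by (auto simp del: index_mult_mat(1))
qed

section \<open>Reflections of the middle plane and the matrix that conjugates the embedding\<close>

lemma diag_block_mat3_index:
  assumes A: "A \<in> carrier_mat k k" and B: "B \<in> carrier_mat m m" and C: "C \<in> carrier_mat n n"
    and i: "i < k + m + n" and j: "j < k + m + n"
  shows "diag_block_mat [A, B, C] $$ (i, j) =
    (if i < k \<and> j < k then A $$ (i, j)
     else if k \<le> i \<and> i < k + m \<and> k \<le> j \<and> j < k + m then B $$ (i - k, j - k)
     else if k + m \<le> i \<and> k + m \<le> j then C $$ (i - k - m, j - k - m)
     else 0)"
  using assms by (auto simp: Let_def)

lemma diag_block_mat3_carrier:
  assumes "A \<in> carrier_mat k k" "B \<in> carrier_mat m m" "C \<in> carrier_mat n n"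
  shows "diag_block_mat [A, B, C] \<in> carrier_mat (k + m + n) (k + m + n)"
  using assms by (auto simp: Let_def)

lemma mat_of_rows_list_carrier:
  "length rs = n \<Longrightarrow> mat_of_rows_list m rs \<in> carrier_mat n m"
  by (auto simp: mat_of_rows_list_def)

lemma mat_of_rows_list_index:
  "i < length rs \<Longrightarrow> j < m \<Longrightarrow> mat_of_rows_list m rs $$ (i, j) = rs ! i ! j"
  by (auto simp: mat_of_rows_list_def)

lemma c_mat_index:
  assumes "l \<ge> 1" "i < 2 * l" "j < 2 * l"
  shows "c_mat l $$ (i, j) =
    (if i = l - 1 then if j = l then 1 else 0
     else if i = l then if j = l - 1 then 1 else 0
     else if i = j then 1 else 0)"
proof -
  define k where "k = l - 1"
  have k: "l = Suc k" using assms(1) by (simp add: k_def)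
  define B :: "'a mat" where "B = mat_of_rows_list 2 [[0, 1], [1, 0]]"
  have B: "B \<in> carrier_mat 2 2" by (simp add: B_def mat_of_rows_list_carrier)
  have B_index: "B $$ (0, 0) = 0" "B $$ (0, Suc 0) = 1" "B $$ (Suc 0, 0) = 1" "B $$ (Suc 0, Suc 0) = 0"
    by (simp_all add: B_def mat_of_rows_list_index numeral_2_eq_2)
  have i: "i < k + 2 + k" and j: "j < k + 2 + k" using assms k by auto
  have eq: "c_mat l = diag_block_mat [1\<^sub>m k, B, 1\<^sub>m k]"
    by (simp only: c_mat_def B_def k_def)
  have "i < k \<or> i = k \<or> i = Suc k \<or> i > Suc k" by linarith
  moreover have "j < k \<or> j = k \<or> j = Suc k \<or> j > Suc k" by linarith
  ultimately show ?thesis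
    using i j unfolding eq diag_block_mat3_index[OF one_carrier_mat B one_carrier_mat i j]
    by (elim disjE) (auto simp: k B_index)
qed

lemma c_mat_carrier: "l \<ge> 1 \<Longrightarrow> c_mat l \<in> carrier_mat (2 * l) (2 * l)"
  using diag_block_mat3_carrier[OF one_carrier_mat mat_of_rows_list_carrier one_carrier_mat,
      of "[[0, 1], [1, 0]]" 2 "l - 1" "l - 1"]
  by (simp only: c_mat_def) (simp add: numeral_2_eq_2 mult_2 del: diag_block_mat.simps)

text \<open>Exchanges the two middle coordinate lines, with scaling; for \<open>x * y = 1\<close> it is a reflection of the
  hyperbolic plane that they span.\<close>

definition plane_swap :: "nat \<Rightarrow> 'a \<Rightarrow> 'a \<Rightarrow> 'a::{zero,one} mat" where
  "plane_swap l x y = mat (2 * l) (2 * l) (\<lambda>(i, j).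
     if i = l - 1 then if j = l then x else 0
     else if i = l then if j = l - 1 then y else 0
     else if i = j then 1 else 0)"

lemma plane_swap_carrier [simp]: "plane_swap l x y \<in> carrier_mat (2 * l) (2 * l)"
  by (simp add: plane_swap_def)

lemma plane_swap_index:
  "i < 2 * l \<Longrightarrow> j < 2 * l \<Longrightarrow> plane_swap l x y $$ (i, j) =
    (if i = l - 1 then if j = l then x else 0
     else if i = l then if j = l - 1 then y else 0
     else if i = j then 1 else 0)"
  by (simp add: plane_swap_def)

lemma c_mat_eq_plane_swap: "l \<ge> 1 \<Longrightarrow> c_mat l = plane_swap l 1 1"
  using c_mat_carrier[of l, where 'a = 'a]
  by (intro eq_matI) (auto simp: c_mat_index plane_swap_def)

lemma block_id_plane_swap: "l \<ge> 1 \<Longrightarrow> block_id (l - 1) (l + 1) (2 * l) (plane_swap l x y)"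
  by (auto simp: block_id_def plane_swap_def)

lemma plane_swap_mult_index:
  fixes A :: "'a::comm_ring_1 mat"
  assumes l: "l \<ge> 1" and A: "A \<in> carrier_mat (2 * l) m" and i: "i < 2 * l" and j: "j < m"
  shows "(plane_swap l x y * A) $$ (i, j) =
    (if i = l - 1 then x * A $$ (l, j) else if i = l then y * A $$ (l - 1, j) else A $$ (i, j))"
proof -
  have hi: "l + 1 \<le> 2 * l" and mid: "{l - 1..<l + 1} = {l - 1, l}" using l by auto
  have less: "l - 1 < 2 * l" "l < 2 * l" "l - 1 \<noteq> l" "l - 1 < l + 1" using l by auto
  have "i = l - 1 \<or> i = l \<or> \<not> (l - 1 \<le> i \<and> i < l + 1)" by auto
  then show ?thesis
    unfolding block_id_mult_index[OF block_id_plane_swap[OF l] A i j hi] mid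
    using less by (elim disjE) (auto simp: plane_swap_index)
qed

lemma mult_plane_swap_index:
  fixes A :: "'a::comm_ring_1 mat"
  assumes l: "l \<ge> 1" and A: "A \<in> carrier_mat m (2 * l)" and i: "i < m" and j: "j < 2 * l"
  shows "(A * plane_swap l x y) $$ (i, j) =
    (if j = l - 1 then A $$ (i, l) * y else if j = l then A $$ (i, l - 1) * x else A $$ (i, j))"
proof -
  have hi: "l + 1 \<le> 2 * l" and mid: "{l - 1..<l + 1} = {l - 1, l}" using l by auto
  have less: "l - 1 < 2 * l" "l < 2 * l" "l - 1 \<noteq> l" "l - 1 < l + 1" using l by auto
  have "j = l - 1 \<or> j = l \<or> \<not> (l - 1 \<le> j \<and> j < l + 1)" by auto
  then show ?thesis
    unfolding mult_block_id_index[OF block_id_plane_swap[OF l] A i j hi] mid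
    using less by (elim disjE) (auto simp: plane_swap_index)
qed

lemma plane_swap_square:
  fixes x y :: "'a::comm_ring_1"
  assumes l: "l \<ge> 1" and xy: "x * y = 1"
  shows "plane_swap l x y * plane_swap l x y = 1\<^sub>m (2 * l)"
proof (rule eq_matI)
  fix i j assume "i < dim_row (1\<^sub>m (2 * l) :: 'a mat)" "j < dim_col (1\<^sub>m (2 * l) :: 'a mat)"
  then have i: "i < 2 * l" and j: "j < 2 * l" by auto
  have less: "l - 1 < 2 * l" "l < 2 * l" "l - 1 \<noteq> l" using l by auto
  have "y * x = 1" using xy by (simp add: mult.commute)
  then show "(plane_swap l x y * plane_swap l x y) $$ (i, j) = (1\<^sub>m (2 * l) :: 'a mat) $$ (i, j)"
    unfolding plane_swap_mult_index[OF l plane_swap_carrier i j]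
    using less i j xy by (simp add: plane_swap_index)
qed (simp_all add: plane_swap_def)

lemma flip_plane_swap:
  assumes l: "l \<ge> 1"
  shows "flip (plane_swap l x y) = plane_swap l x y"
proof (rule eq_matI)
  fix i j assume "i < dim_row (plane_swap l x y)" "j < dim_col (plane_swap l x y)"
  then have i: "i < 2 * l" and j: "j < 2 * l" by (auto simp: plane_swap_def)
  have "flip (plane_swap l x y) $$ (i, j) = plane_swap l x y $$ (2 * l - 1 - j, 2 * l - 1 - i)"
    using i j by (rule flip_index[OF plane_swap_carrier])
  moreover have "2 * l - 1 - j < 2 * l" "2 * l - 1 - i < 2 * l"
    "2 * l - 1 - j = l - 1 \<longleftrightarrow> j = l" "2 * l - 1 - j = l \<longleftrightarrow> j = l - 1"
    "2 * l - 1 - i = l - 1 \<longleftrightarrow> i = l" "2 * l - 1 - i = l \<longleftrightarrow> i = l - 1"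
    "2 * l - 1 - j = 2 * l - 1 - i \<longleftrightarrow> i = j" "l \<noteq> l - 1"
    using i j l by auto
  ultimately show "flip (plane_swap l x y) $$ (i, j) = plane_swap l x y $$ (i, j)"
    using i j by (simp only: plane_swap_index) auto
qed (simp_all add: plane_swap_def)

lemma embed_conj_blocks:
  obtains B :: "'a::field mat" where "B \<in> carrier_mat 3 3"
    and "B = mat_of_rows_list 3 [[1/4, 1/2, -1/2], [1/2, 0, 1], [-1/2, 1, 1]]"
    and "embed_conj (Suc k) = diag_block_mat [1\<^sub>m k, B, 1\<^sub>m k]"
  by (rule that[of "mat_of_rows_list 3 [[1/4, 1/2, -1/2], [1/2, 0, 1], [-1/2, 1, 1]]"])
    (simp_all only: embed_conj_def diff_Suc_1, auto intro: mat_of_rows_list_carrier)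

lemma embed_conj_carrier:
  assumes "l \<ge> 1"
  shows "embed_conj l \<in> carrier_mat (2 * l + 1) (2 * l + 1)"
proof -
  obtain k where k: "l = Suc k" using assms by (cases l) auto
  obtain B :: "'a mat" where B: "B \<in> carrier_mat 3 3"
    and eq: "embed_conj (Suc k) = diag_block_mat [1\<^sub>m k, B, 1\<^sub>m k]"
    by (rule embed_conj_blocks)
  have "k + 3 + k = 2 * l + 1" by (simp add: k)
  then show ?thesis
    using diag_block_mat3_carrier[OF one_carrier_mat[of k] B one_carrier_mat[of k]] by (simp only: k eq)
qed

lemma block_id_embed_conj:
  assumes "l \<ge> 1"
  shows "block_id (l - 1) (l + 2) (2 * l + 1) (embed_conj l :: 'a::field mat)"
  unfolding block_id_def
proof (intro conjI allI impI)
  obtain k where k: "l = Suc k" using assms by (cases l) auto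
  obtain B :: "'a mat" where B: "B \<in> carrier_mat 3 3"
    and eq: "embed_conj (Suc k) = diag_block_mat [1\<^sub>m k, B, 1\<^sub>m k]"
    by (rule embed_conj_blocks)
  fix i j
  assume i: "i < 2 * l + 1" and j: "j < 2 * l + 1"
    and out: "\<not> (l - 1 \<le> i \<and> i < l + 2 \<and> l - 1 \<le> j \<and> j < l + 2)"
  have i': "i < k + 3 + k" and j': "j < k + 3 + k" using i j k by auto
  have out': "\<not> (k \<le> i \<and> i < k + 3 \<and> k \<le> j \<and> j < k + 3)" using out k by auto
  show "embed_conj l $$ (i, j) = (if i = j then 1 else 0 :: 'a)"
  proof -
    have e: "i - k - 3 = j - k - 3 \<longleftrightarrow> i = j" if "k + 3 \<le> i" "k + 3 \<le> j"
      using that by linarith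
    have less: "i - k - 3 < k" if "k + 3 \<le> i" using that i' by linarith
    have less': "j - k - 3 < k" if "k + 3 \<le> j" using that j' by linarith
    have ci: "i < k \<or> k \<le> i \<and> i < k + 3 \<or> k + 3 \<le> i" by linarith
    have cj: "j < k \<or> k \<le> j \<and> j < k + 3 \<or> k + 3 \<le> j" by linarith
    show ?thesis
      unfolding k eq diag_block_mat3_index[OF one_carrier_mat B one_carrier_mat i' j']
      using ci cj out' e less less' by (elim disjE) (simp_all add: index_one_mat)
  qed
qed (rule embed_conj_carrier[OF assms])

text \<open>In the basis \<open>k, k + 1, k + 2\<close> the columns are an isotropic vector, a vector of length 1 orthogonal to
  it, and an isotropic vector dual to the first: a Witt basis of the three-dimensional space.\<close>

lemma embed_conj_middle:
  fixes k :: nat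
  defines "M \<equiv> embed_conj (Suc k) :: 'a::field mat"
  shows
  "M $$ (k, k) = 1/4"
  "M $$ (k, Suc k) = 1/2"
  "M $$ (k, Suc (Suc k)) = - (1/2)"
  "M $$ (Suc k, k) = 1/2"
  "M $$ (Suc k, Suc k) = 0"
  "M $$ (Suc k, Suc (Suc k)) = 1"
  "M $$ (Suc (Suc k), k) = - (1/2)"
  "M $$ (Suc (Suc k), Suc k) = 1"
  "M $$ (Suc (Suc k), Suc (Suc k)) = 1"
proof -
  obtain B :: "'a mat" where B: "B \<in> carrier_mat 3 3"
    and B_def: "B = mat_of_rows_list 3 [[1/4, 1/2, -1/2], [1/2, 0, 1], [-1/2, 1, 1]]"
    and eq: "M = diag_block_mat [1\<^sub>m k, B, 1\<^sub>m k]"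
    unfolding M_def by (rule embed_conj_blocks)
  have e: "M $$ (k + i, k + j) = B $$ (i, j)" if "i < 3" "j < 3" for i j
  proof -
    have i: "k + i < k + 3 + k" and j: "k + j < k + 3 + k" using that by auto
    show ?thesis
      using that unfolding eq diag_block_mat3_index[OF one_carrier_mat B one_carrier_mat i j] by simp
  qed
  show "M $$ (k, k) = 1/4" "M $$ (k, Suc k) = 1/2" "M $$ (k, Suc (Suc k)) = - (1/2)"
    "M $$ (Suc k, k) = 1/2" "M $$ (Suc k, Suc k) = 0" "M $$ (Suc k, Suc (Suc k)) = 1"
    "M $$ (Suc (Suc k), k) = - (1/2)" "M $$ (Suc (Suc k), Suc k) = 1"
    "M $$ (Suc (Suc k), Suc (Suc k)) = 1"
    using e[of 0 0] e[of 0 1] e[of 0 2] e[of 1 0] e[of 1 1] e[of 1 2] e[of 2 0] e[of 2 1] e[of 2 2]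
    by (simp_all add: B_def mat_of_rows_list_index)
qed

lemma block_id_flip:
  assumes "block_id lo hi n A" "lo + hi = n"
  shows "block_id lo hi n (flip A)"
  unfolding block_id_def
proof (intro conjI allI impI)
  have A: "A \<in> carrier_mat n n" using assms(1) by (rule block_id_carrier)
  then show "flip A \<in> carrier_mat n n" by simp
  fix i j assume i: "i < n" and j: "j < n" and out: "\<not> (lo \<le> i \<and> i < hi \<and> lo \<le> j \<and> j < hi)"
  have out': "\<not> (lo \<le> n - 1 - j \<and> n - 1 - j < hi \<and> lo \<le> n - 1 - i \<and> n - 1 - i < hi)"
    using i j out assms(2) by auto
  have "flip A $$ (i, j) = A $$ (n - 1 - j, n - 1 - i)" using A i j by (rule flip_index)
  also have "\<dots> = (if n - 1 - j = n - 1 - i then 1 else 0)"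
    using i j out' by (intro block_id_index[OF assms(1)]) auto
  also have "n - 1 - j = n - 1 - i \<longleftrightarrow> i = j" using i j by auto
  finally show "flip A $$ (i, j) = (if i = j then 1 else 0)" .
qed

text \<open>The columns of the middle block form a Witt basis, so the matrix preserves the form and its inverse
  is its adjoint.\<close>

lemma flip_embed_conj_mult:
  assumes "l \<ge> 1" "(2 :: 'f) \<noteq> 0"
  shows "flip (embed_conj l) * embed_conj l = (1\<^sub>m (2 * l + 1) :: 'f::field mat)"
proof -
  have four: "(4 :: 'f) \<noteq> 0" using assms(2) by (metis mult_eq_0_iff numeral_Bit0_eq_double)
  have "(8 :: 'f) = 2 * 4" by simp
  with four assms(2) have eight: "(8 :: 'f) \<noteq> 0" by (metis mult_eq_0_iff)
  have "(32 :: 'f) = 4 * 8" by simp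
  with four eight have thirtytwo: "(32 :: 'f) \<noteq> 0" by (metis mult_eq_0_iff)
  define k where "k = l - 1"
  have l: "l = Suc k" using assms(1) by (simp add: k_def)
  define M where "M = (embed_conj l :: 'f mat)"
  define n where "n = 2 * l + 1"
  have MC: "M \<in> carrier_mat n n" using embed_conj_carrier[OF assms(1)] by (simp add: M_def n_def)
  have Mid: "block_id k (k + 3) n M"
    using block_id_embed_conj[OF assms(1), where 'a = 'f] by (simp add: M_def n_def l numeral_3_eq_3)
  have Fid: "block_id k (k + 3) n (flip M)"
    using Mid by (rule block_id_flip) (simp add: n_def l)
  have hi: "k + 3 \<le> n" by (simp add: n_def l)
  have mid: "{k..<k + 3} = {k, Suc k, Suc (Suc k)}" by auto
  have M_eq: "embed_conj (Suc k) = M" by (simp add: M_def l)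
  note entries = embed_conj_middle[where 'a = 'f, of k, unfolded M_eq]
  have less: "k < n" "Suc k < n" "Suc (Suc k) < n" by (simp_all add: n_def l)
  have diff: "n - 1 - k = Suc (Suc k)" "n - 1 - Suc k = Suc k" "n - 1 - Suc (Suc k) = k"
    by (simp_all add: n_def l)
  note flip_entries = flip_index[OF MC less(1) less(1), unfolded diff entries]
    flip_index[OF MC less(1) less(2), unfolded diff entries]
    flip_index[OF MC less(1) less(3), unfolded diff entries]
    flip_index[OF MC less(2) less(1), unfolded diff entries]
    flip_index[OF MC less(2) less(2), unfolded diff entries]
    flip_index[OF MC less(2) less(3), unfolded diff entries]
    flip_index[OF MC less(3) less(1), unfolded diff entries]
    flip_index[OF MC less(3) less(2), unfolded diff entries]
    flip_index[OF MC less(3) less(3), unfolded diff entries]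
  have "flip M * M = 1\<^sub>m n"
  proof (rule eq_matI)
    fix i j assume "i < dim_row (1\<^sub>m n :: 'f mat)" "j < dim_col (1\<^sub>m n :: 'f mat)"
    then have i: "i < n" and j: "j < n" by auto
    note eq = block_id_mult_index[OF Fid MC i j hi]
    show "(flip M * M) $$ (i, j) = (1\<^sub>m n :: 'f mat) $$ (i, j)"
    proof (cases "i \<in> {k..<k + 3}")
      case i': True
      show ?thesis
      proof (cases "j \<in> {k..<k + 3}")
        case True
        have "i = k \<or> i = Suc k \<or> i = Suc (Suc k)" "j = k \<or> j = Suc k \<or> j = Suc (Suc k)"
          using i' True by auto
        then show ?thesis
          unfolding eq mid using less four eight thirtytwo assms(2)
          by (elim disjE) (simp_all add: entries flip_entries field_simps)
      next
        case False
        have "(\<Sum>t\<in>{k..<k + 3}. flip M $$ (i, t) * M $$ (t, j)) = 0"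
          using False j hi by (intro sum.neutral) (auto simp: block_id_index[OF Mid])
        then show ?thesis using False i' i j unfolding eq by auto
      qed
    next
      case False
      then show ?thesis using i j unfolding eq by (auto simp: block_id_index[OF Mid])
    qed
  qed (use MC in auto)
  then show ?thesis by (simp add: M_def n_def)
qed

section \<open>The embedding of the even orthogonal group\<close>

lemma insert_middle_carrier: "insert_middle l g \<in> carrier_mat (2 * l + 1) (2 * l + 1)"
  by (simp add: insert_middle_def)

lemmas insert_middle_carrier_Suc [simp] = insert_middle_carrier[simplified]

lemma insert_middle_index:
  "i < 2 * l + 1 \<Longrightarrow> j < 2 * l + 1 \<Longrightarrow> insert_middle l g $$ (i, j) =
     (if i = l \<or> j = l then (if i = j then 1 else 0)
     else g $$ (if i < l then i else i - 1, if j < l then j else j - 1))"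
  by (simp add: insert_middle_def)

text \<open>Indices of the embedded matrix are the old ones with the middle index \<open>l\<close> left out.\<close>

lemma sum_skip_middle:
  fixes F :: "nat \<Rightarrow> 'a::comm_monoid_add"
  shows "(\<Sum>t<2 * l + 1. F t) = F l + (\<Sum>t<2 * l. F (if t < l then t else t + 1))"
proof -
  have "(\<Sum>t<2 * l + 1. F t) = F l + (\<Sum>t\<in>{..<2 * l + 1} - {l}. F t)"
    by (rule sum.remove) auto
  also have "(\<Sum>t\<in>{..<2 * l + 1} - {l}. F t) = (\<Sum>t<2 * l. F (if t < l then t else t + 1))"
    by (rule sum.reindex_bij_witness[where i = "\<lambda>t. if t < l then t else t + 1"
          and j = "\<lambda>t. if t < l then t else t - 1"]) (auto split: if_splits)
  finally show ?thesis .
qed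

lemma insert_middle_mult:
  fixes g h :: "'f::field mat"
  assumes "g \<in> carrier_mat (2 * l) (2 * l)" "h \<in> carrier_mat (2 * l) (2 * l)"
  shows "insert_middle l (g * h) = insert_middle l g * insert_middle l h"
proof (rule eq_matI)
  fix i j assume "i < dim_row (insert_middle l g * insert_middle l h)"
    "j < dim_col (insert_middle l g * insert_middle l h)"
  then have i: "i < 2 * l + 1" and j: "j < 2 * l + 1" by (auto simp: insert_middle_def)
  define i' where "i' = (if i < l then i else i - 1)"
  define j' where "j' = (if j < l then j else j - 1)"
  have "(insert_middle l g * insert_middle l h) $$ (i, j) =
      (\<Sum>t<2 * l + 1. insert_middle l g $$ (i, t) * insert_middle l h $$ (t, j))"
    using i j by (intro index_mult_sum) auto
  also have "\<dots> = insert_middle l (g * h) $$ (i, j)"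
  proof (cases "i = l \<or> j = l")
    case True
    then have "(\<Sum>t<2 * l. insert_middle l g $$ (i, if t < l then t else t + 1) *
          insert_middle l h $$ (if t < l then t else t + 1, j)) = 0"
    proof (intro sum.neutral ballI)
      fix t assume t: "t \<in> {..<2 * l}"
      define s where "s = (if t < l then t else t + 1)"
      have "s < 2 * l + 1" "s \<noteq> l" using t by (auto simp: s_def)
      then show "insert_middle l g $$ (i, if t < l then t else t + 1) *
          insert_middle l h $$ (if t < l then t else t + 1, j) = 0"
        using True i j unfolding s_def[symmetric] by (elim disjE) (simp_all add: insert_middle_index)
    qed
    moreover have "insert_middle l g $$ (i, l) * insert_middle l h $$ (l, j) =
        insert_middle l (g * h) $$ (i, j)"
      using True i j by (auto simp: insert_middle_index)
    ultimately show ?thesis unfolding sum_skip_middle by simp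
  next
    case False
    then have i': "i' < 2 * l" and j': "j' < 2 * l" using i j by (auto simp: i'_def j'_def)
    have "insert_middle l g $$ (i, l) = 0" using False i by (simp add: insert_middle_index)
    moreover have "(\<Sum>t<2 * l. insert_middle l g $$ (i, if t < l then t else t + 1) *
          insert_middle l h $$ (if t < l then t else t + 1, j)) =
        (\<Sum>t<2 * l. g $$ (i', t) * h $$ (t, j'))"
      using False i j by (intro sum.cong) (auto simp: insert_middle_index i'_def j'_def)
    moreover have "(\<Sum>t<2 * l. g $$ (i', t) * h $$ (t, j')) = (g * h) $$ (i', j')"
      by (rule index_mult_sum[OF assms i' j', symmetric])
    ultimately show ?thesis
      using False i j unfolding sum_skip_middle by (simp add: insert_middle_index i'_def j'_def)
  qed
  finally show "insert_middle l (g * h) $$ (i, j) = (insert_middle l g * insert_middle l h) $$ (i, j)"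
    by simp
qed (auto simp: insert_middle_def)

lemma flip_insert_middle:
  assumes "g \<in> carrier_mat (2 * l) (2 * l)"
  shows "flip (insert_middle l g) = insert_middle l (flip g)"
proof (rule eq_matI)
  fix i j assume "i < dim_row (insert_middle l (flip g))" "j < dim_col (insert_middle l (flip g))"
  then have ij: "i < 2 * l + 1" "j < 2 * l + 1" by (auto simp: insert_middle_def)
  have "flip (insert_middle l g) $$ (i, j) = insert_middle l g $$ (2 * l - j, 2 * l - i)"
    using ij by (subst flip_index[OF insert_middle_carrier]) auto
  also have "\<dots> = insert_middle l (flip g) $$ (i, j)"
  proof (cases "i = l \<or> j = l")
    case True
    then show ?thesis using ij by (auto simp: insert_middle_index)
  next
    case False
    have skip: "(if 2 * l - k < l then 2 * l - k else 2 * l - k - 1) =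
        2 * l - 1 - (if k < l then k else k - 1)" if "k < 2 * l + 1" "k \<noteq> l" for k
      using that by auto
    have ij': "(if i < l then i else i - 1) < 2 * l" "(if j < l then j else j - 1) < 2 * l"
      and ij'': "2 * l - i < 2 * l + 1" "2 * l - j < 2 * l + 1"
      and ne: "i \<noteq> l" "j \<noteq> l" "2 * l - i \<noteq> l" "2 * l - j \<noteq> l"
      using False ij by auto
    show ?thesis
      unfolding insert_middle_index[OF ij] insert_middle_index[OF ij''(2,1)]
        skip[OF ij(1) ne(1)] skip[OF ij(2) ne(2)]
      using ne flip_index[OF assms ij'] by (simp only: if_False simp_thms)
  qed
  finally show "flip (insert_middle l g) $$ (i, j) = insert_middle l (flip g) $$ (i, j)" .
qed (auto simp: insert_middle_def)

lemma insert_middle_one: "insert_middle l (1\<^sub>m (2 * l)) = 1\<^sub>m (2 * l + 1)"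
  by (rule eq_matI) (auto simp: insert_middle_def)

text \<open>Laplace expansion along the inserted row, whose only nonzero entry is the central 1.\<close>

lemma det_insert_middle:
  assumes g: "g \<in> carrier_mat (2 * l) (2 * l)"
  shows "det (insert_middle l g) = det g"
proof -
  have "mat_delete (insert_middle l g) l l = g"
    using g by (intro eq_matI) (auto simp: mat_delete_def insert_middle_def)
  then have "cofactor (insert_middle l g) l l = det g" by (simp add: cofactor_def)
  moreover have "det (insert_middle l g) =
      (\<Sum>j<2 * l + 1. insert_middle l g $$ (l, j) * cofactor (insert_middle l g) l j)"
    by (rule laplace_expansion_row) auto
  moreover have "\<dots> = insert_middle l g $$ (l, l) * cofactor (insert_middle l g) l l"
    by (subst sum.remove[of _ l]) (auto intro!: sum.neutral simp: insert_middle_index)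
  ultimately show ?thesis by (simp add: insert_middle_index)
qed

context
  fixes l :: nat
  assumes l: "l \<ge> 1" and two: "(2 :: 'f::field) \<noteq> 0"
begin

lemma embed_eq: "embed l g = flip (embed_conj l) * insert_middle l g * (embed_conj l :: 'f mat)"
  unfolding embed_def
  by (subst GL_inv[OF embed_conj_carrier[OF l] flip_carrier[OF embed_conj_carrier[OF l]]
        flip_embed_conj_mult[OF l two]]) (rule refl)

lemma embed_conj_mult_flip: "embed_conj l * flip (embed_conj l) = (1\<^sub>m (2 * l + 1) :: 'f mat)"
  by (rule flip_right_inverse[OF embed_conj_carrier[OF l] flip_embed_conj_mult[OF l two]])

lemma embed_carrier: "embed l (g :: 'f mat) \<in> carrier_mat (2 * l + 1) (2 * l + 1)"
  unfolding embed_eq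
  by (intro mult_square_carrier flip_carrier embed_conj_carrier[OF l] insert_middle_carrier)

lemma conj_embed_conj_mult:
  fixes A B :: "'f mat"
  assumes A: "A \<in> carrier_mat (2 * l + 1) (2 * l + 1)" and B: "B \<in> carrier_mat (2 * l + 1) (2 * l + 1)"
  shows "(flip (embed_conj l) * A * embed_conj l) * (flip (embed_conj l) * B * embed_conj l)
    = flip (embed_conj l) * (A * B) * embed_conj l"
proof -
  define n where "n = 2 * l + 1"
  define M where "M = (embed_conj l :: 'f mat)"
  define M' where "M' = flip M"
  have C: "M \<in> carrier_mat n n" "M' \<in> carrier_mat n n" "A \<in> carrier_mat n n" "B \<in> carrier_mat n n"
    unfolding M'_def M_def n_def
    by (intro flip_carrier embed_conj_carrier[OF l] A B)+
  have one: "M * M' = 1\<^sub>m n" using embed_conj_mult_flip by (simp add: M_def M'_def n_def)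
  have "M' * A * M * (M' * B * M) = M' * (A * (M * M' * (B * M)))"
    using C by (simp add: assoc_mult_square[of _ n] mult_square_carrier[of _ n])
  also have "\<dots> = M' * (A * (B * M))"
    using C by (simp add: one left_mult_one_mat[of _ n n] mult_square_carrier[of _ n])
  also have "\<dots> = M' * (A * B) * M"
    using C by (simp add: assoc_mult_square[of _ n] mult_square_carrier[of _ n])
  finally show ?thesis by (simp add: M_def M'_def)
qed

text \<open>The map is multiplicative on all matrices, so the embedding extends to the full orthogonal group,
  where the reflections \<open>c\<close> and \<open>\<rho>\<close> live.\<close>

lemma embed_mult:
  fixes g h :: "'f mat"
  assumes "g \<in> carrier_mat (2 * l) (2 * l)" "h \<in> carrier_mat (2 * l) (2 * l)"
  shows "embed l (g * h) = embed l g * embed l h"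
  unfolding embed_eq insert_middle_mult[OF assms]
  by (rule conj_embed_conj_mult[symmetric]) (rule insert_middle_carrier)+

lemma flip_embed:
  fixes g :: "'f mat"
  assumes "g \<in> carrier_mat (2 * l) (2 * l)"
  shows "flip (embed l g) = embed l (flip g)"
proof -
  define n where "n = 2 * l + 1"
  have M: "(embed_conj l :: 'f mat) \<in> carrier_mat n n" using embed_conj_carrier[OF l] by (simp add: n_def)
  have I: "insert_middle l g \<in> carrier_mat n n" "insert_middle l (flip g) \<in> carrier_mat n n"
    unfolding n_def by (rule insert_middle_carrier)+
  have "flip (embed l g) = flip (embed_conj l) * (flip (insert_middle l g) * flip (flip (embed_conj l)))"
    unfolding embed_eq using M I
    by (simp add: flip_mult[where n = n and m = n and k = n] mult_square_carrier[of _ n])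
  also have "\<dots> = embed l (flip g)"
    unfolding embed_eq flip_insert_middle[OF assms] using M I
    by (simp add: assoc_mult_square[of _ n])
  finally show ?thesis .
qed

lemma embed_one: "embed l (1\<^sub>m (2 * l)) = (1\<^sub>m (2 * l + 1) :: 'f mat)"
  unfolding embed_eq insert_middle_one using embed_conj_carrier[OF l, where 'a = 'f]
  by (simp add: right_mult_one_mat[of _ "2 * l + 1" "2 * l + 1"] flip_embed_conj_mult[OF l two]
      del: right_mult_one_mat)

lemma embed_SO:
  fixes g :: "'f mat"
  assumes "g \<in> carrier (SO (2 * l))"
  shows "embed l g \<in> carrier (SO (2 * l + 1))"
proof -
  have g: "g \<in> carrier_mat (2 * l) (2 * l)" "det g = 1" "flip g * g = 1\<^sub>m (2 * l)"
    using assms by (auto simp: mem_SO_iff)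
  define n where "n = 2 * l + 1"
  have M: "(embed_conj l :: 'f mat) \<in> carrier_mat n n" using embed_conj_carrier[OF l] by (simp add: n_def)
  have I: "insert_middle l g \<in> carrier_mat n n" unfolding n_def by (rule insert_middle_carrier)
  have "det (flip (embed_conj l)) * det (embed_conj l :: 'f mat) = 1"
    using M flip_embed_conj_mult[OF l two] by (subst det_mult[symmetric, where n = n]) auto
  then have "det (embed l g) = 1"
    unfolding embed_eq using M I g
    by (simp add: det_mult[where n = n] mult_square_carrier[of _ n] det_insert_middle)
  moreover have "flip (embed l g) * embed l g = 1\<^sub>m (2 * l + 1)"
    using g by (simp add: flip_embed embed_mult[symmetric] embed_one)
  ultimately show ?thesis unfolding mem_SO_iff using embed_carrier by blast
qed

end

section \<open>Levi blocks\<close>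

text \<open>Block diagonal matrices with blocks of sizes \<open>l\<close>, 1, \<open>l\<close>. The central entry \<open>e\<close> is free because the image
  of a reflection under the embedding has \<open>- 1\<close> there.\<close>

definition levi_block :: "nat \<Rightarrow> 'f \<Rightarrow> 'f mat \<Rightarrow> 'f mat \<Rightarrow> 'f::field mat" where
  "levi_block l e a d = mat (2 * l + 1) (2 * l + 1) (\<lambda>(i, j).
     if i < l \<and> j < l then a $$ (i, j)
     else if i = l \<and> j = l then e
     else if l < i \<and> l < j then d $$ (i - l - 1, j - l - 1)
     else 0)"

lemma levi_block_carrier: "levi_block l e a d \<in> carrier_mat (2 * l + 1) (2 * l + 1)"
  by (simp add: levi_block_def)

lemma levi_block_index:
  "i < 2 * l + 1 \<Longrightarrow> j < 2 * l + 1 \<Longrightarrow> levi_block l e a d $$ (i, j) =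
     (if i < l \<and> j < l then a $$ (i, j)
     else if i = l \<and> j = l then e
     else if l < i \<and> l < j then d $$ (i - l - 1, j - l - 1)
     else 0)"
  by (simp add: levi_block_def)

lemma star_carrier:
  assumes a: "a \<in> carrier (GL l)"
  shows "star l a \<in> carrier_mat l l"
proof (rule GL_inverse[OF a])
  fix b assume "b \<in> carrier (GL l)" "b * a = 1\<^sub>m l"
  then show "star l a \<in> carrier_mat l l" using a by (simp add: star_eq_flip[of a l b] mem_GL_iff)
qed

lemma siegel_levi_eq:
  assumes "a \<in> carrier (GL l)"
  shows "siegel_levi l a = levi_block l 1 a (star l a)"
proof -
  have a: "a \<in> carrier_mat l l" using assms by (simp add: mem_GL_iff)
  note s = star_carrier[OF assms]
  show ?thesis
  proof (rule eq_matI)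
    fix i j assume "i < dim_row (levi_block l 1 a (star l a))" "j < dim_col (levi_block l 1 a (star l a))"
    then have i: "i < 2 * l + 1" and j: "j < 2 * l + 1" by (auto simp: levi_block_def)
    then have i': "i < l + 1 + l" and j': "j < l + 1 + l" by auto
    have "i < l \<or> i = l \<or> l + 1 \<le> i" "j < l \<or> j = l \<or> l + 1 \<le> j" by linarith+
    then show "siegel_levi l a $$ (i, j) = levi_block l 1 a (star l a) $$ (i, j)"
      unfolding siegel_levi_def diag_block_mat3_index[OF a one_carrier_mat s i' j'] levi_block_index[OF i j]
      by (elim disjE) simp_all
  qed (use diag_block_mat3_carrier[OF a one_carrier_mat s, of 1] in
      \<open>auto simp: siegel_levi_def levi_block_def simp del: diag_block_mat.simps\<close>)
qed

lemma sum_siegel_blocks: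
  fixes F :: "nat \<Rightarrow> 'a::comm_monoid_add"
  shows "(\<Sum>t<2 * l + 1. F t) = (\<Sum>t<l. F t) + F l + (\<Sum>t<l. F (l + 1 + t))"
proof -
  have eq: "{..<2 * l + 1} = {..<l + 1} \<union> {l + 1..<2 * l + 1}" by auto
  have "(\<Sum>t<2 * l + 1. F t) = (\<Sum>t<l + 1. F t) + (\<Sum>t\<in>{l + 1..<2 * l + 1}. F t)"
    unfolding eq by (rule sum.union_disjoint) auto
  also have "(\<Sum>t\<in>{l + 1..<2 * l + 1}. F t) = (\<Sum>t<l. F (l + 1 + t))"
    by (rule sum.reindex_bij_witness[where i = "\<lambda>t. l + 1 + t" and j = "\<lambda>t. t - (l + 1)"]) auto
  finally show ?thesis by simp
qed

lemma levi_block_mult_index: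
  fixes X :: "'f::field mat"
  assumes X: "X \<in> carrier_mat (2 * l + 1) m" and i: "i < 2 * l + 1" and j: "j < m"
  shows "(levi_block l e a d * X) $$ (i, j) =
    (if i < l then \<Sum>t<l. a $$ (i, t) * X $$ (t, j)
     else if i = l then e * X $$ (l, j)
     else \<Sum>t<l. d $$ (i - l - 1, t) * X $$ (l + 1 + t, j))"
proof -
  have "(levi_block l e a d * X) $$ (i, j) = (\<Sum>t<2 * l + 1. levi_block l e a d $$ (i, t) * X $$ (t, j))"
    by (rule index_mult_sum[OF levi_block_carrier X i j])
  also have "\<dots> = (\<Sum>t<l. levi_block l e a d $$ (i, t) * X $$ (t, j)) +
      levi_block l e a d $$ (i, l) * X $$ (l, j) +
      (\<Sum>t<l. levi_block l e a d $$ (i, l + 1 + t) * X $$ (l + 1 + t, j))"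
    by (rule sum_siegel_blocks)
  finally have eq: "(levi_block l e a d * X) $$ (i, j) = \<dots>" .
  have "i < l \<or> i = l \<or> l < i" by linarith
  then show ?thesis
    unfolding eq using i by (elim disjE) (auto simp: levi_block_index)
qed

lemma mult_levi_block_index:
  fixes X :: "'f::field mat"
  assumes X: "X \<in> carrier_mat m (2 * l + 1)" and i: "i < m" and j: "j < 2 * l + 1"
  shows "(X * levi_block l e a d) $$ (i, j) =
    (if j < l then \<Sum>t<l. X $$ (i, t) * a $$ (t, j)
     else if j = l then X $$ (i, l) * e
     else \<Sum>t<l. X $$ (i, l + 1 + t) * d $$ (t, j - l - 1))"
proof -
  have "(X * levi_block l e a d) $$ (i, j) = (\<Sum>t<2 * l + 1. X $$ (i, t) * levi_block l e a d $$ (t, j))"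
    by (rule index_mult_sum[OF X levi_block_carrier i j])
  also have "\<dots> = (\<Sum>t<l. X $$ (i, t) * levi_block l e a d $$ (t, j)) +
      X $$ (i, l) * levi_block l e a d $$ (l, j) +
      (\<Sum>t<l. X $$ (i, l + 1 + t) * levi_block l e a d $$ (l + 1 + t, j))"
    by (rule sum_siegel_blocks)
  finally have eq: "(X * levi_block l e a d) $$ (i, j) = \<dots>" .
  have "j < l \<or> j = l \<or> l < j" by linarith
  then show ?thesis
    unfolding eq using j by (elim disjE) (auto simp: levi_block_index)
qed

lemma levi_block_mult:
  fixes a d a' d' :: "'f::field mat"
  assumes "a \<in> carrier_mat l l" "d \<in> carrier_mat l l" "a' \<in> carrier_mat l l" "d' \<in> carrier_mat l l"
  shows "levi_block l e a d * levi_block l e' a' d' = levi_block l (e * e') (a * a') (d * d')"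
proof (rule eq_matI)
  fix i j assume "i < dim_row (levi_block l (e * e') (a * a') (d * d'))"
    "j < dim_col (levi_block l (e * e') (a * a') (d * d'))"
  then have i: "i < 2 * l + 1" and j: "j < 2 * l + 1" by (auto simp: levi_block_def)
  have prods: "(a * a') $$ (i, j) = (\<Sum>t<l. a $$ (i, t) * a' $$ (t, j))" if "i < l" "j < l" for i j
    using assms that by (intro index_mult_sum) auto
  have prods': "(d * d') $$ (i, j) = (\<Sum>t<l. d $$ (i, t) * d' $$ (t, j))" if "i < l" "j < l" for i j
    using assms that by (intro index_mult_sum) auto
  have "i < l \<or> i = l \<or> l < i" "j < l \<or> j = l \<or> l < j" by linarith+
  then show "(levi_block l e a d * levi_block l e' a' d') $$ (i, j) =
      levi_block l (e * e') (a * a') (d * d') $$ (i, j)"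
    unfolding levi_block_mult_index[OF levi_block_carrier i j] using i j
    by (elim disjE) (simp_all add: levi_block_index prods prods' del: index_mult_mat(1))
qed (auto simp: levi_block_def)

lemma flip_levi_block:
  assumes "a \<in> carrier_mat l l" "d \<in> carrier_mat l l"
  shows "flip (levi_block l e a d) = levi_block l e (flip d) (flip a)"
proof (rule eq_matI)
  fix i j assume "i < dim_row (levi_block l e (flip d) (flip a))"
    "j < dim_col (levi_block l e (flip d) (flip a))"
  then have i: "i < 2 * l + 1" and j: "j < 2 * l + 1" by (auto simp: levi_block_def)
  have eq: "flip (levi_block l e a d) $$ (i, j) = levi_block l e a d $$ (2 * l + 1 - 1 - j, 2 * l + 1 - 1 - i)"
    using i j by (rule flip_index[OF levi_block_carrier])
  have i': "2 * l + 1 - 1 - i < 2 * l + 1" and j': "2 * l + 1 - 1 - j < 2 * l + 1" by auto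
  have c: "2 * l + 1 - 1 - k < l \<longleftrightarrow> l < k" "2 * l + 1 - 1 - k = l \<longleftrightarrow> k = l" "l < 2 * l + 1 - 1 - k \<longleftrightarrow> k < l"
    if "k < 2 * l + 1" for k using that by linarith+
  have "i < l \<or> i = l \<or> l < i" "j < l \<or> j = l \<or> l < j" by linarith+
  then show "flip (levi_block l e a d) $$ (i, j) = levi_block l e (flip d) (flip a) $$ (i, j)"
    unfolding eq levi_block_index[OF i j] levi_block_index[OF j' i'] c[OF i] c[OF j]
    using i j flip_index[OF assms(1), of "i - l - 1" "j - l - 1"] flip_index[OF assms(2), of i j]
    by (elim disjE) (simp_all, simp_all add: algebra_simps mult_2_right)
qed (auto simp: levi_block_def)

lemma levi_block_one: "levi_block l 1 (1\<^sub>m l) (1\<^sub>m l) = 1\<^sub>m (2 * l + 1)"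
  by (rule eq_matI) (auto simp: levi_block_def)

section \<open>The Weyl element\<close>

lemma w_mat_carrier [simp]: "w_mat l \<in> carrier_mat (2 * l + 1) (2 * l + 1)"
  by (simp add: w_mat_def)

lemma w_mat_mult_index:
  fixes X :: "'f::field mat"
  assumes X: "X \<in> carrier_mat (2 * l + 1) m" and i: "i < 2 * l + 1" and j: "j < m"
  shows "(w_mat l * X) $$ (i, j) =
    (if i < l then X $$ (l + 1 + i, j) else if i = l then (-1) ^ l * X $$ (l, j)
     else X $$ (i - l - 1, j))"
proof -
  define s where "s = (if i < l then l + 1 + i else if i = l then l else i - l - 1)"
  define c :: 'f where "c = (if i = l then (-1) ^ l else 1)"
  have cases: "i < l \<or> i = l \<or> l < i" by linarith
  have s: "s < 2 * l + 1" using i by (auto simp: s_def)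
  have w: "w_mat l $$ (i, t) = (if s = t then c else 0)" if "t < 2 * l + 1" for t
    using cases i that by (elim disjE) (auto simp: w_mat_def s_def c_def)
  have "(w_mat l * X) $$ (i, j) = (\<Sum>t<2 * l + 1. w_mat l $$ (i, t) * X $$ (t, j))"
    by (rule index_mult_sum[OF w_mat_carrier X i j])
  also have "\<dots> = (\<Sum>t<2 * l + 1. if s = t then c * X $$ (t, j) else 0)"
    by (intro sum.cong refl) (simp add: w)
  also have "\<dots> = c * X $$ (s, j)" using s by simp
  finally show ?thesis using cases by (elim disjE) (simp_all add: s_def c_def)
qed

lemma mult_w_mat_index:
  fixes X :: "'f::field mat"
  assumes X: "X \<in> carrier_mat m (2 * l + 1)" and i: "i < m" and j: "j < 2 * l + 1"
  shows "(X * w_mat l) $$ (i, j) =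
    (if j < l then X $$ (i, l + 1 + j) else if j = l then (-1) ^ l * X $$ (i, l)
     else X $$ (i, j - l - 1))"
proof -
  define s where "s = (if j < l then l + 1 + j else if j = l then l else j - l - 1)"
  define c :: 'f where "c = (if j = l then (-1) ^ l else 1)"
  have cases: "j < l \<or> j = l \<or> l < j" by linarith
  have s: "s < 2 * l + 1" using j by (auto simp: s_def)
  have w: "w_mat l $$ (t, j) = (if s = t then c else 0)" if "t < 2 * l + 1" for t
    using cases j that by (elim disjE) (auto simp: w_mat_def s_def c_def)
  have "(X * w_mat l) $$ (i, j) = (\<Sum>t<2 * l + 1. X $$ (i, t) * w_mat l $$ (t, j))"
    by (rule index_mult_sum[OF X w_mat_carrier i j])
  also have "\<dots> = (\<Sum>t<2 * l + 1. if s = t then c * X $$ (i, t) else 0)"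
    by (intro sum.cong refl) (simp add: w)
  also have "\<dots> = c * X $$ (i, s)" using s by simp
  finally show ?thesis using cases by (elim disjE) (simp_all add: s_def c_def)
qed

text \<open>The Weyl element exchanges the two outer blocks, hence \<open>a\<close> and \<open>a\<^sup>*\<close> on the Levi subgroup.\<close>

lemma w_mat_levi_block:
  fixes a d :: "'f::field mat"
  shows "w_mat l * levi_block l e a d = levi_block l e d a * w_mat l"
proof (rule eq_matI)
  fix i j assume "i < dim_row (levi_block l e d a * w_mat l)" "j < dim_col (levi_block l e d a * w_mat l)"
  then have i: "i < 2 * l + 1" and j: "j < 2 * l + 1" by (auto simp: levi_block_def w_mat_def)
  have "i < l \<or> i = l \<or> l < i" "j < l \<or> j = l \<or> l < j" by linarith+
  then show "(w_mat l * levi_block l e a d) $$ (i, j) = (levi_block l e d a * w_mat l) $$ (i, j)"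
    unfolding w_mat_mult_index[OF levi_block_carrier i j] mult_w_mat_index[OF levi_block_carrier i j]
    using i j by (elim disjE) (auto simp: levi_block_index)
qed (auto simp: levi_block_def w_mat_def)

lemma flip_w_mat: "flip (w_mat l) = (w_mat l :: 'f::field mat)"
proof (rule eq_matI)
  fix i j assume "i < dim_row (w_mat l :: 'f mat)" "j < dim_col (w_mat l :: 'f mat)"
  then have ij: "i < 2 * l + 1" "j < 2 * l + 1" by (auto simp: w_mat_def)
  have c: "2 * l - j = l \<and> 2 * l - i = l \<longleftrightarrow> i = l \<and> j = l"
    "2 * l - i = 2 * l - j + l + 1 \<longleftrightarrow> j = i + l + 1"
    "2 * l - j = 2 * l - i + l + 1 \<longleftrightarrow> i = j + l + 1"
    using ij by auto
  have "flip (w_mat l) $$ (i, j) = (w_mat l $$ (2 * l - j, 2 * l - i) :: 'f)"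
    using flip_index[OF w_mat_carrier ij] by simp
  also have "\<dots> = (if 2 * l - j = l \<and> 2 * l - i = l then (-1) ^ l
      else if 2 * l - i = 2 * l - j + l + 1 \<or> 2 * l - j = 2 * l - i + l + 1 then 1 else 0)"
    by (simp add: w_mat_def)
  also have "\<dots> = w_mat l $$ (i, j)"
    unfolding c using ij by (simp add: w_mat_def)
  finally show "flip (w_mat l) $$ (i, j) = (w_mat l $$ (i, j) :: 'f)" .
qed (auto simp: w_mat_def)

lemma w_mat_square: "w_mat l * w_mat l = (1\<^sub>m (2 * l + 1) :: 'f::field mat)"
proof (rule eq_matI)
  fix i j assume "i < dim_row (1\<^sub>m (2 * l + 1) :: 'f mat)" "j < dim_col (1\<^sub>m (2 * l + 1) :: 'f mat)"
  then have i: "i < 2 * l + 1" and j: "j < 2 * l + 1" by auto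
  have "(-1 :: 'f) ^ l * (-1) ^ l = 1" by (simp flip: power_mult_distrib)
  moreover have "i < l \<or> i = l \<or> l < i" by linarith
  ultimately show "(w_mat l * w_mat l) $$ (i, j) = (1\<^sub>m (2 * l + 1) :: 'f mat) $$ (i, j)"
    unfolding w_mat_mult_index[OF w_mat_carrier i j]
    using i j by (elim disjE) (auto simp: w_mat_def)
qed (auto simp: w_mat_def)

lemma det_levi_block_one:
  "det (levi_block l e (1\<^sub>m l) (1\<^sub>m l)) = (e :: 'f::field)"
proof -
  define L where "L = levi_block l e (1\<^sub>m l) (1\<^sub>m l :: 'f mat)"
  have L: "L \<in> carrier_mat (2 * l + 1) (2 * l + 1)" unfolding L_def by (rule levi_block_carrier)
  have "upper_triangular L" using L by (auto simp: upper_triangular_def L_def levi_block_def)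
  then have "det L = prod_list (diag_mat L)" using L by (rule det_upper_triangular)
  also have "\<dots> = (\<Prod>i<2 * l + 1. L $$ (i, i))"
    using L by (simp add: prod_list_diag_prod atLeast0LessThan)
  also have "\<dots> = (\<Prod>i<2 * l + 1. if i = l then e else 1)"
    by (rule prod.cong) (auto simp: L_def levi_block_def)
  also have "\<dots> = e" by (subst prod.delta) auto
  finally show ?thesis by (simp add: L_def)
qed

text \<open>Up to the central sign \<open>(- 1) ^ l\<close> the matrix comes from the permutation of \<open>2 * l\<close> rows that swaps the
  two halves, of sign \<open>(- 1) ^ (l * l)\<close>; the two signs cancel. This is what the central entry of \<open>w\<^sub>l\<close> is
  for.\<close>

lemma det_w_mat: "det (w_mat l :: 'f::field mat) = 1"
proof -
  define K :: "'f mat" where "K = mat (2 * l) (2 * l) (\<lambda>(i, j). if j = i + l \<or> i = j + l then 1 else 0)"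
  have K: "K \<in> carrier_mat (2 * l) (2 * l)" by (simp add: K_def)
  have "w_mat l = levi_block l ((-1) ^ l) (1\<^sub>m l) (1\<^sub>m l) * insert_middle l K"
  proof (rule eq_matI)
    fix i j assume "i < dim_row (levi_block l ((-1) ^ l) (1\<^sub>m l) (1\<^sub>m l) * insert_middle l K)"
      "j < dim_col (levi_block l ((-1) ^ l) (1\<^sub>m l) (1\<^sub>m l) * insert_middle l K)"
    then have i: "i < 2 * l + 1" and j: "j < 2 * l + 1" by (auto simp: levi_block_def insert_middle_def)
    have s: "(\<Sum>t<l. 1\<^sub>m l $$ (k, t) * G t) = G k" if "k < l" for k and G :: "nat \<Rightarrow> 'f"
    proof -
      have "(\<Sum>t<l. 1\<^sub>m l $$ (k, t) * G t) = (\<Sum>t<l. if k = t then G t else 0)"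
        using that by (intro sum.cong) auto
      then show ?thesis using that by simp
    qed
    have c: "i < l \<or> i = l \<or> l < i" by linarith
    have eq: "(levi_block l ((-1) ^ l) (1\<^sub>m l) (1\<^sub>m l) * insert_middle l K) $$ (i, j) =
        (if i = l then (-1) ^ l else 1) * insert_middle l K $$ (i, j)"
      unfolding levi_block_mult_index[OF insert_middle_carrier i j] using i c
      by (elim disjE) (simp_all add: s del: index_one_mat)
    have "i < l \<or> i = l \<or> l < i" "j < l \<or> j = l \<or> l < j" by linarith+
    then show "w_mat l $$ (i, j) =
        (levi_block l ((-1) ^ l) (1\<^sub>m l) (1\<^sub>m l) * insert_middle l K) $$ (i, j)"
      unfolding eq insert_middle_index[OF i j] using i j
      by (elim disjE) (auto simp: w_mat_def K_def)
  qed (auto simp: levi_block_def insert_middle_def w_mat_def)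
  then have "det (w_mat l :: 'f mat) = (-1) ^ l * det K"
    by (simp add: det_mult[OF levi_block_carrier insert_middle_carrier] det_levi_block_one
        det_insert_middle[OF K])
  also have "det K = (-1) ^ (l * l) * det (1\<^sub>m (2 * l) :: 'f mat)"
  proof -
    have "mat (2 * l) (2 * l) (\<lambda>(i, j). K $$ (if i < l then i + l else if i < l + l then i - l else i, j))
        = 1\<^sub>m (2 * l)"
      by (rule eq_matI) (auto simp: K_def)
    then show ?thesis using det_swap_initial_rows[OF K, of l l] by simp
  qed
  also have "(-1) ^ l * ((-1) ^ (l * l) * det (1\<^sub>m (2 * l) :: 'f mat)) = 1"
    by (cases "even l") auto
  finally show ?thesis .
qed

lemma w_mat_SO: "w_mat l \<in> carrier (SO (2 * l + 1))"
  unfolding mem_SO_iff by (simp add: det_w_mat flip_w_mat w_mat_square del: One_nat_def add_Suc_right add_0_right)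

section \<open>The Siegel unipotent radical\<close>

text \<open>Membership in the unipotent radical without the orthogonality condition.\<close>

definition block_unipotent :: "nat \<Rightarrow> 'f::field mat \<Rightarrow> bool" where
  "block_unipotent l u \<longleftrightarrow> u \<in> carrier_mat (2 * l + 1) (2 * l + 1) \<and>
     (\<forall>i<2 * l + 1. \<forall>j<2 * l + 1.
       siegel_block l j \<le> siegel_block l i \<longrightarrow> u $$ (i, j) = (if i = j then 1 else 0))"

lemma det_unitriangular:
  fixes u :: "'f::field mat"
  assumes u: "u \<in> carrier_mat n n" and "upper_triangular u" "\<And>i. i < n \<Longrightarrow> u $$ (i, i) = 1"
  shows "det u = 1"
proof -
  have "det u = prod_list (diag_mat u)" by (rule det_upper_triangular[OF assms(2) u])
  also have "\<dots> = 1" using u assms(3) by (auto simp: prod_list_diag_prod intro!: prod.neutral)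
  finally show ?thesis .
qed

lemma siegel_block_mono: "j \<le> i \<Longrightarrow> siegel_block l j \<le> siegel_block l i"
  by (auto simp: siegel_block_def)

text \<open>Block unipotent matrices are unitriangular, so their determinant is 1.\<close>

lemma mem_siegel_unip_iff:
  "u \<in> siegel_unip l \<longleftrightarrow> block_unipotent l u \<and> flip u * u = 1\<^sub>m (2 * l + 1)"
proof -
  have "det u = 1" if "block_unipotent l u"
    using that by (intro det_unitriangular)
      (auto simp: block_unipotent_def upper_triangular_def siegel_block_mono)
  then show ?thesis
    unfolding siegel_unip_def mem_SO_iff mem_Collect_eq using block_unipotent_def by blast
qed

lemma siegel_unip_SO: "u \<in> siegel_unip l \<Longrightarrow> u \<in> carrier (SO (2 * l + 1))"
  by (simp add: siegel_unip_def)

text \<open>On and below the block diagonal only the diagonal term of the product sum survives: a nonzero factor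
  from \<open>u\<close> off the diagonal raises the block index, and then \<open>v\<close> would have to lower it.\<close>

lemma block_unipotent_mult:
  assumes u: "block_unipotent l u" and v: "block_unipotent l v"
  shows "block_unipotent l (u * v)"
proof -
  have C: "u \<in> carrier_mat (2 * l + 1) (2 * l + 1)" "v \<in> carrier_mat (2 * l + 1) (2 * l + 1)"
    using u v by (auto simp: block_unipotent_def)
  have "(u * v) $$ (i, j) = (if i = j then 1 else 0)"
    if i: "i < 2 * l + 1" and j: "j < 2 * l + 1" and le: "siegel_block l j \<le> siegel_block l i" for i j
  proof -
    have z: "u $$ (i, t) * v $$ (t, j) = 0" if "t < 2 * l + 1" "t \<noteq> i" for t
    proof (cases "siegel_block l t \<le> siegel_block l i")
      case True
      then have "u $$ (i, t) = 0" using u i that by (auto simp: block_unipotent_def)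
      then show ?thesis by simp
    next
      case False
      then have "siegel_block l j \<le> siegel_block l t" "t \<noteq> j" using le by auto
      then have "v $$ (t, j) = 0" using v j that by (auto simp: block_unipotent_def)
      then show ?thesis by simp
    qed
    have "(u * v) $$ (i, j) = (\<Sum>t<2 * l + 1. u $$ (i, t) * v $$ (t, j))"
      by (rule index_mult_sum[OF C i j])
    also have "\<dots> = u $$ (i, i) * v $$ (i, j)"
    proof -
      have "(\<Sum>t\<in>{..<2 * l + 1} - {i}. u $$ (i, t) * v $$ (t, j)) = 0"
        using z by (intro sum.neutral) blast
      then show ?thesis using i by (subst sum.remove[of _ i]) simp_all
    qed
    finally show ?thesis using u v i j le unfolding block_unipotent_def by auto
  qed
  then show ?thesis using C unfolding block_unipotent_def by (auto intro: mult_square_carrier)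
qed

lemma siegel_unip_mult: "u \<in> siegel_unip l \<Longrightarrow> v \<in> siegel_unip l \<Longrightarrow> u * v \<in> siegel_unip l"
  unfolding mem_siegel_unip_iff
  by (intro conjI block_unipotent_mult flip_mult_orthogonal) (auto simp: block_unipotent_def)

text \<open>Writing \<open>u = 1 + N\<close>, block diagonal factors permute no blocks, so they keep \<open>N\<close> strictly above the
  block diagonal.\<close>

lemma block_unipotent_conj:
  fixes a d a' d' u :: "'f::field mat"
  assumes u: "block_unipotent l u"
    and inv: "levi_block l 1 a d * levi_block l 1 a' d' = 1\<^sub>m (2 * l + 1)"
  shows "block_unipotent l (levi_block l 1 a d * u * levi_block l 1 a' d')"
proof -
  define n where "n = 2 * l + 1"
  define L where "L = levi_block l 1 a d"
  define L' where "L' = levi_block l 1 a' d'"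
  have C: "L \<in> carrier_mat n n" "L' \<in> carrier_mat n n" "u \<in> carrier_mat n n"
    using u levi_block_carrier by (auto simp: L_def L'_def n_def block_unipotent_def)
  define N where "N = u - 1\<^sub>m n"
  have N: "N \<in> carrier_mat n n" unfolding N_def by (intro minus_carrier_mat one_carrier_mat)
  have LN: "L * N \<in> carrier_mat n n" using C(1) N by (rule mult_square_carrier)
  have N0: "N $$ (i, j) = 0" if "i < n" "j < n" "siegel_block l j \<le> siegel_block l i" for i j
    using that u C by (auto simp: N_def block_unipotent_def n_def)
  have "u = 1\<^sub>m n + N" using C by (intro eq_matI) (auto simp: N_def)
  then have "L * u * L' = (L * 1\<^sub>m n + L * N) * L'"
    using mult_add_distrib_mat[OF C(1) one_carrier_mat N] by simp
  also have "\<dots> = L * 1\<^sub>m n * L' + L * N * L'"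
    using C by (intro add_mult_distrib_mat[of _ n n] LN mult_square_carrier one_carrier_mat)
  also have "L * 1\<^sub>m n * L' = 1\<^sub>m n"
    using inv C by (simp add: L_def L'_def n_def)
  finally have eq: "L * u * L' = 1\<^sub>m n + L * N * L'" .
  have LN0: "(L * N) $$ (i, j) = 0" if ij: "i < n" "j < n" "siegel_block l j \<le> siegel_block l i" for i j
  proof -
    note eq = levi_block_mult_index[OF N[unfolded n_def] ij(1,2)[unfolded n_def], of 1 a d, folded L_def]
    have N0': "N $$ (t, j) = 0" if "t < n" "siegel_block l t = siegel_block l i" for t
      using N0[OF that(1) ij(2)] that ij(3) by simp
    have "i < l \<or> i = l \<or> l < i" by linarith
    then show ?thesis
    proof (elim disjE)
      assume "i < l"
      moreover from this have "N $$ (t, j) = 0" if "t < l" for t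
        using that by (intro N0') (auto simp: siegel_block_def n_def)
      ultimately show ?thesis unfolding eq by simp
    next
      assume "i = l"
      then show ?thesis unfolding eq using N0'[OF ij(1)] by simp
    next
      assume "l < i"
      moreover from this have "N $$ (l + 1 + t, j) = 0" if "t < l" for t
        using that by (intro N0') (auto simp: siegel_block_def n_def)
      ultimately show ?thesis unfolding eq by simp
    qed
  qed
  have LNL0: "(L * N * L') $$ (i, j) = 0"
    if ij: "i < n" "j < n" "siegel_block l j \<le> siegel_block l i" for i j
  proof -
    note eq = mult_levi_block_index[OF LN[unfolded n_def] ij(1,2)[unfolded n_def], of 1 a' d', folded L'_def]
    have N0': "(L * N) $$ (i, t) = 0" if "t < n" "siegel_block l t = siegel_block l j" for t
      using LN0[OF ij(1) that(1)] that ij(3) by (simp del: index_mult_mat(1))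
    have "j < l \<or> j = l \<or> l < j" by linarith
    then show ?thesis
    proof (elim disjE)
      assume "j < l"
      moreover from this have "(L * N) $$ (i, t) = 0" if "t < l" for t
        using that by (intro N0') (auto simp: siegel_block_def n_def)
      ultimately show ?thesis unfolding eq by (simp del: index_mult_mat(1))
    next
      assume "j = l"
      then show ?thesis unfolding eq using N0'[OF ij(2)] by (simp del: index_mult_mat(1))
    next
      assume "l < j"
      moreover from this have "(L * N) $$ (i, l + 1 + t) = 0" if "t < l" for t
        using that by (intro N0') (auto simp: siegel_block_def n_def)
      ultimately show ?thesis unfolding eq by (simp del: index_mult_mat(1))
    qed
  qed
  have LNLC: "L * N * L' \<in> carrier_mat n n" using LN C(2) by (rule mult_square_carrier)
  show ?thesis
    unfolding block_unipotent_def L_def[symmetric] L'_def[symmetric] n_def[symmetric] eq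
    using LNL0 LNLC C by (auto simp del: index_mult_mat(1))
qed

section \<open>The Siegel Levi subgroup\<close>

lemma star_inverse:
  fixes a b :: "'f::field mat"
  assumes "a \<in> carrier_mat l l" "b \<in> carrier_mat l l" "b * a = 1\<^sub>m l"
  shows "star l a = flip b" "star l b = flip a"
  using assms mat_mult_left_right_inverse[of b l a] by (auto intro: star_eq_flip)

lemma siegel_levi_inverse:
  fixes a b :: "'f::field mat"
  assumes a: "a \<in> carrier_mat l l" and b: "b \<in> carrier_mat l l" and ba: "b * a = 1\<^sub>m l"
  shows "siegel_levi l a = levi_block l 1 a (flip b)"
    and "siegel_levi l b = levi_block l 1 b (flip a)"
    and "siegel_levi l b * siegel_levi l a = 1\<^sub>m (2 * l + 1)"
    and "siegel_levi l a * siegel_levi l b = 1\<^sub>m (2 * l + 1)"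
    and "flip (siegel_levi l a) = siegel_levi l b"
    and "siegel_levi l a \<in> carrier_mat (2 * l + 1) (2 * l + 1)"
    and "siegel_levi l b \<in> carrier_mat (2 * l + 1) (2 * l + 1)"
proof -
  note s = star_inverse[OF a b ba]
  show A: "siegel_levi l a = levi_block l 1 a (flip b)"
    using mem_GL_of_inverse[OF a b ba] by (simp add: siegel_levi_eq s)
  show B: "siegel_levi l b = levi_block l 1 b (flip a)"
    using mem_GL_of_inverse[OF a b ba] by (simp add: siegel_levi_eq s)
  have ab: "a * b = 1\<^sub>m l" by (rule mat_mult_left_right_inverse[OF b a ba])
  have "flip a * flip b = 1\<^sub>m l" unfolding flip_mult[OF b a, symmetric] ba by simp
  moreover have "flip b * flip a = 1\<^sub>m l" unfolding flip_mult[OF a b, symmetric] ab by simp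
  ultimately show "siegel_levi l b * siegel_levi l a = 1\<^sub>m (2 * l + 1)"
    "siegel_levi l a * siegel_levi l b = 1\<^sub>m (2 * l + 1)"
    unfolding A B using a b ab ba by (simp_all add: levi_block_mult levi_block_one)
  show "flip (siegel_levi l a) = siegel_levi l b"
    unfolding A B using a b by (simp add: flip_levi_block)
  show "siegel_levi l a \<in> carrier_mat (2 * l + 1) (2 * l + 1)"
    "siegel_levi l b \<in> carrier_mat (2 * l + 1) (2 * l + 1)"
    unfolding A B by (rule levi_block_carrier)+
qed

lemma siegel_unip_conj:
  fixes a b u :: "'f::field mat"
  assumes a: "a \<in> carrier_mat l l" and b: "b \<in> carrier_mat l l" and ba: "b * a = 1\<^sub>m l"
    and u: "u \<in> siegel_unip l"
  shows "siegel_levi l b * u * siegel_levi l a \<in> siegel_unip l"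
proof -
  note L = siegel_levi_inverse[OF a b ba]
  have uC: "u \<in> carrier_mat (2 * l + 1) (2 * l + 1)" using u by (simp add: mem_siegel_unip_iff block_unipotent_def)
  have f: "flip (siegel_levi l b) = siegel_levi l a"
    using L(5) flip_flip[OF L(6)] by simp
  have "block_unipotent l (siegel_levi l b * u * siegel_levi l a)"
    unfolding L(1,2) using u L(3) by (intro block_unipotent_conj) (auto simp: mem_siegel_unip_iff L(1,2))
  moreover have "flip (siegel_levi l b * u * siegel_levi l a) * (siegel_levi l b * u * siegel_levi l a)
      = 1\<^sub>m (2 * l + 1)"
    using L u uC f
    by (intro flip_mult_orthogonal mult_square_carrier) (auto simp: mem_siegel_unip_iff simp del: add_Suc_right One_nat_def)
  ultimately show ?thesis by (simp add: mem_siegel_unip_iff)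
qed

text \<open>The Levi decomposition of the parabolic subgroup. A block upper triangular orthogonal matrix has
  bottom right block \<open>a\<^sup>*\<close> as soon as its top left block is \<open>a\<close>, because the adjoint of the matrix is its
  inverse; dividing by the Levi element leaves identity blocks on the diagonal.\<close>

lemma siegel_decomposition:
  fixes y a b :: "'f::field mat"
  assumes y: "y \<in> carrier_mat (2 * l + 1) (2 * l + 1)" "flip y * y = 1\<^sub>m (2 * l + 1)"
    and low: "\<And>i j. i < 2 * l + 1 \<Longrightarrow> j < 2 * l + 1 \<Longrightarrow> siegel_block l j < siegel_block l i \<Longrightarrow> y $$ (i, j) = 0"
    and mid: "y $$ (l, l) = 1"
    and a: "a \<in> carrier_mat l l" and b: "b \<in> carrier_mat l l" and ba: "b * a = 1\<^sub>m l"
    and ya: "\<And>i j. i < l \<Longrightarrow> j < l \<Longrightarrow> y $$ (i, j) = a $$ (i, j)"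
  shows "\<exists>v\<in>siegel_unip l. y = siegel_levi l a * v"
proof (rule bexI)
  note L = siegel_levi_inverse[OF a b ba]
  have "siegel_levi l a * (siegel_levi l b * y) = siegel_levi l a * siegel_levi l b * y"
    using L(6,7) y(1) by (intro assoc_mult_square[symmetric])
  then show "y = siegel_levi l a * (siegel_levi l b * y)" using y(1) by (simp add: L(4))
  have orth: "flip (siegel_levi l b * y) * (siegel_levi l b * y) = 1\<^sub>m (2 * l + 1)"
    using L(4,5,6,7) y flip_flip[OF L(6)] by (intro flip_mult_orthogonal) auto
  \<comment> \<open>The lower right block of \<open>y\<close> is inverse to the adjoint of \<open>a\<close>.\<close>
  have dual: "(\<Sum>t<l. flip a $$ (i, t) * y $$ (l + 1 + t, l + 1 + j)) = (if i = j then 1 else 0)"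
    if i: "i < l" and j: "j < l" for i j
  proof -
    have fC: "flip y \<in> carrier_mat (2 * l + 1) (2 * l + 1)" using y(1) by (rule flip_carrier)
    have i': "l + 1 + i < 2 * l + 1" and j': "l + 1 + j < 2 * l + 1" using i j by auto
    have f: "flip y $$ (l + 1 + i, t) = y $$ (2 * l - t, l - 1 - i)" if "t < 2 * l + 1" for t
      using flip_index[OF y(1) i' that] i by (simp add: diff_diff_eq)
    have f0: "flip y $$ (l + 1 + i, t) = 0" if "t \<le> l" for t
    proof -
      have "y $$ (2 * l - t, l - 1 - i) = 0"
        using that i by (intro low) (auto simp: siegel_block_def)
      then show ?thesis using f[of t] that by simp
    qed
    have fa: "flip y $$ (l + 1 + i, l + 1 + t) = flip a $$ (i, t)" if "t < l" for t
    proof -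
      have "2 * l - (l + 1 + t) = l - 1 - t" using that by simp
      then have "flip y $$ (l + 1 + i, l + 1 + t) = y $$ (l - 1 - t, l - 1 - i)"
        using f[of "l + 1 + t"] that by simp
      also have "\<dots> = a $$ (l - 1 - t, l - 1 - i)" using that i by (intro ya) auto
      also have "\<dots> = flip a $$ (i, t)" using i that by (intro flip_index[OF a, symmetric])
      finally show ?thesis .
    qed
    have "(if i = j then 1 else 0) = (flip y * y) $$ (l + 1 + i, l + 1 + j)"
      using i' j' by (simp add: y(2))
    also have "\<dots> = (\<Sum>t<2 * l + 1. flip y $$ (l + 1 + i, t) * y $$ (t, l + 1 + j))"
      by (rule index_mult_sum[OF fC y(1) i' j'])
    also have "\<dots> = (\<Sum>t<l. flip y $$ (l + 1 + i, l + 1 + t) * y $$ (l + 1 + t, l + 1 + j))"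
      unfolding sum_siegel_blocks using f0 by (simp del: One_nat_def add_Suc_right)
    also have "\<dots> = (\<Sum>t<l. flip a $$ (i, t) * y $$ (l + 1 + t, l + 1 + j))"
      by (intro sum.cong refl) (simp only: fa lessThan_iff)
    finally show ?thesis by simp
  qed
  have diag: "(\<Sum>t<l. b $$ (i, t) * y $$ (t, j)) = (if i = j then 1 else 0)" if i: "i < l" and j: "j < l" for i j
  proof -
    have "(\<Sum>t<l. b $$ (i, t) * y $$ (t, j)) = (\<Sum>t<l. b $$ (i, t) * a $$ (t, j))"
      using j by (intro sum.cong) (auto simp: ya)
    also have "\<dots> = (b * a) $$ (i, j)" using i j by (rule index_mult_sum[OF b a, symmetric])
    finally show ?thesis using i j by (simp add: ba)
  qed
  have "block_unipotent l (siegel_levi l b * y)"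
    unfolding block_unipotent_def
  proof (intro conjI allI impI)
    show "siegel_levi l b * y \<in> carrier_mat (2 * l + 1) (2 * l + 1)"
      using L(7) y(1) by (rule mult_square_carrier)
    fix i j assume i: "i < 2 * l + 1" and j: "j < 2 * l + 1"
      and le: "siegel_block l j \<le> siegel_block l i"
    note eq = levi_block_mult_index[OF y(1) i j, of 1 b "flip a", folded L(2)]
    consider (top) "i < l" "j < l" | (mid) "i = l" "j < l" | (centre) "i = l" "j = l"
      | (low) "l < i" "j \<le> l" | (bot) "l < i" "l < j"
      using le by (auto simp: siegel_block_def split: if_splits)
    then show "(siegel_levi l b * y) $$ (i, j) = (if i = j then 1 else 0)"
    proof cases
      case top
      then show ?thesis unfolding eq using diag by simp
    next
      case mid
      then show ?thesis unfolding eq using low[of l j] j by (simp add: siegel_block_def)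
    next
      case centre
      then show ?thesis unfolding eq using assms(4) by simp
    next
      case low
      then have "y $$ (l + 1 + t, j) = 0" if "t < l" for t
        using that j by (intro assms(3)) (auto simp: siegel_block_def)
      then show ?thesis unfolding eq using low by (auto intro!: sum.neutral)
    next
      case bot
      define i' where "i' = i - l - 1"
      define j' where "j' = j - l - 1"
      have "i' < l" "j' < l" "i = l + 1 + i'" "j = l + 1 + j'" using bot i j by (auto simp: i'_def j'_def)
      then show ?thesis unfolding eq using dual[of i' j'] by simp
    qed
  qed
  then show "siegel_levi l b * y \<in> siegel_unip l" using orth by (simp add: mem_siegel_unip_iff)
qed

section \<open>Unipotent elements of the even orthogonal group\<close>

text \<open>The reflection of the middle plane that fixes the column \<open>(1/4, - 1/2)\<close>. This column is the functional
  by which the last coordinates enter the character of the unipotent group, so the reflection preserves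
  the character, whereas \<open>c\<close> in general does not. It differs from \<open>c\<close> by a diagonal element of determinant 1.\<close>

definition whittaker_reflection :: "nat \<Rightarrow> 'f::field mat" where
  "whittaker_reflection l = plane_swap l (- 1 / 2) (- 2)"

lemma U_SO_iff:
  "u \<in> U_SO n \<longleftrightarrow> u \<in> carrier_mat n n \<and> flip u * u = 1\<^sub>m n \<and> upper_triangular u \<and> (\<forall>i<n. u $$ (i, i) = 1)"
  using det_unitriangular[of u n] by (auto simp: U_SO_def mem_SO_iff)

lemma U_SO_SO: "u \<in> U_SO n \<Longrightarrow> u \<in> carrier (SO n)"
  by (simp add: U_SO_def)

lemma upper_triangular_mult:
  fixes u v :: "'f::field mat"
  assumes u: "u \<in> carrier_mat n n" "upper_triangular u" and v: "v \<in> carrier_mat n n" "upper_triangular v"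
  shows "upper_triangular (u * v)"
    and "i < n \<Longrightarrow> (u * v) $$ (i, i) = u $$ (i, i) * v $$ (i, i)"
proof -
  have u0: "u $$ (i, t) = 0" if "t < i" "i < n" for i t using u that by (auto simp: upper_triangular_def)
  have v0: "v $$ (i, t) = 0" if "t < i" "i < n" for i t using v that by (auto simp: upper_triangular_def)
  have z: "u $$ (i, t) * v $$ (t, j) = 0" if "j \<le> i" "i < n" "t < n" "t \<noteq> i \<or> j \<noteq> i" for i j t
    using that u0[of t i] v0[of j t] by (cases "t < i") auto
  have eq: "(u * v) $$ (i, j) = (\<Sum>t<n. u $$ (i, t) * v $$ (t, j))" if "i < n" "j < n" for i j
    by (rule index_mult_sum[OF u(1) v(1) that])
  show "upper_triangular (u * v)"
    unfolding upper_triangular_def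
  proof (intro allI impI)
    fix i j assume "i < dim_row (u * v)" and ji: "j < i"
    then have i: "i < n" using u by auto
    then have "(u * v) $$ (i, j) = (\<Sum>t<n. u $$ (i, t) * v $$ (t, j))" using ji by (intro eq) auto
    also have "\<dots> = 0" using i ji by (intro sum.neutral ballI z) auto
    finally show "(u * v) $$ (i, j) = 0" .
  qed
  assume i: "i < n"
  have "(\<Sum>t\<in>{..<n} - {i}. u $$ (i, t) * v $$ (t, i)) = 0" using i by (intro sum.neutral ballI z) auto
  then show "(u * v) $$ (i, i) = u $$ (i, i) * v $$ (i, i)"
    unfolding eq[OF i i] using i by (subst sum.remove[of _ i]) simp_all
qed

lemma U_SO_subgroup: "subgroup (U_SO n) (SO n)"
proof (rule group.subgroupI[OF SO_group])
  show "U_SO n \<subseteq> carrier (SO n)" by (auto simp: U_SO_def)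
  have "(1\<^sub>m n :: 'a mat) \<in> U_SO n" by (auto simp: U_SO_iff upper_triangular_def)
  then show "(U_SO n :: 'a mat set) \<noteq> {}" by blast
next
  fix u :: "'a mat" assume u: "u \<in> U_SO n"
  then have uC: "u \<in> carrier_mat n n" by (simp add: U_SO_iff)
  have "upper_triangular (flip u)"
    unfolding upper_triangular_def
  proof (intro allI impI)
    fix i j assume "i < dim_row (flip u)" "j < i"
    then have ij: "i < n" "j < n" "n - 1 - i < n - 1 - j" using uC by auto
    then show "flip u $$ (i, j) = 0"
      using u flip_index[OF uC ij(1,2)] by (auto simp: U_SO_iff upper_triangular_def)
  qed
  moreover have "flip u $$ (i, i) = 1" if "i < n" for i
    using u flip_index[OF uC that that] that by (auto simp: U_SO_iff)
  ultimately show "inv\<^bsub>SO n\<^esub> u \<in> U_SO n"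
    using u SO_flip[OF U_SO_SO[OF u]] unfolding SO_inv[OF U_SO_SO[OF u]] by (simp add: U_SO_def)
next
  fix u v :: "'a mat" assume "u \<in> U_SO n" "v \<in> U_SO n"
  then show "u \<otimes>\<^bsub>SO n\<^esub> v \<in> U_SO n"
    using upper_triangular_mult[of u n v] by (auto simp: U_SO_iff flip_mult_orthogonal mult_square_carrier)
qed

context
  fixes l :: nat
  assumes l: "l \<ge> 1" and two: "(2 :: 'f::field) \<noteq> 0"
begin

text \<open>A unipotent upper triangular rotation of a hyperbolic plane is trivial: orthogonality gives twice
  the entry above the diagonal the value 0.\<close>

lemma U_SO_block_unitri:
  fixes u :: "'f mat"
  assumes u: "u \<in> U_SO (2 * l)"
  shows "block_unitri (l - 1) (l + 1) (2 * l) u"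
proof -
  have uC: "u \<in> carrier_mat (2 * l) (2 * l)" and orth: "flip u * u = 1\<^sub>m (2 * l)"
    and u1: "\<And>i. i < 2 * l \<Longrightarrow> u $$ (i, i) = 1"
    and u0: "\<And>i j. i < 2 * l \<Longrightarrow> j < i \<Longrightarrow> u $$ (i, j) = 0"
    using u by (auto simp: U_SO_iff upper_triangular_def)
  have less: "l - 1 < 2 * l" "l < 2 * l" "l - 1 \<noteq> l" using l by auto
  \<comment> \<open>Only the two middle indices contribute to this entry of the orthogonality relation.\<close>
  have "0 = (flip u * u) $$ (l - 1, l)" using less by (simp add: orth)
  also have "\<dots> = (\<Sum>t<2 * l. flip u $$ (l - 1, t) * u $$ (t, l))"
    by (rule index_mult_sum[OF flip_carrier[OF uC] uC less(1,2)])
  also have "\<dots> = (\<Sum>t\<in>{l - 1, l}. flip u $$ (l - 1, t) * u $$ (t, l))"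
  proof (rule sum.mono_neutral_right)
    show "\<forall>t\<in>{..<2 * l} - {l - 1, l}. flip u $$ (l - 1, t) * u $$ (t, l) = 0"
    proof
      fix t assume "t \<in> {..<2 * l} - {l - 1, l}"
      then have t: "t < 2 * l" "t \<noteq> l - 1" "t \<noteq> l" by auto
      have "flip u $$ (l - 1, t) = u $$ (2 * l - 1 - t, 2 * l - 1 - (l - 1))"
        using less t by (intro flip_index[OF uC])
      moreover have "2 * l - 1 - (l - 1) = l" using l by simp
      moreover have "t < l \<Longrightarrow> l < 2 * l - 1 - t" using t l by linarith
      ultimately show "flip u $$ (l - 1, t) * u $$ (t, l) = 0"
        using t u0[of "2 * l - 1 - t" l] u0[of t l] by (cases "t < l") auto
    qed
  qed (use less in auto)
  also have "\<dots> = flip u $$ (l - 1, l - 1) * u $$ (l - 1, l) + flip u $$ (l - 1, l) * u $$ (l, l)"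
    using less by simp
  also have "flip u $$ (l - 1, l - 1) = 1"
    using flip_index[OF uC less(1,1)] u1 less l by simp
  also have "flip u $$ (l - 1, l) = u $$ (l - 1, l)"
  proof -
    have "2 * l - 1 - l = l - 1" "2 * l - 1 - (l - 1) = l" using l by auto
    then show ?thesis using flip_index[OF uC less(1,2)] by simp
  qed
  also have "1 * u $$ (l - 1, l) + u $$ (l - 1, l) * u $$ (l, l) = 2 * u $$ (l - 1, l)"
    using u1 less by simp
  finally have mid: "u $$ (l - 1, l) = 0" using two by simp
  have "u $$ (i, j) = (if i = j then 1 else 0)"
    if "i < 2 * l" "j < 2 * l" "j \<le> i \<or> l - 1 \<le> i \<and> j < l + 1" for i j
  proof -
    have "j < i \<or> j = i \<or> i = l - 1 \<and> j = l" using that by linarith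
    then show ?thesis using u1 u0 mid that less(3) by (elim disjE) auto
  qed
  then show ?thesis using uC by (simp add: block_unitri_def)
qed

lemma block_unitri_U_SO:
  fixes u :: "'f mat"
  assumes "block_unitri (l - 1) (l + 1) (2 * l) u" "flip u * u = 1\<^sub>m (2 * l)"
  shows "u \<in> U_SO (2 * l)"
  using assms unfolding U_SO_iff block_unitri_def upper_triangular_def by auto

abbreviation "rho \<equiv> whittaker_reflection l :: 'f mat"

lemma rho_carrier: "rho \<in> carrier_mat (2 * l) (2 * l)"
  by (simp add: whittaker_reflection_def)

lemma rho_square: "rho * rho = 1\<^sub>m (2 * l)"
  unfolding whittaker_reflection_def using l two by (intro plane_swap_square) auto

lemma rho_orthogonal: "flip rho * rho = 1\<^sub>m (2 * l)"
  using rho_square l by (simp add: whittaker_reflection_def flip_plane_swap)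

lemma c_mat_square: "c_mat l * c_mat l = (1\<^sub>m (2 * l) :: 'f mat)"
  using l by (simp add: c_mat_eq_plane_swap plane_swap_square)

lemma c_mat_orthogonal: "flip (c_mat l) * c_mat l = (1\<^sub>m (2 * l) :: 'f mat)"
  using c_mat_square l by (simp add: c_mat_eq_plane_swap flip_plane_swap)

text \<open>The middle block of \<open>u\<close> is trivial, so conjugation only recombines the middle columns above it and the
  middle rows to the right of it. The character reads these columns through the functional \<open>(1/4, - 1/2)\<close>,
  which the reflection fixes.\<close>

lemma U_SO_rho_conj:
  fixes u :: "'f mat"
  assumes u: "u \<in> U_SO (2 * l)"
  shows "rho * u * rho \<in> U_SO (2 * l)" and "psi_SO \<psi> l (rho * u * rho) = psi_SO \<psi> l u"
proof -
  have uC: "u \<in> carrier_mat (2 * l) (2 * l)" and orth: "flip u * u = 1\<^sub>m (2 * l)"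
    using u by (auto simp: U_SO_iff)
  have id: "block_id (l - 1) (l + 1) (2 * l) rho"
    unfolding whittaker_reflection_def using l by (rule block_id_plane_swap)
  have "block_unitri (l - 1) (l + 1) (2 * l) (rho * u * rho)"
    using l by (intro block_unitri_conj id rho_square U_SO_block_unitri u) auto
  moreover have "flip (rho * u * rho) * (rho * u * rho) = 1\<^sub>m (2 * l)"
    by (intro flip_mult_orthogonal mult_square_carrier rho_carrier rho_orthogonal uC orth)
  ultimately show "rho * u * rho \<in> U_SO (2 * l)" by (rule block_unitri_U_SO)
  have ruC: "rho * u \<in> carrier_mat (2 * l) (2 * l)" by (intro mult_square_carrier rho_carrier uC)
  show "psi_SO \<psi> l (rho * u * rho) = psi_SO \<psi> l u"
  proof (cases "l = 1")
    case False
    then have l2: "l \<ge> 2" using l by auto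
    have e: "(rho * u * rho) $$ (i, j) = (if j = l - 1 then u $$ (i, l) * - 2
        else if j = l then u $$ (i, l - 1) * (- 1 / 2) else u $$ (i, j))" if ij: "i < l - 1" "j < 2 * l" for i j
    proof -
      have i: "i < 2 * l" and ne: "i \<noteq> l - 1" "i \<noteq> l" using ij by auto
      have "(rho * u) $$ (i, t) = u $$ (i, t)" if "t < 2 * l" for t
        unfolding whittaker_reflection_def
        using plane_swap_mult_index[OF l uC i that] ne by simp
      then show ?thesis
        using mult_plane_swap_index[OF l ruC i ij(2), of "- 1 / 2" "- 2", folded whittaker_reflection_def] ij(2) l
        by simp
    qed
    have "(\<Sum>i<l - 2. (rho * u * rho) $$ (i, i + 1)) = (\<Sum>i<l - 2. u $$ (i, i + 1))"
      using l2 by (intro sum.cong refl) (subst e, auto)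
    moreover have "(rho * u * rho) $$ (l - 2, l - 1) = u $$ (l - 2, l) * - 2"
      using l2 by (subst e) auto
    moreover have "(rho * u * rho) $$ (l - 2, l) = u $$ (l - 2, l - 1) * (- 1 / 2)"
      using l2 by (subst e) auto
    moreover have "2 * x / 4 = x / 2" for x :: 'f
    proof -
      have "2 * x / 4 = 2 * x / (2 * 2)" by simp
      also have "\<dots> = x / 2" using two by (rule nonzero_mult_divide_mult_cancel_left)
      finally show ?thesis .
    qed
    moreover have "(4 :: 'f) \<noteq> 0"
    proof -
      have "(4 :: 'f) = 2 * 2" by simp
      then show ?thesis using two by (metis mult_eq_0_iff)
    qed
    ultimately have "(\<Sum>i<l - 2. (rho * u * rho) $$ (i, i + 1)) + 1 / 4 * (rho * u * rho) $$ (l - 2, l - 1)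
        - 1 / 2 * (rho * u * rho) $$ (l - 2, l)
      = (\<Sum>i<l - 2. u $$ (i, i + 1)) + 1 / 4 * u $$ (l - 2, l - 1) - 1 / 2 * u $$ (l - 2, l)"
      by simp
    then show ?thesis using False unfolding psi_SO_def by (simp only: if_False)
  qed (simp add: psi_SO_def)
qed

lemma det_rho_c: "det (rho * c_mat l) = 1"
proof -
  have C: "rho * c_mat l \<in> carrier_mat (2 * l) (2 * l)"
    using l by (intro mult_square_carrier rho_carrier c_mat_carrier)
  have less: "l - 1 < 2 * l" "l < 2 * l" "l - 1 \<noteq> l" using l by auto
  have e: "(rho * c_mat l) $$ (i, j) = (if i = j then if i = l - 1 then - 1 / 2 else if i = l then - 2 else 1 else 0)"
    if ij: "i < 2 * l" "j < 2 * l" for i j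
    using mult_plane_swap_index[OF l rho_carrier ij, of 1 1] l ij less
    unfolding c_mat_eq_plane_swap[OF l] by (simp add: whittaker_reflection_def plane_swap_index)
  have "upper_triangular (rho * c_mat l)"
    unfolding upper_triangular_def using C by (auto simp: e simp del: index_mult_mat(1))
  then have "det (rho * c_mat l) = prod_list (diag_mat (rho * c_mat l))"
    using C by (rule det_upper_triangular)
  also have "\<dots> = (\<Prod>i<2 * l. (rho * c_mat l) $$ (i, i))"
    using C by (simp only: prod_list_diag_prod atLeast0LessThan carrier_matD(1))
  also have "\<dots> = (\<Prod>i<2 * l. if i = l - 1 then - 1 / 2 else if i = l then - 2 else 1)"
    by (intro prod.cong refl) (simp add: e del: index_mult_mat(1))
  also have "\<dots> = (\<Prod>i\<in>{l - 1, l}. if i = l - 1 then - 1 / 2 else if i = l then - 2 else 1)"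
    using less by (intro prod.mono_neutral_right) auto
  also have "\<dots> = 1" using less two by simp
  finally show ?thesis .
qed

text \<open>Both reflections have determinant \<open>- 1\<close>, so the product is in the special orthogonal group although
  neither factor is. The map \<open>g \<mapsto> \<rho> * g * c\<close> is the substitution used in the zeta sum.\<close>

lemma rho_g_c_SO:
  assumes "g \<in> carrier (SO (2 * l))"
  shows "rho * g * c_mat l \<in> carrier (SO (2 * l))"
proof -
  note C = rho_carrier SO_carrier[OF assms] c_mat_carrier[OF l, where 'a = 'f]
  have "det (rho * g * c_mat l) = det g * det (rho * c_mat l)"
    using C by (simp add: det_mult[of _ "2 * l"] mult_square_carrier)
  also have "\<dots> = 1" using assms by (simp add: mem_SO_iff det_rho_c)
  moreover have "flip (rho * g * c_mat l) * (rho * g * c_mat l) = 1\<^sub>m (2 * l)"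
    using assms C by (intro flip_mult_orthogonal mult_square_carrier rho_orthogonal c_mat_orthogonal)
      (auto simp: mem_SO_iff)
  ultimately show ?thesis using C by (simp add: mem_SO_iff mult_square_carrier)
qed

lemma rho_c_SO: "rho * c_mat l \<in> carrier (SO (2 * l))"
proof -
  have "(1\<^sub>m (2 * l) :: 'f mat) \<in> carrier (SO (2 * l))" by (simp add: mem_SO_iff)
  from rho_g_c_SO[OF this] show ?thesis using rho_carrier by simp
qed

lemma block_id_insert_middle:
  fixes g :: "'f mat"
  assumes g: "block_id (l - 1) (l + 1) (2 * l) g"
  shows "block_id (l - 1) (l + 2) (2 * l + 1) (insert_middle l g)"
  unfolding block_id_def
proof (intro conjI allI impI)
  fix i j assume i: "i < 2 * l + 1" and j: "j < 2 * l + 1"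
    and out: "\<not> (l - 1 \<le> i \<and> i < l + 2 \<and> l - 1 \<le> j \<and> j < l + 2)"
  define i' where "i' = (if i < l then i else i - 1)"
  define j' where "j' = (if j < l then j else j - 1)"
  show "insert_middle l g $$ (i, j) = (if i = j then 1 else 0)"
  proof (cases "i = l \<or> j = l")
    case True
    then show ?thesis using insert_middle_index[OF i j] by auto
  next
    case False
    have less: "i' < 2 * l" "j' < 2 * l" using i j False by (auto simp: i'_def j'_def)
    have out': "\<not> (l - 1 \<le> i' \<and> i' < l + 1 \<and> l - 1 \<le> j' \<and> j' < l + 1)" and eq: "i' = j' \<longleftrightarrow> i = j"
      using out False l by (auto simp: i'_def j'_def)
    show ?thesis
      using block_id_index[OF g less out'] insert_middle_index[OF i j, of g, folded i'_def j'_def] False eq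
      by auto
  qed
qed (rule insert_middle_carrier)

lemma block_unitri_insert_middle:
  fixes u :: "'f mat"
  assumes u: "block_unitri (l - 1) (l + 1) (2 * l) u"
  shows "block_unitri (l - 1) (l + 2) (2 * l + 1) (insert_middle l u)"
  unfolding block_unitri_def
proof (intro conjI allI impI)
  fix i j assume i: "i < 2 * l + 1" and j: "j < 2 * l + 1" and ij: "j \<le> i \<or> l - 1 \<le> i \<and> j < l + 2"
  define i' where "i' = (if i < l then i else i - 1)"
  define j' where "j' = (if j < l then j else j - 1)"
  show "insert_middle l u $$ (i, j) = (if i = j then 1 else 0)"
  proof (cases "i = l \<or> j = l")
    case True
    then show ?thesis using insert_middle_index[OF i j] by auto
  next
    case False
    have less: "i' < 2 * l" "j' < 2 * l" using i j False by (auto simp: i'_def j'_def)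
    have "j' \<le> i' \<or> l - 1 \<le> i' \<and> j' < l + 1" "i' = j' \<longleftrightarrow> i = j"
      using ij False l by (auto simp: i'_def j'_def)
    then show ?thesis
      using block_unitri_index[OF u less] insert_middle_index[OF i j, of u, folded i'_def j'_def] False by auto
  qed
qed (rule insert_middle_carrier)

lemma embed_U_SO_block_unitri:
  fixes u :: "'f mat"
  assumes u: "u \<in> U_SO (2 * l)"
  shows "block_unitri (l - 1) (l + 2) (2 * l + 1) (embed l u)"
  unfolding embed_eq[OF l two]
proof (rule block_unitri_conj)
  show "block_id (l - 1) (l + 2) (2 * l + 1) (embed_conj l :: 'f mat)"
    by (rule block_id_embed_conj[OF l])
  then show "block_id (l - 1) (l + 2) (2 * l + 1) (flip (embed_conj l :: 'f mat))"
    using l by (intro block_id_flip) auto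
qed (use l in \<open>auto intro!: flip_embed_conj_mult[OF l two, simplified] block_unitri_insert_middle[simplified] U_SO_block_unitri[OF u, simplified]\<close>)

text \<open>Column \<open>l - 1\<close> is the one where the conjugating matrix has its first isotropic column
  \<open>(1/4, 1/2, - 1/2)\<close>; the coefficients of the character \<open>\<psi>\<close> on the unipotent group are read off here.\<close>

lemma embed_index_top:
  fixes g :: "'f mat"
  assumes i: "i < l - 1" and j: "j < l"
  shows "embed l g $$ (i, j) =
    (if j = l - 1 then 1 / 4 * g $$ (i, l - 1) - 1 / 2 * g $$ (i, l) else g $$ (i, j))"
proof -
  define k where "k = l - 1"
  have lk: "l = Suc k" using l by (simp add: k_def)
  define n where "n = 2 * l + 1"
  define M where "M = (embed_conj l :: 'f mat)"
  define I where "I = insert_middle l g"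
  have id: "block_id (l - 1) (l + 2) n M" unfolding n_def M_def by (rule block_id_embed_conj[OF l])
  have idf: "block_id (l - 1) (l + 2) n (flip M)"
    using l by (intro block_id_flip[OF id]) (auto simp: n_def)
  have IC: "I \<in> carrier_mat n n" unfolding I_def n_def by (rule insert_middle_carrier)
  have FIC: "flip M * I \<in> carrier_mat n n" by (intro mult_square_carrier IC block_id_carrier[OF idf])
  have hi: "l + 2 \<le> n" using l by (simp add: n_def)
  have in': "i < n" and jn: "j < n" using i j by (auto simp: n_def)
  have FI: "(flip M * I) $$ (i, t) = I $$ (i, t)" if "t < n" for t
    unfolding block_id_mult_index[OF idf IC in' that hi] using i by auto
  have e: "embed l g $$ (i, j) = (if l - 1 \<le> j \<and> j < l + 2
      then \<Sum>t\<in>{l - 1..<l + 2}. (flip M * I) $$ (i, t) * M $$ (t, j) else (flip M * I) $$ (i, j))"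
    unfolding embed_eq[OF l two] M_def[symmetric] I_def[symmetric]
    by (rule mult_block_id_index[OF id FIC in' jn hi])
  have I: "I $$ (i, t) = (if t = l then 0 else g $$ (i, if t < l then t else t - 1))" if "t < n" for t
    using that in' i unfolding I_def n_def by (subst insert_middle_index) auto
  show ?thesis
  proof (cases "j = l - 1")
    case True
    have mid: "{l - 1..<l + 2} = {k, Suc k, Suc (Suc k)}" unfolding lk by auto
    have less: "k < n" "Suc k < n" "Suc (Suc k) < n" by (simp_all add: n_def lk)
    have Meq: "embed_conj (Suc k) = M" by (simp add: M_def lk)
    note me = embed_conj_middle[where 'a = 'f, of k, unfolded Meq]
    have "l - 1 \<le> j \<and> j < l + 2" "j = k" using True by (auto simp: k_def)
    then have "embed l g $$ (i, j) = (\<Sum>t\<in>{l - 1..<l + 2}. (flip M * I) $$ (i, t) * M $$ (t, k))"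
      unfolding e by (simp only: if_True simp_thms)
    also have "\<dots> = (\<Sum>t\<in>{l - 1..<l + 2}. I $$ (i, t) * M $$ (t, k))"
      using hi by (intro sum.cong refl arg_cong2[of _ _ _ _ "(*)"] FI) auto
    also have "\<dots> = (\<Sum>t\<in>{k, Suc k, Suc (Suc k)}. I $$ (i, t) * M $$ (t, k))"
      unfolding mid ..
    also have "\<dots> = g $$ (i, k) * (1 / 4) + g $$ (i, Suc k) * - (1 / 2)"
      using less by (simp add: I me lk)
    finally show ?thesis using True by (simp add: lk)
  next
    case False
    then have "j < l - 1" using j by auto
    then show ?thesis unfolding e using False j jn by (simp add: FI I del: index_mult_mat(1))
  qed
qed

text \<open>The embedding carries the unipotent group into the upper unitriangular subgroup of the odd orthogonal
  group. The
  character of the induced functions sees only the superdiagonal of \<open>a\<close>, and by the choice of the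
  conjugating matrix its last entry is exactly the combination in the character of the even group.\<close>

lemma embed_U_SO_decomposition:
  fixes u :: "'f mat"
  assumes u: "u \<in> U_SO (2 * l)" and \<psi>: "\<psi> 0 = (1 :: complex)"
  shows "\<exists>a\<in>U_GL l. \<exists>v\<in>siegel_unip l. embed l u = siegel_levi l a * v \<and> psi_GL \<psi> l a = psi_SO \<psi> l u"
proof -
  define y where "y = embed l u"
  have ySO: "y \<in> carrier (SO (2 * l + 1))" unfolding y_def by (intro embed_SO[OF l two] U_SO_SO[OF u])
  have yu: "block_unitri (l - 1) (l + 2) (2 * l + 1) y" unfolding y_def by (rule embed_U_SO_block_unitri[OF u])
  define a where "a = mat l l (\<lambda>(i, j). y $$ (i, j))"
  have aC: "a \<in> carrier_mat l l" by (simp add: a_def)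
  have a_tri: "upper_triangular a" "\<And>i. i < l \<Longrightarrow> a $$ (i, i) = 1"
    using block_unitri_index[OF yu] by (auto simp: a_def upper_triangular_def)
  then have "det a = 1" using aC by (intro det_unitriangular)
  then have aGL: "a \<in> carrier (GL l)" using aC by (simp add: mem_GL_iff)
  then have aU: "a \<in> U_GL l" using a_tri by (simp add: U_GL_def)
  obtain b where b: "b \<in> carrier (GL l)" "b * a = 1\<^sub>m l" using GL_inverse[OF aGL] by metis
  have "\<exists>v\<in>siegel_unip l. y = siegel_levi l a * v"
  proof (rule siegel_decomposition[OF _ _ _ _ aC _ b(2)])
    show "y $$ (i, j) = 0" if "i < 2 * l + 1" "j < 2 * l + 1" "siegel_block l j < siegel_block l i" for i j
    proof -
      have "j < i" using that(3) siegel_block_mono[of i j l] by linarith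
      then show ?thesis using block_unitri_index[OF yu that(1,2)] by simp
    qed
    show "y $$ (l, l) = 1" using block_unitri_index[OF yu, of l l] by simp
  next
    show "y \<in> carrier_mat (2 * l + 1) (2 * l + 1)" "flip y * y = 1\<^sub>m (2 * l + 1)"
      using ySO by (auto simp only: mem_SO_iff)
    show "b \<in> carrier_mat l l" using b by (simp add: mem_GL_iff)
    show "y $$ (i, j) = a $$ (i, j)" if "i < l" "j < l" for i j using that by (simp add: a_def)
  qed
  then obtain v where v: "v \<in> siegel_unip l" "y = siegel_levi l a * v" by blast
  have "psi_GL \<psi> l a = psi_SO \<psi> l u"
  proof (cases "l = 1")
    case True
    then show ?thesis by (simp add: psi_GL_def psi_SO_def \<psi>)
  next
    case False
    then obtain m where m: "l = Suc (Suc m)" using l by (metis One_nat_def Suc_le_D not0_implies_Suc)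
    have "(\<Sum>i<l - 1. a $$ (i, i + 1)) = (\<Sum>i<m. a $$ (i, i + 1)) + a $$ (m, m + 1)"
      by (simp add: m)
    also have "(\<Sum>i<m. a $$ (i, i + 1)) = (\<Sum>i<m. u $$ (i, i + 1))"
    proof (intro sum.cong refl)
      fix i assume "i \<in> {..<m}"
      then have "i < l - 1" "i + 1 < l" "i + 1 \<noteq> l - 1" "i < l" by (auto simp: m)
      then show "a $$ (i, i + 1) = u $$ (i, i + 1)"
        using embed_index_top[of i "i + 1" u] by (simp add: a_def y_def)
    qed
    also have "a $$ (m, m + 1) = 1 / 4 * u $$ (m, m + 1) - 1 / 2 * u $$ (m, m + 2)"
      using embed_index_top[of m "m + 1" u] by (simp add: a_def y_def m)
    finally have "(\<Sum>i<l - 1. a $$ (i, i + 1)) =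
        (\<Sum>i<m. u $$ (i, i + 1)) + 1 / 4 * u $$ (m, m + 1) - 1 / 2 * u $$ (m, m + 2)"
      by (simp only: add_diff_eq)
    then show ?thesis unfolding psi_GL_def psi_SO_def by (simp add: m)
  qed
  then show ?thesis using aU v unfolding y_def by blast
qed

text \<open>In the Witt basis formed by the columns of the conjugating matrix, both isotropic vectors are
  combinations of the fixed vector \<open>(1/4, - 1/2)\<close> of the reflection and the inserted basis vector, hence
  fixed; the second column is orthogonal to both and is negated.\<close>

lemma embed_rho: "embed l rho = levi_block l (- 1) (1\<^sub>m l) (1\<^sub>m l)"
proof -
  define k where "k = l - 1"
  have lk: "l = Suc k" using l by (simp add: k_def)
  define n where "n = 2 * l + 1"
  define M where "M = (embed_conj l :: 'f mat)"
  define I where "I = insert_middle l rho"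
  define S where "S = levi_block l (- 1) (1\<^sub>m l) (1\<^sub>m l :: 'f mat)"
  have Mid: "block_id k (k + 3) n M"
    using block_id_embed_conj[OF l, where 'a = 'f] by (simp add: M_def n_def lk numeral_3_eq_3)
  note MC = block_id_carrier[OF Mid]
  have IC: "I \<in> carrier_mat n n" unfolding I_def n_def by (rule insert_middle_carrier)
  have SC: "S \<in> carrier_mat n n" unfolding S_def n_def by (rule levi_block_carrier)
  have "block_id (l - 1) (l + 2) n I"
    unfolding I_def n_def whittaker_reflection_def by (intro block_id_insert_middle block_id_plane_swap l)
  then have Iid: "block_id k (k + 3) n I" by (simp add: lk numeral_3_eq_3)
  have Sid: "block_id (Suc k) (Suc (Suc k)) n S"
    unfolding block_id_def
  proof (intro conjI allI impI)
    fix i j assume i: "i < n" and j: "j < n"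
      and out: "\<not> (Suc k \<le> i \<and> i < Suc (Suc k) \<and> Suc k \<le> j \<and> j < Suc (Suc k))"
    have "i < l \<or> i = l \<or> l < i" "j < l \<or> j = l \<or> l < j" by linarith+
    then show "S $$ (i, j) = (if i = j then 1 else 0)"
      using i j out unfolding S_def n_def by (elim disjE) (auto simp: levi_block_index lk)
  qed (rule SC)
  have hi: "k + 3 \<le> n" and hi': "Suc (Suc k) \<le> n" by (simp_all add: n_def lk)
  have mid: "{k..<k + 3} = {k, Suc k, Suc (Suc k)}" and mid': "{Suc k..<Suc (Suc k)} = {Suc k}" by auto
  have less: "k < n" "Suc k < n" "Suc (Suc k) < n" by (simp_all add: n_def lk)
  have Ie: "I $$ (k, k) = 0" "I $$ (k, Suc k) = 0" "I $$ (k, Suc (Suc k)) = - 1 / 2"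
    "I $$ (Suc k, k) = 0" "I $$ (Suc k, Suc k) = 1" "I $$ (Suc k, Suc (Suc k)) = 0"
    "I $$ (Suc (Suc k), k) = - 2" "I $$ (Suc (Suc k), Suc k) = 0" "I $$ (Suc (Suc k), Suc (Suc k)) = 0"
    unfolding I_def whittaker_reflection_def
    by (simp_all add: insert_middle_index plane_swap_index lk)
  have Se: "S $$ (Suc k, Suc k) = - 1" by (simp add: S_def levi_block_index lk)
  have Meq: "embed_conj (Suc k) = M" by (simp add: M_def lk)
  note me = embed_conj_middle[where 'a = 'f, of k, unfolded Meq]
  have IM: "I * M = M * S"
  proof (rule eq_matI)
    fix i j assume "i < dim_row (M * S)" "j < dim_col (M * S)"
    then have i: "i < n" and j: "j < n" using MC SC by auto
    note eq = block_id_mult_index[OF Iid MC i j hi] mult_block_id_index[OF Sid MC i j hi']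
    have out: "M $$ (s, t) = 0" if "s < n" "t < n" "s \<in> {k..<k + 3} \<longleftrightarrow> t \<notin> {k..<k + 3}" for s t
      proof -
      have "\<not> (k \<le> s \<and> s < k + 3 \<and> k \<le> t \<and> t < k + 3)" "s \<noteq> t" using that(3) by auto
      then show ?thesis using block_id_index[OF Mid that(1,2)] by simp
    qed
    show "(I * M) $$ (i, j) = (M * S) $$ (i, j)"
    proof (cases "i \<in> {k..<k + 3}")
      case i': True
      show ?thesis
      proof (cases "j \<in> {k..<k + 3}")
        case True
        have "(4 :: 'f) = 2 * 2" by simp
        then have "(4 :: 'f) \<noteq> 0" using two by (metis mult_eq_0_iff)
        moreover have "i = k \<or> i = Suc k \<or> i = Suc (Suc k)" "j = k \<or> j = Suc k \<or> j = Suc (Suc k)"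
          using i' True by auto
        ultimately show ?thesis
          unfolding eq mid mid' using less two
          by (elim disjE) (simp_all add: Ie Se me field_simps)
      next
        case False
        have "M $$ (k, j) = 0" "M $$ (Suc k, j) = 0" "M $$ (Suc (Suc k), j) = 0" "M $$ (i, j) = 0"
          using False i' less i j by (intro out; auto)+
        then show ?thesis unfolding eq mid using False by auto
      qed
    next
      case False
      have "M $$ (i, Suc k) = 0" using False less i by (intro out) auto
      moreover have "j = Suc k" if "Suc k \<le> j \<and> j < Suc (Suc k)" using that by linarith
      ultimately show ?thesis unfolding eq mid' using False by (cases "j = Suc k") auto
    qed
  qed (use IC MC SC in auto)
  have FC: "flip M \<in> carrier_mat n n" using MC by simp
  have "embed l rho = flip M * I * M" unfolding embed_eq[OF l two] M_def I_def ..
  also have "\<dots> = flip M * (I * M)" by (rule assoc_mult_square[OF FC IC MC])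
  also have "\<dots> = flip M * M * S" unfolding IM by (rule assoc_mult_square[OF FC MC SC, symmetric])
  also have "flip M * M = 1\<^sub>m n" unfolding M_def n_def by (rule flip_embed_conj_mult[OF l two])
  also have "1\<^sub>m n * S = S" using SC by simp
  finally show ?thesis by (simp add: S_def)
qed

end

section \<open>Scalar elements of the Levi subgroup\<close>

lemma smult_one_mult:
  fixes c :: "'a::comm_ring_1"
  assumes "X \<in> carrier_mat n n"
  shows "(c \<cdot>\<^sub>m 1\<^sub>m n) * X = c \<cdot>\<^sub>m X" "X * (c \<cdot>\<^sub>m 1\<^sub>m n) = c \<cdot>\<^sub>m X"
  using assms by (auto simp: mult_smult_assoc_mat[of _ n n _ n] mult_smult_distrib[of _ n n _ n])

lemma smult_one_inverse:
  fixes c e :: "'a::comm_ring_1"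
  assumes "c * e = 1"
  shows "(c \<cdot>\<^sub>m 1\<^sub>m n) * (e \<cdot>\<^sub>m 1\<^sub>m n) = 1\<^sub>m n"
  using assms by (intro eq_matI) (auto simp: smult_one_mult[of _ n] mult.commute)

lemma flip_smult_one: "flip (c \<cdot>\<^sub>m 1\<^sub>m n) = c \<cdot>\<^sub>m (1\<^sub>m n :: 'a::comm_ring_1 mat)"
  by (intro eq_matI) (auto simp: flip_def)

context
  fixes l :: nat and c e :: "'f::field"
  assumes ce: "c * e = 1"
begin

lemma inverse_swapped: "e * c = 1"
  using ce by (simp add: mult.commute)

lemma scalar_levi_eq: "siegel_levi l (c \<cdot>\<^sub>m 1\<^sub>m l) = levi_block l 1 (c \<cdot>\<^sub>m 1\<^sub>m l) (e \<cdot>\<^sub>m 1\<^sub>m l)"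
  using siegel_levi_inverse(1)[of "c \<cdot>\<^sub>m 1\<^sub>m l" l "e \<cdot>\<^sub>m 1\<^sub>m l"]
  by (simp add: smult_one_inverse inverse_swapped flip_smult_one)

lemma scalar_levi_carrier: "siegel_levi l (c \<cdot>\<^sub>m 1\<^sub>m l) \<in> carrier_mat (2 * l + 1) (2 * l + 1)"
  unfolding scalar_levi_eq by (rule levi_block_carrier)

lemma scalar_levi_commute:
  assumes a: "a \<in> carrier (GL l)"
  shows "siegel_levi l (c \<cdot>\<^sub>m 1\<^sub>m l) * siegel_levi l a = siegel_levi l a * siegel_levi l (c \<cdot>\<^sub>m 1\<^sub>m l)"
  using a star_carrier[OF a] unfolding scalar_levi_eq siegel_levi_eq[OF a]
  by (simp add: levi_block_mult smult_one_mult[of _ l] mem_GL_iff)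

lemma scalar_levi_unip_conj:
  assumes "u \<in> siegel_unip l"
  shows "siegel_levi l (c \<cdot>\<^sub>m 1\<^sub>m l) * u * siegel_levi l (e \<cdot>\<^sub>m 1\<^sub>m l) \<in> siegel_unip l"
  using ce assms by (intro siegel_unip_conj) (auto simp: smult_one_inverse)

lemma scalar_levi_mult_inverse:
  "siegel_levi l (e \<cdot>\<^sub>m 1\<^sub>m l) * siegel_levi l (c \<cdot>\<^sub>m 1\<^sub>m l) = 1\<^sub>m (2 * l + 1)"
  using siegel_levi_inverse(3)[of "c \<cdot>\<^sub>m 1\<^sub>m l" l "e \<cdot>\<^sub>m 1\<^sub>m l"]
  by (simp add: smult_one_inverse inverse_swapped)

lemma scalar_levi_SO: "siegel_levi l (c \<cdot>\<^sub>m 1\<^sub>m l) \<in> carrier (SO (2 * l + 1))"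
proof -
  define L where "L = siegel_levi l (c \<cdot>\<^sub>m 1\<^sub>m l)"
  have LC: "L \<in> carrier_mat (2 * l + 1) (2 * l + 1)" unfolding L_def by (rule scalar_levi_carrier)
  have e: "L $$ (i, j) = (if i = j then if i < l then c else if i = l then 1 else e else 0)"
    if i: "i < 2 * l + 1" and j: "j < 2 * l + 1" for i j
  proof -
    have "i < l \<or> i = l \<or> l < i" "j < l \<or> j = l \<or> l < j" by linarith+
    then show ?thesis
      unfolding L_def scalar_levi_eq levi_block_index[OF i j] using i j by (elim disjE) auto
  qed
  have split: "{..<2 * l + 1} = insert l ({..<l} \<union> {l + 1..<2 * l + 1})" by auto
  have "upper_triangular L" using LC by (auto simp: upper_triangular_def e)
  then have "det L = prod_list (diag_mat L)" using LC by (rule det_upper_triangular)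
  also have "\<dots> = (\<Prod>i<2 * l + 1. L $$ (i, i))"
    using LC by (simp only: prod_list_diag_prod atLeast0LessThan carrier_matD(1))
  also have "\<dots> = (\<Prod>i<2 * l + 1. if i < l then c else if i = l then 1 else e)"
    by (intro prod.cong refl) (simp add: e)
  also have "\<dots> = (\<Prod>i\<in>{..<l} \<union> {l + 1..<2 * l + 1}. if i < l then c else if i = l then 1 else e)"
    unfolding split by (subst prod.insert) auto
  also have "\<dots> = (\<Prod>i<l. if i < l then c else if i = l then 1 else e) *
      (\<Prod>i=l + 1..<2 * l + 1. if i < l then c else if i = l then 1 else e)"
    by (rule prod.union_disjoint) auto
  also have "(\<Prod>i<l. if i < l then c else if i = l then 1 else e) = c ^ l" by simp
  also have "(\<Prod>i=l + 1..<2 * l + 1. if i < l then c else if i = l then 1 else e) = (\<Prod>i=l + 1..<2 * l + 1. e)"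
    by (intro prod.cong) auto
  also have "\<dots> = e ^ l" by simp
  also have "c ^ l * e ^ l = 1" using ce by (simp flip: power_mult_distrib)
  finally have det: "det L = 1" .
  have f: "flip L = siegel_levi l (e \<cdot>\<^sub>m 1\<^sub>m l)"
    using siegel_levi_inverse(5)[of "c \<cdot>\<^sub>m 1\<^sub>m l" l "e \<cdot>\<^sub>m 1\<^sub>m l"]
    by (simp add: L_def smult_one_inverse inverse_swapped)
  show ?thesis
    unfolding mem_SO_iff L_def[symmetric] f using LC det scalar_levi_mult_inverse by (simp only: L_def)
qed

end

lemma wll_mat_eq:
  assumes "(2 :: 'f::field) \<noteq> 0"
  shows "wll_mat l = siegel_levi l ((1 / 2 :: 'f) \<cdot>\<^sub>m 1\<^sub>m l)"
proof -
  have "star l ((1 / 2 :: 'f) \<cdot>\<^sub>m 1\<^sub>m l) = flip (2 \<cdot>\<^sub>m 1\<^sub>m l)"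
    using assms by (intro star_eq_flip) (auto simp: smult_one_inverse)
  then show ?thesis by (simp only: siegel_levi_def wll_mat_def flip_smult_one)
qed

abbreviation neg_levi :: "nat \<Rightarrow> 'f::field mat" where
  "neg_levi l \<equiv> siegel_levi l ((- 1) \<cdot>\<^sub>m 1\<^sub>m l)"

lemma neg_levi_square: "neg_levi l * neg_levi l = (1\<^sub>m (2 * l + 1) :: 'f::field mat)"
  by (rule scalar_levi_mult_inverse) simp

lemma w_mat_neg_levi: "w_mat l * neg_levi l = neg_levi l * (w_mat l :: 'f::field mat)"
  by (simp add: scalar_levi_eq[of "-1" "-1"] w_mat_levi_block)

text \<open>Together with \<open>embed_rho\<close> this identifies the embedded reflection with the negative of the central
  element \<open>- 1\<close> of the Levi subgroup. The sign matters: the embedded reflection itself has determinant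
  \<open>- 1\<close>, its negative lies in the special orthogonal group of odd size.\<close>

lemma levi_block_minus_one: "levi_block l (- 1) (1\<^sub>m l) (1\<^sub>m l) = (- 1) \<cdot>\<^sub>m (neg_levi l :: 'f::field mat)"
  unfolding scalar_levi_eq[of "-1" "-1", simplified]
  by (rule eq_matI) (auto simp: levi_block_def)

lemma siegel_unip_one: "1\<^sub>m (2 * l + 1) \<in> siegel_unip l"
  by (auto simp: mem_siegel_unip_iff block_unipotent_def)

lemma siegel_unip_carrier: "u \<in> siegel_unip l \<Longrightarrow> u \<in> carrier_mat (2 * l + 1) (2 * l + 1)"
  by (simp add: mem_siegel_unip_iff block_unipotent_def)

lemma siegel_unip_flip:
  assumes u: "u \<in> siegel_unip l"
  shows "flip u \<in> siegel_unip l"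
proof -
  have uC: "u \<in> carrier_mat (2 * l + 1) (2 * l + 1)" by (rule siegel_unip_carrier[OF u])
  have "flip u $$ (i, j) = (if i = j then 1 else 0)"
    if i: "i < 2 * l + 1" and j: "j < 2 * l + 1" and le: "siegel_block l j \<le> siegel_block l i" for i j
  proof -
    have ij': "2 * l - j < 2 * l + 1" "2 * l - i < 2 * l + 1" by auto
    have "siegel_block l (2 * l - i) \<le> siegel_block l (2 * l - j)"
      using le i j by (auto simp: siegel_block_def split: if_splits)
    then have "u $$ (2 * l - j, 2 * l - i) = (if 2 * l - j = 2 * l - i then 1 else 0)"
      using u ij' unfolding mem_siegel_unip_iff block_unipotent_def by blast
    moreover have "2 * l - j = 2 * l - i \<longleftrightarrow> i = j" using i j by auto
    ultimately show ?thesis using flip_index[OF uC i j] by simp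
  qed
  moreover have "flip (flip u) * flip u = 1\<^sub>m (2 * l + 1)"
    using u uC flip_right_inverse[OF uC] by (simp add: mem_siegel_unip_iff)
  ultimately show ?thesis
    using flip_carrier[OF uC] unfolding mem_siegel_unip_iff block_unipotent_def by blast
qed

section \<open>The dual of a unitriangular matrix\<close>

text \<open>Each row of \<open>a * b = 1\<close> expresses an entry of \<open>b\<close> through entries in lower rows, so the claim follows by
  induction from the bottom row.\<close>

lemma U_GL_inverse:
  fixes a b :: "'f::field mat"
  assumes a: "a \<in> U_GL l" and b: "b \<in> carrier_mat l l" and ab: "a * b = 1\<^sub>m l"
  shows "b \<in> U_GL l" and "\<And>i. i + 1 < l \<Longrightarrow> b $$ (i, i + 1) = - a $$ (i, i + 1)"
proof -
  have aC: "a \<in> carrier_mat l l" and a1: "\<And>i. i < l \<Longrightarrow> a $$ (i, i) = 1"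
    and a0: "\<And>i j. i < l \<Longrightarrow> j < i \<Longrightarrow> a $$ (i, j) = 0"
    using a by (auto simp: U_GL_def mem_GL_iff upper_triangular_def)
  have rec: "(if i = j then 1 else 0) = b $$ (i, j) + (\<Sum>t\<in>{i<..<l}. a $$ (i, t) * b $$ (t, j))"
    if i: "i < l" and j: "j < l" for i j
  proof -
    have "(if i = j then 1 else 0) = (\<Sum>t<l. a $$ (i, t) * b $$ (t, j))"
      using index_mult_sum[OF aC b i j] i j by (simp add: ab)
    also have "\<dots> = (\<Sum>t\<in>insert i {i<..<l}. a $$ (i, t) * b $$ (t, j))"
      using i by (intro sum.mono_neutral_right) (auto intro!: a0 mult_zero_left)
    finally show ?thesis using i by (simp add: a1)
  qed
  have tri: "b $$ (i, j) = (if i = j then 1 else 0)" if "j \<le> i" "i < l" for i j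
    using that
  proof (induction "l - i" arbitrary: i rule: less_induct)
    case less
    have "(\<Sum>t\<in>{i<..<l}. a $$ (i, t) * b $$ (t, j)) = 0"
      using less by (intro sum.neutral) auto
    then show ?case using rec[of i j] less by simp
  qed
  have "det b = 1" using b tri by (intro det_unitriangular) (auto simp: upper_triangular_def)
  then show "b \<in> U_GL l"
    using b tri by (auto simp: U_GL_def mem_GL_iff upper_triangular_def)
  fix i assume i: "i + 1 < l"
  have "(\<Sum>t\<in>{i<..<l}. a $$ (i, t) * b $$ (t, i + 1)) = (\<Sum>t\<in>{i + 1}. a $$ (i, t) * b $$ (t, i + 1))"
    using i by (intro sum.mono_neutral_right) (auto simp: tri)
  then have "0 = b $$ (i, i + 1) + a $$ (i, i + 1)" using rec[of i "i + 1"] i by (simp add: tri)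
  then show "b $$ (i, i + 1) = - a $$ (i, i + 1)" by (simp add: eq_neg_iff_add_eq_0)
qed

lemma d_mat_carrier [simp]: "d_mat l \<in> carrier_mat l l"
  by (simp add: d_mat_def)

lemma d_mat_mult_index:
  fixes X :: "'f::field mat"
  assumes X: "X \<in> carrier_mat l l" and i: "i < l" and j: "j < l"
  shows "(d_mat l * X) $$ (i, j) = (-1) ^ (i + 1) * X $$ (i, j)"
    and "(X * d_mat l) $$ (i, j) = (-1) ^ (j + 1) * X $$ (i, j)"
proof -
  have "(d_mat l * X) $$ (i, j) = (\<Sum>t<l. d_mat l $$ (i, t) * X $$ (t, j))"
    by (rule index_mult_sum[OF d_mat_carrier X i j])
  also have "\<dots> = (\<Sum>t<l. if i = t then (-1) ^ (i + 1) * X $$ (t, j) else 0)"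
    using i by (intro sum.cong) (auto simp: d_mat_def)
  finally show "(d_mat l * X) $$ (i, j) = (-1) ^ (i + 1) * X $$ (i, j)" using i by simp
  have "(X * d_mat l) $$ (i, j) = (\<Sum>t<l. X $$ (i, t) * d_mat l $$ (t, j))"
    by (rule index_mult_sum[OF X d_mat_carrier i j])
  also have "\<dots> = (\<Sum>t<l. if j = t then (-1) ^ (j + 1) * X $$ (i, t) else 0)"
    using j by (intro sum.cong) (auto simp: d_mat_def)
  finally show "(X * d_mat l) $$ (i, j) = (-1) ^ (j + 1) * X $$ (i, j)" using j by simp
qed

lemma d_mat_square: "d_mat l * d_mat l = (1\<^sub>m l :: 'f::field mat)"
proof (rule eq_matI)
  fix i j assume "i < dim_row (1\<^sub>m l :: 'f mat)" "j < dim_col (1\<^sub>m l :: 'f mat)"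
  then have i: "i < l" and j: "j < l" by auto
  show "(d_mat l * d_mat l) $$ (i, j) = (1\<^sub>m l :: 'f mat) $$ (i, j)"
    unfolding d_mat_mult_index(1)[OF d_mat_carrier i j] using i j
    by (auto simp: d_mat_def simp flip: power_mult_distrib power_add)
qed (auto simp: d_mat_def)

lemma d_mat_GL: "d_mat l \<in> carrier (GL l)"
  by (rule mem_GL_of_inverse(1)[OF d_mat_carrier d_mat_carrier d_mat_square])

text \<open>Passing to \<open>a\<^sup>*\<close> reverses the superdiagonal and changes its sign; conjugation by the alternating signs
  of \<open>d\<^sub>l\<close> changes the sign back, so the character is the same.\<close>

lemma dual_U_GL:
  fixes a b :: "'f::field mat"
  assumes a: "a \<in> U_GL l" and b: "b \<in> carrier_mat l l" and ab: "a * b = 1\<^sub>m l"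
  shows "d_mat l * flip b * d_mat l \<in> U_GL l"
    and "psi_GL \<chi> l (d_mat l * flip b * d_mat l) = psi_GL \<chi> l a"
proof -
  define X where "X = d_mat l * flip b * d_mat l"
  have bU: "b \<in> U_GL l" by (rule U_GL_inverse(1)[OF a b ab])
  have dfC: "d_mat l * flip b \<in> carrier_mat l l" using b by (intro mult_square_carrier) auto
  have XC: "X \<in> carrier_mat l l" unfolding X_def by (rule mult_square_carrier[OF dfC d_mat_carrier])
  have e: "X $$ (i, j) = (-1) ^ (i + j) * b $$ (l - 1 - j, l - 1 - i)" if "i < l" "j < l" for i j
    unfolding X_def d_mat_mult_index(2)[OF dfC that] d_mat_mult_index(1)[OF flip_carrier[OF b] that]
      flip_index[OF b that] by (simp add: power_add)
  have tri: "X $$ (i, j) = (if i = j then 1 else 0)" if "j \<le> i" "i < l" for i j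
  proof (cases "i = j")
    case True
    then show ?thesis using that e[of i i] bU by (auto simp: U_GL_def)
  next
    case False
    then have "l - 1 - i < l - 1 - j" "l - 1 - j < l" using that by auto
    then show ?thesis using that False e[of i j] bU by (auto simp: U_GL_def mem_GL_iff upper_triangular_def)
  qed
  have "det X = 1" using XC tri by (intro det_unitriangular) (auto simp: upper_triangular_def)
  then show "d_mat l * flip b * d_mat l \<in> U_GL l"
    using XC tri unfolding X_def[symmetric] by (auto simp: U_GL_def mem_GL_iff upper_triangular_def)
  have "(\<Sum>i<l - 1. X $$ (i, i + 1)) = (\<Sum>i<l - 1. a $$ (l - 1 - Suc i, l - 1 - Suc i + 1))"
  proof (intro sum.cong refl)
    fix i assume "i \<in> {..<l - 1}"
    then have i: "i < l" "i + 1 < l" and i': "l - 1 - Suc i + 1 < l" "l - 1 - (i + 1) = l - 1 - Suc i"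
      "l - 1 - i = l - 1 - Suc i + 1" by auto
    have "X $$ (i, i + 1) = - b $$ (l - 1 - Suc i, l - 1 - Suc i + 1)"
      unfolding e[OF i] i'(2,3) by (simp flip: mult_2)
    then show "X $$ (i, i + 1) = a $$ (l - 1 - Suc i, l - 1 - Suc i + 1)"
      using U_GL_inverse(2)[OF a b ab i'(1)] by simp
  qed
  also have "\<dots> = (\<Sum>i<l - 1. a $$ (i, i + 1))"
    by (rule sum.nat_diff_reindex)
  finally show "psi_GL \<chi> l (d_mat l * flip b * d_mat l) = psi_GL \<chi> l a"
    by (simp add: psi_GL_def X_def)
qed

section \<open>Sums over cosets\<close>

lemma (in group) sum_rcosets_representatives:
  fixes F :: "'a \<Rightarrow> 'c::comm_semiring_1"
  assumes H: "subgroup H G" and fin: "finite (carrier G)"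
    and F: "\<And>h g. h \<in> H \<Longrightarrow> g \<in> carrier G \<Longrightarrow> F (h \<otimes> g) = F g"
  shows "of_nat (card H) * (\<Sum>C\<in>rcosets H. F (SOME g. g \<in> C)) = (\<Sum>g\<in>carrier G. F g)"
proof -
  have HG: "H \<subseteq> carrier G" by (rule subgroup.subset[OF H])
  have "(\<Sum>g\<in>carrier G. F g) = (\<Sum>C\<in>rcosets H. \<Sum>g\<in>C. F g)"
    unfolding rcosets_part_G[OF H, symmetric]
    using rcos_disjoint[OF H] cosets_finite[OF _ HG fin]
    by (subst sum.Union_disjoint) (auto simp: pairwise_def disjnt_def)
  also have "\<dots> = (\<Sum>C\<in>rcosets H. of_nat (card H) * F (SOME g. g \<in> C))"
  proof (intro sum.cong refl)
    fix C assume C: "C \<in> rcosets H"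
    then obtain x where x: "x \<in> carrier G" "C = H #> x" by (auto simp: RCOSETS_def)
    have const: "F g = F x" if "g \<in> C" for g using that x F by (auto simp: r_coset_def)
    have "x \<in> C" using x rcos_self[OF x(1) H] by simp
    then have "(SOME g. g \<in> C) \<in> C" by (rule someI)
    then have "(\<Sum>g\<in>C. F g) = (\<Sum>g\<in>C. F (SOME g. g \<in> C))"
      by (intro sum.cong refl) (simp add: const)
    then show "(\<Sum>g\<in>C. F g) = of_nat (card H) * F (SOME g. g \<in> C)"
      by (simp add: card_rcosets_equal[OF C HG])
  qed
  finally show ?thesis by (simp add: sum_distrib_left)
qed

section \<open>The base field and its character\<close>

text \<open>Translation by 1 permutes the field, so the cardinality is 0 in it; if 2 were 0, an odd cardinality
  would be 1.\<close>

lemma two_nonzero_of_odd_card: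
  assumes "odd CARD('f::{field, finite})"
  shows "(2 :: 'f) \<noteq> 0"
proof
  assume two: "(2 :: 'f) = 0"
  have "(\<Sum>x\<in>UNIV. x) = (\<Sum>x\<in>UNIV. x + 1 :: 'f)"
    by (rule sum.reindex_bij_witness[of _ "\<lambda>x. x + 1" "\<lambda>x. x - 1"]) auto
  \<comment> \<open>Cancel the sum over the field; what remains is the sum of the constant 1.\<close>
  then have "of_nat CARD('f) = (0 :: 'f)" by (simp add: sum.distrib)
  moreover obtain m where "CARD('f) = 2 * m + 1" using assms by (elim oddE)
  ultimately show False using two by simp
qed

lemma additive_character_nonzero:
  assumes "additive_character \<psi>"
  shows "\<psi> x \<noteq> 0"
proof -
  have "\<psi> x * \<psi> (- x) = \<psi> (x + - x)" using assms unfolding additive_character_def by metis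
  then have "\<psi> x * \<psi> (- x) = 1" using assms by (simp add: additive_character_def)
  then show ?thesis by auto
qed

section \<open>The induced space and the intertwining operator\<close>

lemma module_two_argument_functions: "Modules.module (\<lambda>(z :: complex) F g a. z * F g a)"
  by unfold_locales (auto simp: fun_eq_iff algebra_simps)

text \<open>Linear induction over the span that defines the induced space.\<close>

lemma induced_whittaker_closed:
  fixes T :: "('f::field mat \<Rightarrow> 'f mat \<Rightarrow> complex) set"
  assumes f: "f \<in> induced_whittaker \<chi> l s \<tau>"
    and gen: "\<And>\<Lambda> \<xi>. \<Lambda> \<in> Hom_char s \<tau> (U_GL l) (psi_GL \<chi> l) \<Longrightarrow> \<Lambda> \<noteq> (\<lambda>_. 0) \<Longrightarrow>
      \<xi> \<in> induced_space l \<tau> \<Longrightarrow> (\<lambda>g a. \<Lambda> (\<tau> a (\<xi> g))) \<in> T"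
    and zero: "(\<lambda>g a. 0) \<in> T"
    and add: "\<And>F G. F \<in> T \<Longrightarrow> G \<in> T \<Longrightarrow> (\<lambda>g a. F g a + G g a) \<in> T"
    and scale: "\<And>z F. F \<in> T \<Longrightarrow> (\<lambda>g a. z * F g a) \<in> T"
  shows "f \<in> T"
proof -
  interpret Modules.module "\<lambda>(z :: complex) (F :: 'f mat \<Rightarrow> 'f mat \<Rightarrow> complex) g a. z * F g a"
    by (rule module_two_argument_functions)
  have "subspace T"
  proof (rule subspaceI)
    show "0 \<in> T" using zero by (simp add: zero_fun_def)
    show "F + G \<in> T" if "F \<in> T" "G \<in> T" for F G using add[OF that] by (simp add: plus_fun_def)
  qed (rule scale)
  moreover have "{\<lambda>g a. \<Lambda> (\<tau> a (\<xi> g)) | \<Lambda> \<xi>. \<Lambda> \<in> Hom_char s \<tau> (U_GL l) (psi_GL \<chi> l) \<and>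
      \<Lambda> \<noteq> (\<lambda>_. 0) \<and> \<xi> \<in> induced_space l \<tau>} \<subseteq> T"
    using gen by blast
  ultimately show ?thesis
    using f span_minimal unfolding induced_whittaker_def by blast
qed

lemma induced_whittaker_levi:
  assumes \<tau>: "representation s (GL l) \<tau>" and f: "f \<in> induced_whittaker \<chi> l s \<tau>"
    and b: "b \<in> carrier (GL l)" and a: "a \<in> carrier (GL l)" and v: "v \<in> siegel_unip l"
    and g: "g \<in> carrier (SO (2 * l + 1))"
  shows "f (siegel_levi l b * v * g) a = f g (a * b)"
proof -
  have "f \<in> {f. f (siegel_levi l b * v * g) a = f g (a * b)}"
  proof (rule induced_whittaker_closed[OF f])
    fix \<Lambda> \<xi> assume "\<xi> \<in> induced_space l \<tau>"
    then have "\<xi> (siegel_levi l b * v * g) = \<tau> b (\<xi> g)" using b v g by (simp add: induced_space_def)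
    moreover have "\<tau> (a * b) = \<tau> a \<circ> \<tau> b" using \<tau> a b by (simp add: representation_def)
    ultimately show "(\<lambda>g a. \<Lambda> (\<tau> a (\<xi> g))) \<in> {f. f (siegel_levi l b * v * g) a = f g (a * b)}" by simp
  qed auto
  then show ?thesis by simp
qed

lemma induced_whittaker_unip:
  assumes \<tau>: "representation s (GL l) \<tau>" and f: "f \<in> induced_whittaker \<chi> l s \<tau>"
    and u: "u \<in> U_GL l" and a: "a \<in> carrier (GL l)"
  shows "f g (u * a) = psi_GL \<chi> l u * f g a"
proof -
  have uGL: "u \<in> carrier (GL l)" using u by (simp add: U_GL_def)
  have "f \<in> {f. f g (u * a) = psi_GL \<chi> l u * f g a}"
  proof (rule induced_whittaker_closed[OF f])
    fix \<Lambda> \<xi> assume "\<Lambda> \<in> Hom_char s \<tau> (U_GL l) (psi_GL \<chi> l)"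
    then have "\<Lambda> (\<tau> u (\<tau> a (\<xi> g))) = psi_GL \<chi> l u * \<Lambda> (\<tau> a (\<xi> g))" using u by (simp add: Hom_char_def)
    moreover have "\<tau> (u * a) = \<tau> u \<circ> \<tau> a" using \<tau> a uGL by (simp add: representation_def)
    ultimately show "(\<lambda>g a. \<Lambda> (\<tau> a (\<xi> g))) \<in> {f. f g (u * a) = psi_GL \<chi> l u * f g a}" by simp
  qed (auto simp: algebra_simps)
  then show ?thesis by simp
qed

text \<open>The transformation law under the upper unitriangular subgroup of the odd orthogonal group. It is shared by the
  functions of the induced space and their images under the intertwining operator.\<close>

definition siegel_equivariant ::
  "('f::field \<Rightarrow> complex) \<Rightarrow> nat \<Rightarrow> ('f mat \<Rightarrow> 'f mat \<Rightarrow> complex) \<Rightarrow> bool" where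
  "siegel_equivariant \<chi> l f \<longleftrightarrow>
     (\<forall>a\<in>U_GL l. \<forall>v\<in>siegel_unip l. \<forall>g\<in>carrier (SO (2 * l + 1)).
        f (siegel_levi l a * v * g) (1\<^sub>m l) = psi_GL \<chi> l a * f g (1\<^sub>m l))"

lemma one_GL [simp]: "1\<^sub>m l \<in> carrier (GL l)"
  by (simp add: mem_GL_iff)

lemma siegel_equivariant_induced:
  fixes f :: "'f::field mat \<Rightarrow> 'f mat \<Rightarrow> complex"
  assumes \<tau>: "representation s (GL l) \<tau>" and f: "f \<in> induced_whittaker \<chi> l s \<tau>"
  shows "siegel_equivariant \<chi> l f"
  unfolding siegel_equivariant_def
proof (intro ballI)
  fix a v g :: "'f mat" assume a: "a \<in> U_GL l" and v: "v \<in> siegel_unip l" and g: "g \<in> carrier (SO (2 * l + 1))"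
  have aGL: "a \<in> carrier (GL l)" using a by (simp add: U_GL_def)
  then have aC: "a \<in> carrier_mat l l" by (simp add: mem_GL_iff)
  have "f (siegel_levi l a * v * g) (1\<^sub>m l) = f g (1\<^sub>m l * a)"
    by (rule induced_whittaker_levi[OF \<tau> f aGL one_GL v g])
  also have "1\<^sub>m l * a = a * 1\<^sub>m l" using aC by simp
  also have "f g (a * 1\<^sub>m l) = psi_GL \<chi> l a * f g (1\<^sub>m l)"
    by (rule induced_whittaker_unip[OF \<tau> f a one_GL])
  finally show "f (siegel_levi l a * v * g) (1\<^sub>m l) = psi_GL \<chi> l a * f g (1\<^sub>m l)" .
qed

lemma intertwining_at_one:
  fixes h :: "'f::field mat"
  shows "intertwining l f h (1\<^sub>m l) = (\<Sum>u\<in>siegel_unip l. f (w_mat l * u * h) (d_mat l))"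
proof -
  have "star l (1\<^sub>m l) = (1\<^sub>m l :: 'f mat)" using star_eq_flip[of "1\<^sub>m l" l "1\<^sub>m l"] by simp
  then have "d_mat l * star l (1\<^sub>m l) = (d_mat l :: 'f mat)" by (simp add: right_mult_one_mat[OF d_mat_carrier])
  then show ?thesis by (simp add: intertwining_def)
qed

text \<open>Move the unipotent element past the sum: the unipotent radical absorbs the factor \<open>v\<close> by a change of
  variable, the Weyl element turns the Levi part \<open>a\<close> into \<open>a\<^sup>*\<close>, and after conjugation by \<open>d\<^sub>l\<close> this
  contributes the same value of the character.\<close>

lemma siegel_equivariant_intertwining:
  fixes f :: "'f::field mat \<Rightarrow> 'f mat \<Rightarrow> complex"
  assumes \<tau>: "representation s (GL l) \<tau>" and f: "f \<in> induced_whittaker \<chi> l s \<tau>"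
  shows "siegel_equivariant \<chi> l (intertwining l f)"
  unfolding siegel_equivariant_def
proof (intro ballI)
  fix a v g :: "'f mat" assume a: "a \<in> U_GL l" and v: "v \<in> siegel_unip l" and g: "g \<in> carrier (SO (2 * l + 1))"
  define n where "n = 2 * l + 1"
  have aGL: "a \<in> carrier (GL l)" using a by (simp add: U_GL_def)
  obtain b where b: "b \<in> carrier (GL l)" "b * a = 1\<^sub>m l" "a * b = 1\<^sub>m l" by (rule GL_inverse[OF aGL])
  have C: "a \<in> carrier_mat l l" "b \<in> carrier_mat l l" using aGL b by (auto simp: mem_GL_iff)
  have fC: "flip a \<in> carrier_mat l l" "flip b \<in> carrier_mat l l" using C by auto
  have fab: "flip a * flip b = 1\<^sub>m l" using flip_mult[OF C(2,1)] b by simp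
  note L = siegel_levi_inverse[OF C b(2)]
  note L' = siegel_levi_inverse[OF fC(2) fC(1) fab]
  define A B A' where "A = siegel_levi l a" and "B = siegel_levi l b" and "A' = siegel_levi l (flip b)"
  define w where "w = (w_mat l :: 'f mat)"
  have MC: "A \<in> carrier_mat n n" "B \<in> carrier_mat n n" "A' \<in> carrier_mat n n" "w \<in> carrier_mat n n"
    "v \<in> carrier_mat n n" "g \<in> carrier_mat n n"
    unfolding A_def B_def A'_def w_def n_def
    using L(6,7) L'(6) siegel_unip_carrier[OF v] SO_carrier[OF g] by (auto simp only: w_mat_carrier)
  have AB: "A * B = 1\<^sub>m n" and BA: "B * A = 1\<^sub>m n" using L by (auto simp: A_def B_def n_def)
  have wA: "w * A = A' * w"
    unfolding w_def A_def A'_def L(1) L'(1) using C by (simp add: w_mat_levi_block)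
  have fbGL: "flip b \<in> carrier (GL l)" using mem_GL_of_inverse[OF fC(2) fC(1) fab] by simp
  let ?V = "siegel_unip l :: 'f mat set"
  have shift: "f (w * u * (A * v * g)) (d_mat l) = psi_GL \<chi> l a * f (w * (B * u * A * v) * g) (d_mat l)"
    if u: "u \<in> ?V" for u
  proof -
    have uC: "u \<in> carrier_mat n n" using siegel_unip_carrier[OF u] by (simp add: n_def)
    have u': "B * u * A * v \<in> ?V"
      unfolding A_def B_def by (intro siegel_unip_mult siegel_unip_conj[OF C b(2) u] v)
    have SO: "w * (B * u * A * v) * g \<in> carrier (SO (2 * l + 1))"
      unfolding w_def by (intro SO_mult w_mat_SO siegel_unip_SO[OF u'] g)
    \<comment> \<open>Insert \<open>A * B = 1\<close> to collect the new unipotent variable \<open>B * u * A * v\<close>.\<close>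
    have "w * u * (A * v * g) = w * (A * B) * u * (A * v * g)"
      using MC by (simp add: AB)
    also have "\<dots> = w * A * (B * u * A * v * g)"
      using MC uC by (simp add: assoc_mult_square[of _ n] mult_square_carrier[of _ n])
    also have "\<dots> = A' * 1\<^sub>m n * (w * (B * u * A * v) * g)"
      unfolding wA using MC uC by (simp add: assoc_mult_square[of _ n] mult_square_carrier[of _ n])
    finally have "f (w * u * (A * v * g)) (d_mat l) = f (w * (B * u * A * v) * g) (d_mat l * flip b)"
      using induced_whittaker_levi[OF \<tau> f fbGL d_mat_GL siegel_unip_one SO] by (simp add: A'_def n_def)
    also have "d_mat l * flip b = d_mat l * flip b * d_mat l * d_mat l"
      using fC by (simp add: assoc_mult_square[of _ l] mult_square_carrier[of _ l] d_mat_square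
        right_mult_one_mat[OF fC(2)])
    also have "f (w * (B * u * A * v) * g) (d_mat l * flip b * d_mat l * d_mat l) =
        psi_GL \<chi> l (d_mat l * flip b * d_mat l) * f (w * (B * u * A * v) * g) (d_mat l)"
      by (rule induced_whittaker_unip[OF \<tau> f dual_U_GL(1)[OF a C(2) b(3)] d_mat_GL])
    finally show ?thesis by (simp add: dual_U_GL(2)[OF a C(2) b(3)])
  qed
  have vf: "v * flip v = 1\<^sub>m n" "flip v * v = 1\<^sub>m n"
    using v flip_right_inverse[of v n] MC by (auto simp: mem_siegel_unip_iff n_def)
  have fvC: "flip v \<in> carrier_mat n n" using MC by simp
  have "intertwining l f (A * v * g) (1\<^sub>m l) =
      (\<Sum>u\<in>?V. psi_GL \<chi> l a * f (w * (B * u * A * v) * g) (d_mat l))"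
    unfolding intertwining_at_one by (intro sum.cong refl) (simp add: shift flip: w_def)
  also have "\<dots> = (\<Sum>u\<in>?V. psi_GL \<chi> l a * f (w * u * g) (d_mat l))"
  proof (rule sum.reindex_bij_witness[where i = "\<lambda>u. A * (u * flip v) * B" and j = "\<lambda>u. B * u * A * v"])
    fix u assume u: "u \<in> ?V"
    have uC: "u \<in> carrier_mat n n" using siegel_unip_carrier[OF u] by (simp add: n_def)
    show "B * u * A * v \<in> ?V"
      unfolding A_def B_def by (intro siegel_unip_mult siegel_unip_conj[OF C b(2) u] v)
    show "A * (u * flip v) * B \<in> ?V"
      unfolding A_def B_def
      by (intro siegel_unip_conj[OF C(2,1) b(3)] siegel_unip_mult u siegel_unip_flip v)
    have "A * (B * u * A * v * flip v) * B = (A * B) * u * (A * (v * flip v) * B)"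
      using MC uC fvC by (simp only: assoc_mult_square[of _ n] mult_square_carrier[of _ n])
    then show "A * (B * u * A * v * flip v) * B = u"
      using MC uC by (simp add: vf AB)
    have "B * (A * (u * flip v) * B) * A * v = (B * A) * u * (flip v * ((B * A) * v))"
      using MC uC fvC by (simp only: assoc_mult_square[of _ n] mult_square_carrier[of _ n])
    then show "B * (A * (u * flip v) * B) * A * v = u"
      using MC uC by (simp add: vf BA)
  qed simp
  also have "\<dots> = psi_GL \<chi> l a * intertwining l f g (1\<^sub>m l)"
    by (simp add: intertwining_at_one sum_distrib_left w_def)
  finally show "intertwining l f (siegel_levi l a * v * g) (1\<^sub>m l) = psi_GL \<chi> l a * intertwining l f g (1\<^sub>m l)"
    by (simp add: A_def)
qed

section \<open>A symmetry of the induced space\<close>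

context
  fixes l :: nat
  assumes l: "l \<ge> 1" and two: "(2 :: 'f::{field, finite}) \<noteq> 0"
begin

text \<open>For \<open>r = \<rho> * c\<close> this is \<open>z * E r\<close>, where \<open>E\<close> is the embedding and \<open>z\<close> the Levi element of \<open>- 1\<close>. Since
  \<open>E \<rho> = - z\<close>, it equals \<open>- E c\<close>, but the product form shows that it lies in the special orthogonal group.\<close>

definition twist_elt :: "'f mat" where
  "twist_elt = neg_levi l * embed l (whittaker_reflection l * c_mat l)"

text \<open>The effect on induced functions of the substitution \<open>g \<mapsto> \<rho> * g * c\<close>. The value type is left open so that
  the same operation applies to the vector-valued functions and to the two-argument ones.\<close>

definition twist :: "('f mat \<Rightarrow> 'a) \<Rightarrow> 'f mat \<Rightarrow> 'a" where
  "twist f g = f (neg_levi l * g * twist_elt)"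

lemma neg_levi_SO: "(neg_levi l :: 'f mat) \<in> carrier (SO (2 * l + 1))"
  by (rule scalar_levi_SO[of "-1" "-1"]) simp

lemma twist_elt_SO: "twist_elt \<in> carrier (SO (2 * l + 1))"
  unfolding twist_elt_def by (intro SO_mult neg_levi_SO embed_SO[OF l two] rho_c_SO[OF l two])

lemma neg_levi_unip_conj:
  "(u :: 'f mat) \<in> siegel_unip l \<Longrightarrow> neg_levi l * u * neg_levi l \<in> siegel_unip l"
  by (rule scalar_levi_unip_conj[of "-1" "-1"]) simp_all

text \<open>Right translations preserve the induced space, and so does left translation by \<open>z\<close>, which is central in
  the Levi subgroup and normalises the unipotent radical.\<close>

lemma twist_induced_space:
  assumes \<xi>: "\<xi> \<in> induced_space l \<tau>"
  shows "twist \<xi> \<in> induced_space l \<tau>"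
  unfolding induced_space_def mem_Collect_eq
proof (intro ballI)
  fix a u g :: "'f mat"
  assume a: "a \<in> carrier (GL l)" and u: "u \<in> siegel_unip l" and g: "g \<in> carrier (SO (2 * l + 1))"
  define n where "n = 2 * l + 1"
  define z where "z = (neg_levi l :: 'f mat)"
  define A where "A = siegel_levi l a"
  have AC: "A \<in> carrier_mat n n" unfolding A_def n_def siegel_levi_eq[OF a] by (rule levi_block_carrier)
  have C: "z \<in> carrier_mat n n" "u \<in> carrier_mat n n" "g \<in> carrier_mat n n" "twist_elt \<in> carrier_mat n n"
    unfolding z_def n_def
    by (intro SO_carrier neg_levi_SO siegel_unip_SO[OF u] g twist_elt_SO)+
  have zz: "z * z = 1\<^sub>m n" unfolding z_def n_def by (rule neg_levi_square)
  have zA: "z * A = A * z" unfolding z_def A_def by (rule scalar_levi_commute[of "-1" "-1"]) (use a in simp_all)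
  \<comment> \<open>Move \<open>z\<close> past \<open>A\<close> and insert \<open>z * z = 1\<close> after \<open>u\<close>.\<close>
  have "z * (A * u * g) * twist_elt = z * A * (u * (g * twist_elt))"
    using C AC by (simp add: assoc_mult_square[of _ n] mult_square_carrier[of _ n])
  also have "\<dots> = A * (z * u * 1\<^sub>m n * (g * twist_elt))"
    unfolding zA using C AC by (simp add: assoc_mult_square[of _ n] mult_square_carrier[of _ n])
  also have "\<dots> = A * (z * u * z) * (z * g * twist_elt)"
    unfolding zz[symmetric] using C AC by (simp add: assoc_mult_square[of _ n] mult_square_carrier[of _ n])
  finally have "twist \<xi> (A * u * g) = \<xi> (A * (z * u * z) * (z * g * twist_elt))"
    by (simp add: twist_def z_def)
  also have "\<dots> = \<tau> a (\<xi> (z * g * twist_elt))"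
    using \<xi> a neg_levi_unip_conj[OF u] SO_mult[OF SO_mult[OF neg_levi_SO g] twist_elt_SO]
    by (simp add: induced_space_def A_def z_def)
  finally show "twist \<xi> (siegel_levi l a * u * g) = \<tau> a (twist \<xi> g)" by (simp add: A_def twist_def z_def)
qed

lemma twist_induced_whittaker:
  assumes f: "f \<in> induced_whittaker \<chi> l s \<tau>"
  shows "twist f \<in> induced_whittaker \<chi> l s \<tau>"
proof -
  interpret Modules.module "\<lambda>(z :: complex) (F :: 'f mat \<Rightarrow> 'f mat \<Rightarrow> complex) g a. z * F g a"
    by (rule module_two_argument_functions)
  let ?I = "induced_whittaker \<chi> l s \<tau>"
  have sub: "subspace ?I" unfolding induced_whittaker_def by (rule subspace_span)
  have "f \<in> {f. twist f \<in> ?I}"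
  proof (rule induced_whittaker_closed[OF f])
    fix \<Lambda> \<xi> assume \<Lambda>: "\<Lambda> \<in> Hom_char s \<tau> (U_GL l) (psi_GL \<chi> l)" "\<Lambda> \<noteq> (\<lambda>_. 0)"
      and \<xi>: "\<xi> \<in> induced_space l \<tau>"
    have "twist (\<lambda>g a. \<Lambda> (\<tau> a (\<xi> g))) = (\<lambda>g a. \<Lambda> (\<tau> a (twist \<xi> g)))"
      by (simp add: twist_def fun_eq_iff)
    also have "\<dots> \<in> ?I"
      unfolding induced_whittaker_def using \<Lambda> twist_induced_space[OF \<xi>] by (intro span_base) blast
    finally show "(\<lambda>g a. \<Lambda> (\<tau> a (\<xi> g))) \<in> {f. twist f \<in> ?I}" by simp
  next
    show "(\<lambda>g a. 0) \<in> {f. twist f \<in> ?I}"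
      using subspace_0[OF sub] by (simp add: twist_def[abs_def] zero_fun_def)
  next
    fix F G :: "'f mat \<Rightarrow> 'f mat \<Rightarrow> complex"
    assume "F \<in> {f. twist f \<in> ?I}" "G \<in> {f. twist f \<in> ?I}"
    then have "twist F + twist G \<in> ?I" using subspace_add[OF sub] by blast
    then show "(\<lambda>g a. F g a + G g a) \<in> {f. twist f \<in> ?I}"
      by (simp add: twist_def[abs_def] plus_fun_def)
  next
    fix z and F :: "'f mat \<Rightarrow> 'f mat \<Rightarrow> complex"
    assume "F \<in> {f. twist f \<in> ?I}"
    then have "(\<lambda>g a. z * twist F g a) \<in> ?I" using subspace_scale[OF sub] by blast
    then show "(\<lambda>g a. z * F g a) \<in> {f. twist f \<in> ?I}" by (simp add: twist_def[abs_def])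
  qed
  then show ?thesis by simp
qed

text \<open>The operator commutes with right translations; \<open>z\<close> commutes with the Weyl element and can be moved
  through the sum because conjugation by it permutes the unipotent radical.\<close>

lemma intertwining_twist:
  assumes h: "h \<in> carrier (SO (2 * l + 1))"
  shows "intertwining l (twist f) h a = twist (intertwining l f) h a"
proof -
  define n where "n = 2 * l + 1"
  define z where "z = (neg_levi l :: 'f mat)"
  define w where "w = (w_mat l :: 'f mat)"
  have C: "z \<in> carrier_mat n n" "h \<in> carrier_mat n n" "twist_elt \<in> carrier_mat n n" "w \<in> carrier_mat n n"
    unfolding z_def n_def w_def
    by (intro SO_carrier neg_levi_SO h twist_elt_SO w_mat_SO)+
  have zz: "z * z = 1\<^sub>m n" unfolding z_def n_def by (rule neg_levi_square)
  have wz: "w * z = z * w" unfolding w_def z_def by (rule w_mat_neg_levi)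
  have uC: "u \<in> carrier_mat n n" if "u \<in> siegel_unip l" for u
    using siegel_unip_carrier[OF that] by (simp add: n_def)
  have "z * (w * u * h) * twist_elt = w * (z * u * z) * (z * h * twist_elt)" if "u \<in> siegel_unip l" for u
  proof -
    have "z * (w * u * h) * twist_elt = z * w * (u * 1\<^sub>m n * h * twist_elt)"
      using C uC[OF that] by (simp add: assoc_mult_square[of _ n] mult_square_carrier[of _ n])
    also have "\<dots> = w * (z * u * z) * (z * h * twist_elt)"
      unfolding wz[symmetric] zz[symmetric] using C uC[OF that]
      by (simp only: assoc_mult_square[of _ n] mult_square_carrier[of _ n])
    finally show ?thesis .
  qed
  then have "intertwining l (twist f) h a =
      (\<Sum>u\<in>siegel_unip l. f (w * (z * u * z) * (z * h * twist_elt)) (d_mat l * star l a))"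
    unfolding intertwining_def twist_def by (intro sum.cong refl) (simp add: z_def w_def)
  also have "\<dots> = (\<Sum>u\<in>siegel_unip l. f (w * u * (z * h * twist_elt)) (d_mat l * star l a))"
  proof (rule sum.reindex_bij_witness[where i = "\<lambda>u. z * u * z" and j = "\<lambda>u. z * u * z"])
    fix u :: "'f mat" assume u: "u \<in> siegel_unip l"
    have "z * (z * u * z) * z = (z * z) * u * (z * z)"
      using C uC[OF u] by (simp only: assoc_mult_square[of _ n] mult_square_carrier[of _ n])
    also have "\<dots> = u" using uC[OF u] by (simp add: zz)
    finally have "z * (z * u * z) * z = u" .
    then show "z * (z * u * z) * z = u" "z * (z * u * z) * z = u" by simp_all
    show "z * u * z \<in> siegel_unip l" "z * u * z \<in> siegel_unip l"
      unfolding z_def by (rule neg_levi_unip_conj[OF u])+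
  qed simp
  also have "\<dots> = twist (intertwining l f) h a"
    by (simp add: intertwining_def twist_def z_def w_def)
  finally show ?thesis .
qed

section \<open>Zeta sums under the outer conjugation\<close>

definition whittaker_equivariant :: "('f \<Rightarrow> complex) \<Rightarrow> ('f mat \<Rightarrow> complex) \<Rightarrow> bool" where
  "whittaker_equivariant \<psi> W \<longleftrightarrow>
     (\<forall>u\<in>U_SO (2 * l). \<forall>g\<in>carrier (SO (2 * l)). W (u * g) = psi_SO \<psi> l u * W g)"

lemma wll_SO: "(wll_mat l :: 'f mat) \<in> carrier (SO (2 * l + 1))"
  unfolding wll_mat_eq[OF two] using two by (intro scalar_levi_SO[of _ 2]) simp

lemma wll_embed_SO: "(g :: 'f mat) \<in> carrier (SO (2 * l)) \<Longrightarrow> wll_mat l * embed l g \<in> carrier (SO (2 * l + 1))"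
  by (intro SO_mult wll_SO embed_SO[OF l two])

text \<open>The element \<open>w\<^bsub>l,l\<^esub>\<close> is a scalar of the Levi subgroup, so it commutes with the Levi part of an embedded
  unipotent element and normalises the rest.\<close>

lemma siegel_equivariant_embed:
  fixes \<psi> :: "'f \<Rightarrow> complex"
  assumes \<psi>: "\<psi> 0 = 1" and f: "siegel_equivariant (\<lambda>x. inverse (\<psi> x)) l f"
    and u: "u \<in> U_SO (2 * l)" and g: "g \<in> carrier (SO (2 * l))"
  shows "f (wll_mat l * embed l (u * g)) (1\<^sub>m l) = inverse (psi_SO \<psi> l u) * f (wll_mat l * embed l g) (1\<^sub>m l)"
proof -
  define n where "n = 2 * l + 1"
  obtain a v where a: "a \<in> U_GL l" and v: "v \<in> siegel_unip l"
    and uav: "embed l u = siegel_levi l a * v" and eq: "psi_GL \<psi> l a = psi_SO \<psi> l u"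
    using embed_U_SO_decomposition[of l u \<psi>] l two u \<psi> by blast
  have aGL: "a \<in> carrier (GL l)" using a by (simp add: U_GL_def)
  define w w' where "w = (wll_mat l :: 'f mat)" and "w' = siegel_levi l ((2 :: 'f) \<cdot>\<^sub>m 1\<^sub>m l)"
  define A where "A = siegel_levi l a"
  define E where "E = embed l g"
  have C: "A \<in> carrier_mat n n" "w \<in> carrier_mat n n" "w' \<in> carrier_mat n n" "E \<in> carrier_mat n n" "v \<in> carrier_mat n n"
  proof -
    show "A \<in> carrier_mat n n" unfolding A_def n_def siegel_levi_eq[OF aGL] by (rule levi_block_carrier)
    show "w \<in> carrier_mat n n" unfolding w_def n_def by (rule SO_carrier[OF wll_SO])
    show "w' \<in> carrier_mat n n"
      unfolding w'_def n_def using two by (intro scalar_levi_carrier[of _ "1 / 2"]) simp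
    show "E \<in> carrier_mat n n" unfolding E_def n_def by (rule embed_carrier[OF l two])
    show "v \<in> carrier_mat n n" unfolding n_def by (rule siegel_unip_carrier[OF v])
  qed
  have ww: "w' * w = 1\<^sub>m n"
    unfolding w_def w'_def n_def wll_mat_eq[OF two] using two by (intro scalar_levi_mult_inverse) simp
  have wA: "w * A = A * w"
    unfolding w_def A_def wll_mat_eq[OF two] using two by (intro scalar_levi_commute[of _ 2] aGL) simp
  have v': "w * v * w' \<in> siegel_unip l"
    unfolding w_def w'_def wll_mat_eq[OF two] using two by (intro scalar_levi_unip_conj v) simp
  have "embed l (u * g) = A * v * E"
    unfolding A_def E_def uav[symmetric]
    using u g by (intro embed_mult[OF l two]) (auto simp: U_SO_iff intro: SO_carrier)
  \<comment> \<open>Insert \<open>w' * w = 1\<close> after \<open>v\<close>.\<close>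
  then have "w * embed l (u * g) = w * A * (v * 1\<^sub>m n * E)"
    using C by (simp add: assoc_mult_square[of _ n] mult_square_carrier[of _ n])
  also have "\<dots> = A * (w * v * w') * (w * E)"
    unfolding wA ww[symmetric] using C by (simp only: assoc_mult_square[of _ n] mult_square_carrier[of _ n])
  finally have "f (w * embed l (u * g)) (1\<^sub>m l) = psi_GL (\<lambda>x. inverse (\<psi> x)) l a * f (w * E) (1\<^sub>m l)"
    using f a v' wll_embed_SO[OF g] unfolding siegel_equivariant_def A_def w_def E_def by simp
  then show ?thesis by (simp add: w_def E_def psi_GL_def flip: eq)
qed

text \<open>The characters of \<open>W\<close> and \<open>f\<close> cancel, so the summand is constant on cosets and the arbitrary
  representatives disappear; the sum over the group can then be reindexed freely.\<close>

lemma zeta_sum_group_sum: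
  fixes \<psi> :: "'f \<Rightarrow> complex"
  assumes \<psi>: "additive_character \<psi>"
    and W: "whittaker_equivariant \<psi> W" and f: "siegel_equivariant (\<lambda>x. inverse (\<psi> x)) l f"
  shows "of_nat (card (U_SO (2 * l) :: 'f mat set)) * zeta_sum l W f =
    (\<Sum>g\<in>carrier (SO (2 * l)). W g * f (wll_mat l * embed l g) (1\<^sub>m l))"
  unfolding zeta_sum_def Let_def
proof (rule group.sum_rcosets_representatives[OF SO_group U_SO_subgroup])
  have "carrier (SO (2 * l)) \<subseteq> (carrier_mat (2 * l) (2 * l) :: 'f mat set)" by (auto intro: SO_carrier)
  then show "finite (carrier (SO (2 * l)) :: 'f mat set)" by (rule finite_subset) (rule finite_carrier_mat)
  fix u g :: "'f mat" assume u: "u \<in> U_SO (2 * l)" and g: "g \<in> carrier (SO (2 * l))"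
  have "psi_SO \<psi> l u \<noteq> 0"
    using additive_character_nonzero[OF \<psi>] by (simp add: psi_SO_def)
  moreover have "\<psi> 0 = 1" using \<psi> by (simp add: additive_character_def)
  ultimately show "W (u \<otimes>\<^bsub>SO (2 * l)\<^esub> g) * f (wll_mat l * embed l (u \<otimes>\<^bsub>SO (2 * l)\<^esub> g)) (1\<^sub>m l) =
      W g * f (wll_mat l * embed l g) (1\<^sub>m l)"
    using W u g siegel_equivariant_embed[OF _ f u g] by (simp add: whittaker_equivariant_def)
qed

text \<open>The correspondence between the two Whittaker models. Only values on the group are compared, since
  the functions are arbitrary elsewhere.\<close>

definition reflected :: "('f mat \<Rightarrow> complex) \<Rightarrow> ('f mat \<Rightarrow> complex) \<Rightarrow> bool" where
  "reflected W W' \<longleftrightarrow> (\<forall>g\<in>carrier (SO (2 * l)). W' g = W (whittaker_reflection l * g * c_mat l))"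

lemma reflect_twice:
  assumes "g \<in> carrier (SO (2 * l))"
  shows "whittaker_reflection l * (whittaker_reflection l * g * c_mat l) * c_mat l = (g :: 'f mat)"
proof -
  define n where "n = 2 * l"
  define r where "r = (whittaker_reflection l :: 'f mat)"
  define c where "c = (c_mat l :: 'f mat)"
  have C: "r \<in> carrier_mat n n" "g \<in> carrier_mat n n" "c \<in> carrier_mat n n"
    unfolding r_def c_def n_def using rho_carrier[OF l two] SO_carrier[OF assms] c_mat_carrier[OF l] by auto
  have "r * (r * g * c) * c = (r * r) * g * (c * c)"
    using C by (simp only: assoc_mult_square[of _ n] mult_square_carrier[of _ n])
  also have "\<dots> = g"
    using C rho_square[OF l two] c_mat_square[OF l two] by (simp add: r_def c_def n_def)
  finally show ?thesis by (simp add: r_def c_def)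
qed

lemma reflected_sym: "reflected W W' \<Longrightarrow> reflected W' W"
  unfolding reflected_def using rho_g_c_SO[OF l two] reflect_twice by metis

lemma reflected_equivariant:
  assumes W: "whittaker_equivariant \<psi> W" and r: "reflected W W'"
  shows "whittaker_equivariant \<psi> W'"
  unfolding whittaker_equivariant_def
proof (intro ballI)
  fix u g :: "'f mat" assume u: "u \<in> U_SO (2 * l)" and g: "g \<in> carrier (SO (2 * l))"
  define n where "n = 2 * l"
  define r where "r = (whittaker_reflection l :: 'f mat)"
  define c where "c = (c_mat l :: 'f mat)"
  have C: "r \<in> carrier_mat n n" "g \<in> carrier_mat n n" "c \<in> carrier_mat n n" "u \<in> carrier_mat n n"
    unfolding r_def c_def n_def
    using rho_carrier[OF l two] SO_carrier[OF g] c_mat_carrier[OF l] U_SO_SO[OF u] SO_carrier by auto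
  have rr: "r * r = 1\<^sub>m n" unfolding r_def n_def by (rule rho_square[OF l two])
  have "r * (u * g) * c = r * u * 1\<^sub>m n * (g * c)"
    using C by (simp add: assoc_mult_square[of _ n] mult_square_carrier[of _ n])
  also have "\<dots> = r * u * r * (r * g * c)"
    unfolding rr[symmetric] using C by (simp only: assoc_mult_square[of _ n] mult_square_carrier[of _ n])
  finally have eq: "r * (u * g) * c = r * u * r * (r * g * c)" .
  have ug: "u * g \<in> carrier (SO (2 * l))" by (intro SO_mult U_SO_SO[OF u] g)
  have "W' (u * g) = W (r * (u * g) * c)"
    using assms(2) ug by (simp add: reflected_def r_def c_def)
  also have "\<dots> = W (r * u * r * (r * g * c))" by (simp only: eq)
  also have "\<dots> = psi_SO \<psi> l (r * u * r) * W (r * g * c)"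
    using W U_SO_rho_conj(1)[OF l two u] rho_g_c_SO[OF l two g]
    by (simp add: whittaker_equivariant_def r_def c_def)
  also have "\<dots> = psi_SO \<psi> l u * W' g"
    using assms(2) g U_SO_rho_conj(2)[OF l two u] by (simp add: reflected_def r_def c_def)
  finally show "W' (u * g) = psi_SO \<psi> l u * W' g" .
qed

text \<open>Insert \<open>\<rho> * \<rho> = 1\<close> after \<open>h\<close>: the two embedded factors \<open>\<rho>\<close> become \<open>- z\<close>, their signs cancel, and the
  first \<open>z\<close> commutes with \<open>w\<^bsub>l,l\<^esub>\<close>.\<close>

lemma wll_embed_reflect:
  assumes h: "h \<in> carrier (SO (2 * l))"
  shows "wll_mat l * embed l (whittaker_reflection l * h * c_mat l) =
    neg_levi l * (wll_mat l * embed l h) * twist_elt"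
proof -
  define n m where "n = 2 * l + 1" and "m = 2 * l"
  define r where "r = (whittaker_reflection l :: 'f mat)"
  define c where "c = (c_mat l :: 'f mat)"
  define z w where "z = (neg_levi l :: 'f mat)" and "w = (wll_mat l :: 'f mat)"
  define E X where "E = embed l h" and "X = embed l (r * c)"
  have C: "r \<in> carrier_mat m m" "h \<in> carrier_mat m m" "c \<in> carrier_mat m m"
    unfolding r_def c_def m_def
    using rho_carrier[OF l two] SO_carrier[OF h] c_mat_carrier[OF l] by auto
  have D: "z \<in> carrier_mat n n" "w \<in> carrier_mat n n" "E \<in> carrier_mat n n" "X \<in> carrier_mat n n"
    unfolding z_def w_def E_def X_def n_def
    by (intro SO_carrier neg_levi_SO wll_SO embed_carrier[OF l two])+
  have rr: "r * r = 1\<^sub>m m" unfolding r_def m_def by (rule rho_square[OF l two])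
  have Er: "embed l r = (- 1) \<cdot>\<^sub>m z"
    unfolding r_def z_def embed_rho[OF l two] by (rule levi_block_minus_one)
  have wz: "w * z = z * w"
    unfolding w_def z_def wll_mat_eq[OF two] using two
    by (intro scalar_levi_commute[of _ 2]) (auto simp: mem_GL_iff)
  have "r * h * c = r * h * 1\<^sub>m m * c" using C by (simp add: mult_square_carrier[of _ m])
  also have "\<dots> = r * (h * (r * (r * c)))"
    unfolding rr[symmetric] using C by (simp only: assoc_mult_square[of _ m] mult_square_carrier[of _ m])
  finally have "embed l (r * h * c) = embed l r * (E * (embed l r * X))"
    unfolding E_def X_def using C
    by (simp add: embed_mult[OF l two] m_def mult_square_carrier[of _ "2 * l"])
  also have "\<dots> = (- 1) \<cdot>\<^sub>m ((- 1) \<cdot>\<^sub>m (z * (E * (z * X))))"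
    unfolding Er using D
    by (simp add: mult_smult_assoc_mat[of _ n n _ n] mult_smult_distrib[of _ n n _ n] mult_square_carrier[of _ n])
  also have "\<dots> = z * (E * (z * X))"
    by (rule eq_matI) auto
  finally have "w * embed l (r * h * c) = w * z * (E * (z * X))"
    using D by (simp add: assoc_mult_square[of _ n] mult_square_carrier[of _ n])
  also have "\<dots> = z * (w * E) * (z * X)"
    unfolding wz using D by (simp only: assoc_mult_square[of _ n] mult_square_carrier[of _ n])
  finally show ?thesis by (simp add: r_def c_def z_def w_def E_def X_def twist_elt_def)
qed

text \<open>Substitute \<open>g = \<rho> * h * c\<close> in the sum over the group. The function \<open>f'\<close> is a parameter because
  twisting commutes with the intertwining operator only on the group.\<close>

lemma zeta_sum_reflected:
  fixes \<psi> :: "'f \<Rightarrow> complex"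
  assumes \<psi>: "additive_character \<psi>" and W: "whittaker_equivariant \<psi> W" and r: "reflected W W'"
    and f: "siegel_equivariant (\<lambda>x. inverse (\<psi> x)) l f" and f': "siegel_equivariant (\<lambda>x. inverse (\<psi> x)) l f'"
    and ff': "\<And>h. h \<in> carrier (SO (2 * l + 1)) \<Longrightarrow> f' h (1\<^sub>m l) = twist f h (1\<^sub>m l)"
  shows "zeta_sum l W' f = zeta_sum l W f'"
proof -
  let ?G = "carrier (SO (2 * l)) :: 'f mat set"
  let ?\<phi> = "\<lambda>g :: 'f mat. whittaker_reflection l * g * c_mat l"
  have "(\<Sum>g\<in>?G. W' g * f (wll_mat l * embed l g) (1\<^sub>m l)) =
      (\<Sum>h\<in>?G. W h * f' (wll_mat l * embed l h) (1\<^sub>m l))"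
  proof (rule sum.reindex_bij_witness[where i = ?\<phi> and j = ?\<phi>])
    fix g :: "'f mat" assume g: "g \<in> ?G"
    show "?\<phi> (?\<phi> g) = g" "?\<phi> (?\<phi> g) = g" by (rule reflect_twice[OF g])+
    show g': "?\<phi> g \<in> ?G" and "?\<phi> g \<in> ?G" by (rule rho_g_c_SO[OF l two g])+
    have "f' (wll_mat l * embed l (?\<phi> g)) (1\<^sub>m l) = f (wll_mat l * embed l g) (1\<^sub>m l)"
      using ff'[OF wll_embed_SO[OF g']] wll_embed_reflect[OF g'] reflect_twice[OF g]
      by (simp add: twist_def)
    then show "W (?\<phi> g) * f' (wll_mat l * embed l (?\<phi> g)) (1\<^sub>m l) = W' g * f (wll_mat l * embed l g) (1\<^sub>m l)"
      using r g by (simp add: reflected_def)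
  qed
  then have eq: "of_nat (card (U_SO (2 * l) :: 'f mat set)) * zeta_sum l W' f =
      of_nat (card (U_SO (2 * l) :: 'f mat set)) * zeta_sum l W f'"
    using zeta_sum_group_sum[OF \<psi> reflected_equivariant[OF W r] f] zeta_sum_group_sum[OF \<psi> W f'] by simp
  have "U_SO (2 * l) \<subseteq> (carrier_mat (2 * l) (2 * l) :: 'f mat set)" by (auto simp: U_SO_iff)
  then have "finite (U_SO (2 * l) :: 'f mat set)" by (rule finite_subset) (rule finite_carrier_mat)
  moreover have "(1\<^sub>m (2 * l) :: 'f mat) \<in> U_SO (2 * l)" by (auto simp: U_SO_iff upper_triangular_def)
  ultimately have "card (U_SO (2 * l) :: 'f mat set) \<noteq> 0" by auto
  then show ?thesis using eq by simp
qed

section \<open>Whittaker models and the gamma factor\<close>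

lemma whittaker_SO_equivariant:
  assumes \<pi>: "representation s (SO (2 * l)) \<pi>" and W: "W \<in> whittaker_SO \<psi> l s \<pi>"
  shows "whittaker_equivariant \<psi> W"
  unfolding whittaker_equivariant_def
proof (intro ballI)
  fix u g :: "'f mat" assume u: "u \<in> U_SO (2 * l)" and g: "g \<in> carrier (SO (2 * l))"
  obtain \<Gamma> v where \<Gamma>: "\<Gamma> \<in> Hom_char s \<pi> (U_SO (2 * l)) (psi_SO \<psi> l)" and eq: "W = (\<lambda>g. \<Gamma> (\<pi> g v))"
    using W by (auto simp: whittaker_SO_def)
  have "\<pi> (u * g) = \<pi> u \<circ> \<pi> g" using \<pi> U_SO_SO[OF u] g by (simp add: representation_def)
  then show "W (u * g) = psi_SO \<psi> l u * W g" using \<Gamma> u by (simp add: eq Hom_char_def)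
qed

text \<open>Transport of a Whittaker functional along a surjection \<open>T\<close> that intertwines two actions of \<open>U\<close> up to
  replacing an element by one with the same character value.\<close>

lemma hom_char_translate:
  fixes \<pi> :: "'f mat \<Rightarrow> 'v::ab_group_add \<Rightarrow> 'v"
  assumes \<Gamma>: "\<Gamma> \<in> Hom_char s \<pi>1 U \<chi>" "\<Gamma> \<noteq> (\<lambda>_. 0)"
    and lin: "Vector_Spaces.linear s s T" and surj: "\<And>v. \<exists>w. T w = v"
    and T: "\<And>u v. u \<in> U \<Longrightarrow> \<exists>u'\<in>U. \<chi> u' = \<chi> u \<and> T (\<pi>2 u v) = \<pi>1 u' (T v)"
  shows "(\<lambda>v. \<Gamma> (T v)) \<in> Hom_char s \<pi>2 U \<chi>" "(\<lambda>v. \<Gamma> (T v)) \<noteq> (\<lambda>_. 0)"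
proof -
  have "Vector_Spaces.linear s (*) (\<Gamma> \<circ> T)"
    by (rule Vector_Spaces.linear_compose[OF lin]) (use \<Gamma>(1) in \<open>simp add: Hom_char_def\<close>)
  moreover have "\<Gamma> (T (\<pi>2 u v)) = \<chi> u * \<Gamma> (T v)" if "u \<in> U" for u v
    using T[OF that, of v] \<Gamma>(1) by (auto simp: Hom_char_def)
  ultimately show "(\<lambda>v. \<Gamma> (T v)) \<in> Hom_char s \<pi>2 U \<chi>" by (auto simp: Hom_char_def comp_def)
  obtain v where "\<Gamma> v \<noteq> 0" using \<Gamma>(2) by (auto simp: fun_eq_iff)
  moreover obtain w where "T w = v" using surj by blast
  ultimately have "\<Gamma> (T w) \<noteq> 0" by simp
  then show "(\<lambda>v. \<Gamma> (T v)) \<noteq> (\<lambda>_. 0)" by metis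
qed

text \<open>With \<open>t = \<rho> * c\<close> in the special orthogonal group, composing with \<open>\<pi> t\<close> or its inverse exchanges the
  functionals for \<open>\<pi>\<close> and for its conjugate, because \<open>t * (c * u * c) = (\<rho> * u * \<rho>) * t\<close>; moreover
  \<open>\<rho> * g * c = t * (c * g * c)\<close> relates the resulting functions.\<close>

lemma whittaker_SO_outer_conj:
  fixes \<pi> :: "'f mat \<Rightarrow> 'v::ab_group_add \<Rightarrow> 'v"
  assumes \<pi>: "representation s (SO (2 * l)) \<pi>"
  shows "\<And>W. W \<in> whittaker_SO \<psi> l s \<pi> \<Longrightarrow> \<exists>W'\<in>whittaker_SO \<psi> l s (outer_conj l \<pi>). reflected W W'"
    and "\<And>W'. W' \<in> whittaker_SO \<psi> l s (outer_conj l \<pi>) \<Longrightarrow> \<exists>W\<in>whittaker_SO \<psi> l s \<pi>. reflected W W'"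
proof -
  define n where "n = 2 * l"
  define r where "r = (whittaker_reflection l :: 'f mat)"
  define c where "c = (c_mat l :: 'f mat)"
  define t t' where "t = r * c" and "t' = c * r"
  have C: "r \<in> carrier_mat n n" "c \<in> carrier_mat n n"
    unfolding r_def c_def n_def using rho_carrier[OF l two] c_mat_carrier[OF l] by auto
  have rr: "r * r = 1\<^sub>m n" and cc: "c * c = 1\<^sub>m n"
    unfolding r_def c_def n_def by (rule rho_square[OF l two], rule c_mat_square[OF l two])
  have tt': "t * t' = 1\<^sub>m n"
  proof -
    have "t * t' = r * (c * c) * r" unfolding t_def t'_def using C
      by (simp only: assoc_mult_square[of _ n] mult_square_carrier[of _ n])
    then show ?thesis using C by (simp add: cc rr)
  qed
  have t: "t \<in> carrier (SO n)" unfolding t_def r_def c_def n_def by (rule rho_c_SO[OF l two])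
  have tC: "t \<in> carrier_mat n n" "t' \<in> carrier_mat n n" unfolding t_def t'_def using C by (auto intro: mult_square_carrier)
  have t't: "t' * t = 1\<^sub>m n" by (rule mat_mult_left_right_inverse[OF tC tt'])
  have t': "t' \<in> carrier (SO n)"
  proof -
    have "t' = flip t * (t * t')"
      using t tC by (simp add: mem_SO_iff flip: assoc_mult_square[of _ n])
    also have "\<dots> = flip t" using tC by (simp add: tt')
    finally show ?thesis using SO_flip[OF t] by simp
  qed
  have mult: "\<pi> (g * h) v = \<pi> g (\<pi> h v)" if "g \<in> carrier (SO n)" "h \<in> carrier (SO n)" for g h v
    using \<pi> that by (simp add: representation_def n_def)
  have one: "\<pi> (1\<^sub>m n) v = v" for v using \<pi> by (simp add: representation_def n_def)
  have lin: "Vector_Spaces.linear s s (\<pi> g)" if "g \<in> carrier (SO n)" for g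
    using \<pi> that by (simp add: representation_def n_def)
  have inv: "\<pi> t (\<pi> t' v) = v" "\<pi> t' (\<pi> t v) = v" for v
    using mult[OF t t', of v] mult[OF t' t, of v] by (simp_all add: tt' t't one)
  have cgc: "c * g * c \<in> carrier (SO n)" and rgc: "r * g * c = t * (c * g * c)" and rgc': "t' * (r * g * c) = c * g * c"
    if g: "g \<in> carrier (SO n)" for g
  proof -
    have gC: "g \<in> carrier_mat n n" by (rule SO_carrier[OF g])
    have "t * (c * g * c) = r * (c * c) * g * c"
      unfolding t_def using C gC by (simp only: assoc_mult_square[of _ n] mult_square_carrier[of _ n])
    then show e: "r * g * c = t * (c * g * c)" using C by (simp add: cc)
    have "t' * (r * g * c) = c * (r * r) * g * c"
      unfolding t'_def using C gC by (simp only: assoc_mult_square[of _ n] mult_square_carrier[of _ n])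
    then show e': "t' * (r * g * c) = c * g * c" using C by (simp add: rr)
    show "c * g * c \<in> carrier (SO n)"
      unfolding e'[symmetric] using rho_g_c_SO[OF l two g[unfolded n_def]]
      by (intro SO_mult[OF t']) (simp add: r_def c_def n_def)
  qed
  have conj: "r * u * r \<in> U_SO n" "psi_SO \<psi> l (r * u * r) = psi_SO \<psi> l u" if "u \<in> U_SO n" for u
    using U_SO_rho_conj[OF l two, of u] that by (simp_all add: r_def n_def)
  have uC: "u \<in> carrier_mat n n" if "u \<in> U_SO n" for u using that by (simp add: U_SO_iff)
  show "\<exists>W'\<in>whittaker_SO \<psi> l s (outer_conj l \<pi>). reflected W W'" if W: "W \<in> whittaker_SO \<psi> l s \<pi>" for W
  proof -
    obtain \<Gamma> v where \<Gamma>: "\<Gamma> \<in> Hom_char s \<pi> (U_SO n) (psi_SO \<psi> l)" "\<Gamma> \<noteq> (\<lambda>_. 0)" and W: "W = (\<lambda>g. \<Gamma> (\<pi> g v))"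
      using W unfolding whittaker_SO_def n_def by blast
    have tr: "\<exists>u'\<in>U_SO n. psi_SO \<psi> l u' = psi_SO \<psi> l u \<and> \<pi> t (outer_conj l \<pi> u v) = \<pi> u' (\<pi> t v)"
      if u: "u \<in> U_SO n" for u v
    proof (intro bexI[OF _ conj(1)[OF u]] conjI conj(2)[OF u])
      have "t * (c * u * c) = r * (c * c) * u * c"
        unfolding t_def using C uC[OF u] by (simp only: assoc_mult_square[of _ n] mult_square_carrier[of _ n])
      also have "\<dots> = r * u * 1\<^sub>m n * c" using C uC[OF u] by (simp add: cc mult_square_carrier[of _ n])
      also have "\<dots> = r * u * r * t"
        unfolding rr[symmetric] t_def using C uC[OF u]
        by (simp only: assoc_mult_square[of _ n] mult_square_carrier[of _ n])
      finally show "\<pi> t (outer_conj l \<pi> u v) = \<pi> (r * u * r) (\<pi> t v)"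
        using mult[OF t cgc[OF U_SO_SO[OF u]]] mult[OF U_SO_SO[OF conj(1)[OF u]] t]
        by (simp add: outer_conj_def c_def[symmetric])
    qed
    have "\<exists>w. \<pi> t w = v" for v using inv by blast
    from hom_char_translate[OF \<Gamma> lin[OF t] this tr]
    have h: "(\<lambda>v. \<Gamma> (\<pi> t v)) \<in> Hom_char s (outer_conj l \<pi>) (U_SO n) (psi_SO \<psi> l)"
      "(\<lambda>v. \<Gamma> (\<pi> t v)) \<noteq> (\<lambda>_. 0)" by blast+
    have "(\<lambda>g. \<Gamma> (\<pi> t (outer_conj l \<pi> g v))) \<in> whittaker_SO \<psi> l s (outer_conj l \<pi>)"
      unfolding whittaker_SO_def mem_Collect_eq using h unfolding n_def
      by (intro exI[of _ "\<lambda>v. \<Gamma> (\<pi> t v)"] exI[of _ v] conjI) simp_all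
    moreover have "reflected W (\<lambda>g. \<Gamma> (\<pi> t (outer_conj l \<pi> g v)))"
      unfolding reflected_def W
    proof
      fix g :: "'f mat" assume "g \<in> carrier (SO (2 * l))"
      then have g: "g \<in> carrier (SO n)" by (simp add: n_def)
      show "\<Gamma> (\<pi> t (outer_conj l \<pi> g v)) = \<Gamma> (\<pi> (whittaker_reflection l * g * c_mat l) v)"
        using mult[OF t cgc[OF g]] rgc[OF g] by (simp add: outer_conj_def c_def r_def)
    qed
    ultimately show ?thesis by blast
  qed
  show "\<exists>W\<in>whittaker_SO \<psi> l s \<pi>. reflected W W'" if W: "W' \<in> whittaker_SO \<psi> l s (outer_conj l \<pi>)" for W'
  proof -
    obtain \<Gamma> v where \<Gamma>: "\<Gamma> \<in> Hom_char s (outer_conj l \<pi>) (U_SO n) (psi_SO \<psi> l)" "\<Gamma> \<noteq> (\<lambda>_. 0)"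
      and W: "W' = (\<lambda>g. \<Gamma> (outer_conj l \<pi> g v))"
      using W unfolding whittaker_SO_def n_def by blast
    have tr: "\<exists>u'\<in>U_SO n. psi_SO \<psi> l u' = psi_SO \<psi> l u \<and> \<pi> t' (\<pi> u v) = outer_conj l \<pi> u' (\<pi> t' v)"
      if u: "u \<in> U_SO n" for u v
    proof (intro bexI[OF _ conj(1)[OF u]] conjI conj(2)[OF u])
      have "c * (r * u * r) * c * t' = c * (r * u * (r * (c * c) * r))"
        unfolding t'_def using C uC[OF u] by (simp only: assoc_mult_square[of _ n] mult_square_carrier[of _ n])
      also have "\<dots> = t' * u"
        unfolding t'_def using C uC[OF u]
        by (simp add: cc rr mult_square_carrier[of _ n] assoc_mult_square[of _ n])
      finally show "\<pi> t' (\<pi> u v) = outer_conj l \<pi> (r * u * r) (\<pi> t' v)"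
        using mult[OF t' U_SO_SO[OF u]] mult[OF cgc[OF U_SO_SO[OF conj(1)[OF u]]] t']
        by (simp add: outer_conj_def c_def[symmetric])
    qed
    have "\<exists>w. \<pi> t' w = v" for v using inv by blast
    from hom_char_translate[OF \<Gamma> lin[OF t'] this tr]
    have h: "(\<lambda>v. \<Gamma> (\<pi> t' v)) \<in> Hom_char s \<pi> (U_SO n) (psi_SO \<psi> l)"
      "(\<lambda>v. \<Gamma> (\<pi> t' v)) \<noteq> (\<lambda>_. 0)" by blast+
    have "(\<lambda>g. \<Gamma> (\<pi> t' (\<pi> g v))) \<in> whittaker_SO \<psi> l s \<pi>"
      unfolding whittaker_SO_def mem_Collect_eq using h unfolding n_def
      by (intro exI[of _ "\<lambda>v. \<Gamma> (\<pi> t' v)"] exI[of _ v] conjI) simp_all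
    moreover have "reflected (\<lambda>g. \<Gamma> (\<pi> t' (\<pi> g v))) W'"
      unfolding reflected_def W
    proof
      fix g :: "'f mat" assume g': "g \<in> carrier (SO (2 * l))"
      then have g: "g \<in> carrier (SO n)" by (simp add: n_def)
      have "r * g * c \<in> carrier (SO n)" using rho_g_c_SO[OF l two g'] by (simp add: r_def c_def n_def)
      then show "\<Gamma> (outer_conj l \<pi> g v) = \<Gamma> (\<pi> t' (\<pi> (whittaker_reflection l * g * c_mat l) v))"
        using mult[OF t', of "r * g * c" v] rgc'[OF g] by (simp add: outer_conj_def c_def r_def)
    qed
    ultimately show ?thesis by blast
  qed
qed

text \<open>A constant satisfies the functional equation at \<open>W'\<close> and \<open>f\<close> exactly when it satisfies the one at \<open>W\<close>
  and the twist of \<open>f\<close>.\<close>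

lemma functional_equation_reflected:
  fixes \<psi> :: "'f \<Rightarrow> complex"
  assumes \<psi>: "additive_character \<psi>" and \<tau>: "representation s (GL l) \<tau>"
    and W: "whittaker_equivariant \<psi> W" and r: "reflected W W'"
    and f: "f \<in> induced_whittaker (\<lambda>x. inverse (\<psi> x)) l s \<tau>"
  shows "\<gamma> * zeta_sum l W' f = zeta_sum l W' (intertwining l f) \<longleftrightarrow>
    \<gamma> * zeta_sum l W (twist f) = zeta_sum l W (intertwining l (twist f))"
proof -
  note tf = twist_induced_whittaker[OF f]
  have "zeta_sum l W' f = zeta_sum l W (twist f)"
    by (rule zeta_sum_reflected[OF \<psi> W r siegel_equivariant_induced[OF \<tau> f] siegel_equivariant_induced[OF \<tau> tf]]) simp
  moreover have "zeta_sum l W' (intertwining l f) = zeta_sum l W (intertwining l (twist f))"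
    by (rule zeta_sum_reflected[OF \<psi> W r siegel_equivariant_intertwining[OF \<tau> f]
          siegel_equivariant_intertwining[OF \<tau> tf] intertwining_twist])
  ultimately show ?thesis by simp
qed

end

theorem corollary7p8:
  fixes p r l :: nat
    and \<psi> :: "'f::{field, finite} \<Rightarrow> complex"
    and sV :: "complex \<Rightarrow> 'v::ab_group_add \<Rightarrow> 'v"
    and \<pi> :: "'f mat \<Rightarrow> 'v \<Rightarrow> 'v"
    and sW :: "complex \<Rightarrow> 'w::ab_group_add \<Rightarrow> 'w"
    and \<tau> :: "'f mat \<Rightarrow> 'w \<Rightarrow> 'w"
  assumes "prime p" and "odd p" and "CARD('f) = p ^ r"
    and "l \<ge> 1"
    and "additive_character \<psi>" and "\<exists>x. \<psi> x \<noteq> 1"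
    and "irreducible_rep sV (SO (2 * l)) \<pi>"
    and "cuspidal_SO (2 * l) \<pi>"
    and "generic_SO \<psi> l sV \<pi>"
    and "irreducible_rep sW (GL l) \<tau>"
    and "generic_GL \<psi> l sW \<tau>"
  shows "gamma_factor \<psi> l sV \<pi> sW \<tau> = gamma_factor \<psi> l sV (outer_conj l \<pi>) sW \<tau>"
proof -
  have "odd CARD('f)" using assms(2,3) by simp
  then have two: "(2 :: 'f) \<noteq> 0" by (rule two_nonzero_of_odd_card)
  note l = assms(4) and \<psi> = assms(5)
  have \<pi>: "representation sV (SO (2 * l)) \<pi>" and \<tau>: "representation sW (GL l) \<tau>"
    using assms(7,10) by (simp_all add: irreducible_rep_def)
  let ?I = "induced_whittaker (\<lambda>x. inverse (\<psi> x)) l sW \<tau>"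
  let ?eq = "\<lambda>\<gamma> W f. \<gamma> * zeta_sum l W f = zeta_sum l W (intertwining l f)"
  note model = whittaker_SO_outer_conj[OF l two \<pi>, of _ \<psi>]
  have step: "?eq \<gamma> W' f" if "whittaker_equivariant l \<psi> W" "reflected l W W'" "f \<in> ?I" "\<forall>f\<in>?I. ?eq \<gamma> W f" for \<gamma> W W' f
    using functional_equation_reflected[OF l two \<psi> \<tau> that(1,2,3)] twist_induced_whittaker[OF l two that(3)] that(4)
    by blast
  have "(\<forall>W\<in>whittaker_SO \<psi> l sV \<pi>. \<forall>f\<in>?I. ?eq \<gamma> W f) \<longleftrightarrow>
      (\<forall>W\<in>whittaker_SO \<psi> l sV (outer_conj l \<pi>). \<forall>f\<in>?I. ?eq \<gamma> W f)" for \<gamma>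
  proof (intro iffI ballI)
    fix W' f assume eq: "\<forall>W\<in>whittaker_SO \<psi> l sV \<pi>. \<forall>f\<in>?I. ?eq \<gamma> W f"
      and W': "W' \<in> whittaker_SO \<psi> l sV (outer_conj l \<pi>)" and f: "f \<in> ?I"
    obtain W where W: "W \<in> whittaker_SO \<psi> l sV \<pi>" "reflected l W W'" using model(2)[OF W'] by blast
    show "?eq \<gamma> W' f"
      using eq W by (intro step[OF whittaker_SO_equivariant[OF l two \<pi> W(1)] W(2) f]) blast
  next
    fix W f assume eq: "\<forall>W\<in>whittaker_SO \<psi> l sV (outer_conj l \<pi>). \<forall>f\<in>?I. ?eq \<gamma> W f"
      and W: "W \<in> whittaker_SO \<psi> l sV \<pi>" and f: "f \<in> ?I"
    obtain W' where W': "W' \<in> whittaker_SO \<psi> l sV (outer_conj l \<pi>)" "reflected l W W'" using model(1)[OF W] by blast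
    have "whittaker_equivariant l \<psi> W'"
      by (rule reflected_equivariant[OF l two whittaker_SO_equivariant[OF l two \<pi> W] W'(2)])
    then show "?eq \<gamma> W f"
      using eq W' by (intro step[OF _ reflected_sym[OF l two W'(2)] f]) blast+
  qed
  then show ?thesis by (simp add: gamma_factor_def)
qed

end
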